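(* Let $m\ge 3$ and $k\ge1$ be integers, let $M>0$, and let $f:\mathbb{R}\times\mathbb{R}^{k}\to\mathbb{R}^{k}$ be a continuous function such that for all $t\in\mathbb{R}$, $x\in\mathbb{R}^k$: (1) $f(t+2\pi,x)=f(t,x)$; (2) $f(-t,x)=f(t,x)$; (3) $f(t,-x)=-f(t,x)$; (4) there is a symmetric real $k\times k$ matrix $A$ such that $\lim_{x\to0}\frac{f(t,x)-Ax}{|x|}=0$ uniformly in $t\in\mathbb{R}$, and $\frac{j^2}{m^2}+\mu\neq0$ for all integers $j\ge0$ and all $\mu\in\sigma(A)$; (5) $f(t,x)\bullet x>0$ whenever $|x|\ge M$ (where $\bullet$ is the Euclidean inner product). Write $m=2^{\varepsilon_0}p_1^{\varepsilon_1}\cdots p_s^{\varepsilon_s}$ with $\varepsilon_0\ge0$, $\varepsilon_l>0$ and primes $2<p_1<p_2<\dots<p_s$, and put $m_l:=m/p_l$ for $l=1,\dots,s$. Let $G=D_m\times\mathbb{Z}_2$, $\mathfrak{s}=\lfloor\frac{m+1}{2}\rfloor$, and let the numbers $\rho_i$ be as defined in the context. Consider the system $\ddot u(t)=f(t,u(t))$, $u(t)\in\mathbb{R}^k$. Then: (i) if $\rho_0$ is odd, the system admits a $G$-orbit of $2\pi m$-periodic solutions with symmetries $(D_m)$; (ii) if $\rho_{\mathfrak{s}}$ is odd, the system admits a $G$-orbit of $2\pi m$-periodic solutions with symmetries $(D_m^z)$; (iii) if for some $l\in\{1,\dots,s\}$ the number $\rho_{m_l}$ is odd, the system admits a $G$-orbit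 of $2\pi m$-periodic solutions with symmetries either $(D_{m_l}^z)$ or $(D_m^z)$; (iv) if $\varepsilon_0>0$ and $\rho_{\mathfrak{s}+1}$ is odd, the system admits a $G$-orbit of $2\pi m$-periodic solutions with symmetries exactly $(D_m^d)$; (v) if $\varepsilon_0>0$ and $\rho_{\mathfrak{s}+2}$ is odd, the system admits a $G$-orbit of $2\pi m$-periodic solutions with symmetries exactly $(D_m^{\hat d})$; (vi) if $\varepsilon_0>0$ and for some integer $q$ with $2\le q\le\varepsilon_0$ the number $\rho_{m/2^{q}}$ is odd, the system admits a $G$-orbit of $2\pi m$-periodic solutions with symmetries exactly $(D_{m/2^{q-1}}^{d})$ and a $G$-orbit of $2\pi m$-periodic solutions with symmetries exactly $(\widetilde D_{m/2^{q-1}}^{d})$.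
   Context: **Group action.** Let $\mathbb{E}=C^2_{2\pi m}(\mathbb{R},\mathbb{R}^k)$ be the space of $2\pi m$-periodic $C^2$ functions. $D_m$ is the dihedral group of order $2m$ generated by the rotation $\gamma$ of order $m$ and the reflection $\kappa$, with $\kappa\gamma\kappa=\gamma^{-1}$. The group $G=D_m\times\mathbb{Z}_2$, $\mathbb{Z}_2=\{\pm1\}$, acts on $\mathbb{E}$ by $((\gamma^j,\pm1)u)(t)=\pm u(t+2\pi j)$ and $((\kappa,\pm1)u)(t)=\pm u(-t)$. For $u\in\mathbb{E}$, $G_u=\{g\in G: gu=u\}$. "The system admits a $G$-orbit of $2\pi m$-periodic solutions with symmetries $(H)$" means: there is a solution $u\in\mathbb{E}$ whose isotropy group $G_u$ is conjugate in $G$ to $H$. **Subgroups of $G$.** For $n\mid m$: $D_n$ is generated by $(\gamma^{m/n},1)$ and $(\kappa,1)$; $D_n^z$ is generated by $(\gamma^{m/n},1)$ and $(\kappa,-1)$. For even $n\mid m$: $D_n^d$ is generated by $(\gamma^{m/n},-1)$ and $(\kappa,1)$; $D_n^{\hat d}$ is generated by $(\gamma^{m/n},-1)$ and $(\kappa,-1)$; $\widetilde D_n^d$ is generated by $(\gamma^{m/n},-1)$ and $(\gamma\kappa,1)$. **The numbers $\rho_i$.** Let $\sigma_-(A)$ be the set of negative eigenvalues of $A$ and $\mathfrak{m}(\mu)$ the multiplicity of the eigenvalue $\mu$. For $\mu\in\sigma_-(A)$ let $\mathfrak{j}_\mu\ge0$ be the integer with $-\frac{(\mathfrak{j}_\mu+1)^2}{m^2}<\mu<-\frac{\mathfrak{j}_\mu^2}{m^2}$,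 let $b_\mu=\lfloor \mathfrak{j}_\mu/m\rfloor$ and $\alpha_\mu=\mathfrak{j}_\mu-b_\mu m\in\{0,\dots,m-1\}$. Define - $\beta_0(\mu)=(b_\mu+1)\mathfrak{m}(\mu)$ and $\beta_{\mathfrak{s}}(\mu)=b_\mu\,\mathfrak{m}(\mu)$; - if $m$ is even, for $i=\mathfrak{s}+1,\mathfrak{s}+2$: $\beta_i(\mu)=b_\mu\mathfrak{m}(\mu)$ if $\alpha_\mu<\frac m2$, and $\beta_i(\mu)=(b_\mu+1)\mathfrak{m}(\mu)$ if $\alpha_\mu\ge\frac m2$; - for $0<i<\frac m2$: $\beta_i(\mu)=2b_\mu\mathfrak{m}(\mu)$ if $\alpha_\mu<i$; $\beta_i(\mu)=(2b_\mu+1)\mathfrak{m}(\mu)$ if $i\le\alpha_\mu<m-i$; $\beta_i(\mu)=2(b_\mu+1)\mathfrak{m}(\mu)$ if $m-i\le\alpha_\mu$. Put $\eta_i=\sum_{\mu\in\sigma_-(A)}\beta_i(\mu)$. Finally $\rho_0=\eta_0$, $\rho_{\mathfrak{s}}=\eta_{\mathfrak{s}}$, $\rho_{\mathfrak{s}+1}=\eta_{\mathfrak{s}+1}$, $\rho_{\mathfrak{s}+2}=\eta_{\mathfrak{s}+2}$, and for $0<i<\frac m2$, $\rho_i=\sum_{i'}\eta_{i'}$, the sum being over all integers $0<i'<\frac m2$ with $\gcd(i',m)=\gcd(i,m)$. *)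

theory Defs
  imports "HOL-Analysis.Analysis" "HOL-Algebra.Generated_Groups" "HOL-Algebra.Group_Action"
    "HOL-Algebra.Sym_Groups"
begin

section \<open>The group \<open>D\<^sub>m \<times> \<int>\<^sub>2\<close>\<close>

text \<open>
  The pair \<open>(j, e)\<close> stands for \<open>\<gamma>\<^sup>j\<close> if \<open>e\<close> is false and for \<open>\<gamma>\<^sup>j\<kappa>\<close> if \<open>e\<close> is true; the
  exponent \<open>j\<close> is taken modulo \<open>m\<close>, and the product is dictated by \<open>\<kappa>\<gamma>\<^sup>j = \<gamma>\<^sup>-\<^sup>j\<kappa>\<close>.
\<close>

definition dihedral :: "nat \<Rightarrow> (int \<times> bool) monoid" where
  "dihedral m =
    \<lparr> carrier = {0..<int m} \<times> UNIV,
      mult = (\<lambda>(i, a) (j, b). ((if a then i - j else i + j) mod int m, a \<noteq> b)),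
      one = (0, False) \<rparr>"

text \<open>For \<open>m \<le> 1\<close> the pair \<open>(1, False)\<close> is not in the carrier; only \<open>m \<ge> 3\<close> is of interest.\<close>

definition rot :: "int \<times> bool" where "rot = (1, False)"

definition flip :: "int \<times> bool" where "flip = (0, True)"

text \<open>The group \<open>\<int>\<^sub>2 = {\<plusminus>1}\<close> is \<^const>\<open>sign_img\<close>.\<close>

definition symgroup :: "nat \<Rightarrow> ((int \<times> bool) \<times> int) monoid" where
  "symgroup m = dihedral m \<times>\<times> sign_img"

definition D_sub :: "nat \<Rightarrow> nat \<Rightarrow> ((int \<times> bool) \<times> int) set" where
  "D_sub m n = generate (symgroup m) {(rot [^]\<^bsub>dihedral m\<^esub> (m div n), 1), (flip, 1)}"

definition Dz_sub :: "nat \<Rightarrow> nat \<Rightarrow> ((int \<times> bool) \<times> int) set" where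
  "Dz_sub m n = generate (symgroup m) {(rot [^]\<^bsub>dihedral m\<^esub> (m div n), 1), (flip, -1)}"

definition Dd_sub :: "nat \<Rightarrow> nat \<Rightarrow> ((int \<times> bool) \<times> int) set" where
  "Dd_sub m n = generate (symgroup m) {(rot [^]\<^bsub>dihedral m\<^esub> (m div n), -1), (flip, 1)}"

definition Ddhat_sub :: "nat \<Rightarrow> nat \<Rightarrow> ((int \<times> bool) \<times> int) set" where
  "Ddhat_sub m n = generate (symgroup m) {(rot [^]\<^bsub>dihedral m\<^esub> (m div n), -1), (flip, -1)}"

definition Ddtilde_sub :: "nat \<Rightarrow> nat \<Rightarrow> ((int \<times> bool) \<times> int) set" where
  "Ddtilde_sub m n = generate (symgroup m)
     {(rot [^]\<^bsub>dihedral m\<^esub> (m div n), -1), (rot \<otimes>\<^bsub>dihedral m\<^esub> flip, 1)}"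

definition conjugate_in :: "('a, 'b) monoid_scheme \<Rightarrow> 'a set \<Rightarrow> 'a set \<Rightarrow> bool" where
  "conjugate_in G H K \<longleftrightarrow>
    (\<exists>g\<in>carrier G. H = (\<lambda>h. g \<otimes>\<^bsub>G\<^esub> h \<otimes>\<^bsub>G\<^esub> inv\<^bsub>G\<^esub> g) ` K)"

section \<open>The function space and the action\<close>

definition C2_periodic :: "nat \<Rightarrow> (real \<Rightarrow> real ^ 'k) set" where
  "C2_periodic m =
    {u. (\<forall>t. u (t + 2 * pi * real m) = u t) \<and>
        (\<exists>D. (\<forall>t. (u has_vector_derivative D t) (at t)) \<and> D C1_differentiable_on UNIV)}"

text \<open>
  This is the left action given on generators by \<open>(\<gamma>\<^sup>j, s)u(t) = s u(t + 2\<pi>j)\<close> and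
  \<open>(\<kappa>, s)u(t) = s u(-t)\<close>; hence \<open>\<gamma>\<^sup>j\<kappa>\<close> sends \<open>u\<close> to \<open>t \<mapsto> u(-(t + 2\<pi>j))\<close>.
\<close>

definition sym_act ::
    "(int \<times> bool) \<times> int \<Rightarrow> (real \<Rightarrow> real ^ 'k) \<Rightarrow> (real \<Rightarrow> real ^ 'k)" where
  "sym_act = (\<lambda>((j, e), s) u t.
     of_int s *\<^sub>R u (if e then - (t + 2 * pi * of_int j) else t + 2 * pi * of_int j))"

definition is_solution :: "(real \<Rightarrow> real ^ 'k \<Rightarrow> real ^ 'k) \<Rightarrow> (real \<Rightarrow> real ^ 'k) \<Rightarrow> bool" where
  "is_solution f u \<longleftrightarrow>
    (\<forall>t. vector_derivative (\<lambda>s. vector_derivative u (at s)) (at t) = f t (u t))"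

definition admits_orbit ::
    "nat \<Rightarrow> (real \<Rightarrow> real ^ 'k \<Rightarrow> real ^ 'k) \<Rightarrow> ((int \<times> bool) \<times> int) set \<Rightarrow> bool" where
  "admits_orbit m f H \<longleftrightarrow>
    (\<exists>u \<in> C2_periodic m. is_solution f u \<and>
       conjugate_in (symgroup m) (stabilizer (symgroup m) sym_act u) H)"

section \<open>Spectrum and the numbers \<open>\<rho>\<^sub>i\<close>\<close>

text \<open>
  Real eigenvalues only, and multiplicity as the dimension of the eigenspace. For the symmetric
  matrices considered, all eigenvalues are real and both multiplicities agree.
\<close>

definition eigenspace :: "real ^ 'k ^ 'k \<Rightarrow> real \<Rightarrow> (real ^ 'k) set" where
  "eigenspace A \<mu> = {v. A *v v = \<mu> *\<^sub>R v}"

definition real_spectrum :: "real ^ 'k ^ 'k \<Rightarrow> real set" where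
  "real_spectrum A = {\<mu>. \<exists>v. v \<noteq> 0 \<and> v \<in> eigenspace A \<mu>}"

definition neg_spectrum :: "real ^ 'k ^ 'k \<Rightarrow> real set" where
  "neg_spectrum A = {\<mu> \<in> real_spectrum A. \<mu> < 0}"

definition eig_mult :: "real ^ 'k ^ 'k \<Rightarrow> real \<Rightarrow> nat" where
  "eig_mult A \<mu> = dim (eigenspace A \<mu>)"

text \<open>
  For \<open>\<mu> < 0\<close>, such a \<open>j\<close> exists, and is then unique, iff \<open>j\<^sup>2/m\<^sup>2 + \<mu>\<close> vanishes for no \<open>j\<close>.
\<close>

definition jmu :: "nat \<Rightarrow> real \<Rightarrow> nat" where
  "jmu m \<mu> = (THE j. - ((real j + 1)\<^sup>2 / (real m)\<^sup>2) < \<mu> \<and> \<mu> < - ((real j)\<^sup>2 / (real m)\<^sup>2))"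

definition bmu :: "nat \<Rightarrow> real \<Rightarrow> nat" where
  "bmu m \<mu> = jmu m \<mu> div m"

definition alphamu :: "nat \<Rightarrow> real \<Rightarrow> nat" where
  "alphamu m \<mu> = jmu m \<mu> - bmu m \<mu> * m"

definition ss_idx :: "nat \<Rightarrow> nat" where
  "ss_idx m = (m + 1) div 2"

text \<open>
  The indices \<open>0\<close>, \<open>\<ss>\<close>, \<open>\<ss> + 1\<close>, \<open>\<ss> + 2\<close> and \<open>0 < i < m/2\<close> are pairwise distinct. All other
  values, including those at \<open>\<ss> + 1\<close> and \<open>\<ss> + 2\<close> for odd \<open>m\<close>, are junk.
\<close>

definition beta :: "nat \<Rightarrow> real ^ 'k ^ 'k \<Rightarrow> nat \<Rightarrow> real \<Rightarrow> nat" where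
  "beta m A i \<mu> =
    (if i = 0 then (bmu m \<mu> + 1) * eig_mult A \<mu>
     else if i = ss_idx m then bmu m \<mu> * eig_mult A \<mu>
     else if even m \<and> (i = ss_idx m + 1 \<or> i = ss_idx m + 2) then
       (if alphamu m \<mu> < m div 2 then bmu m \<mu> * eig_mult A \<mu> else (bmu m \<mu> + 1) * eig_mult A \<mu>)
     else if 2 * i < m then
       (if alphamu m \<mu> < i then 2 * bmu m \<mu> * eig_mult A \<mu>
        else if alphamu m \<mu> < m - i then (2 * bmu m \<mu> + 1) * eig_mult A \<mu>
        else 2 * (bmu m \<mu> + 1) * eig_mult A \<mu>)
     else undefined)"

definition eta :: "nat \<Rightarrow> real ^ 'k ^ 'k \<Rightarrow> nat \<Rightarrow> nat" where
  "eta m A i = (\<Sum>\<mu>\<in>neg_spectrum A. beta m A i \<mu>)"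

definition rho :: "nat \<Rightarrow> real ^ 'k ^ 'k \<Rightarrow> nat \<Rightarrow> nat" where
  "rho m A i =
    (if 0 < i \<and> 2 * i < m
     then (\<Sum>i'\<in>{i'. 0 < i' \<and> 2 * i' < m \<and> gcd i' m = gcd i m}. eta m A i')
     else eta m A i)"

section \<open>Sanity checks on the encoding\<close>


lemma group_dihedral: "m > 0 \<Longrightarrow> group (dihedral m)"
proof (rule groupI, goal_cases)
  case (3 x y z)
  then show ?case
    by (auto simp: dihedral_def mod_simps algebra_simps split: prod.splits)
next
  case (5 x)
  obtain i a where x: "x = (i, a)" by (cases x)
  have "(if a then (i, a) else ((- i) mod int m, a)) \<otimes>\<^bsub>dihedral m\<^esub> x = \<one>\<^bsub>dihedral m\<^esub>"
    by (auto simp: dihedral_def x mod_simps)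
  moreover have "(if a then (i, a) else ((- i) mod int m, a)) \<in> carrier (dihedral m)"
    using 5 by (auto simp: dihedral_def x)
  ultimately show ?case by blast
qed (auto simp: dihedral_def)

lemma order_dihedral: "order (dihedral m) = 2 * m"
  by (simp add: order_def dihedral_def card_cartesian_product)

lemma flip_rot_flip:
  assumes "m > 1"
  shows "flip \<otimes>\<^bsub>dihedral m\<^esub> rot \<otimes>\<^bsub>dihedral m\<^esub> flip = inv\<^bsub>dihedral m\<^esub> rot"
proof -
  interpret group "dihedral m" using group_dihedral assms by simp
  have "rot \<in> carrier (dihedral m)" "flip \<in> carrier (dihedral m)"
    using assms by (auto simp: dihedral_def rot_def flip_def)
  then have "inv\<^bsub>dihedral m\<^esub> rot = flip \<otimes>\<^bsub>dihedral m\<^esub> rot \<otimes>\<^bsub>dihedral m\<^esub> flip"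
    using assms by (intro inv_equality m_closed) (auto simp: dihedral_def rot_def flip_def mod_simps)
  then show ?thesis by simp
qed

lemma periodic_int:
  fixes u :: "real \<Rightarrow> 'a"
  assumes "\<And>t. u (t + c) = u t"
  shows "u (t + of_int k * c) = u t"
proof -
  have n: "u (t + of_nat n * c) = u t" for t n
    by (induction n) (use assms in \<open>auto simp: algebra_simps\<close>, metis add.assoc add.commute)
  show ?thesis
  proof (cases "k \<ge> 0")
    case True then show ?thesis using n[of t "nat k"] by simp
  next
    case False then show ?thesis using n[of "t + of_int k * c" "nat (-k)"] by simp
  qed
qed

lemma sym_act_mult:
  assumes "u \<in> C2_periodic m" "g \<in> carrier (symgroup m)" "h \<in> carrier (symgroup m)"
  shows "sym_act (g \<otimes>\<^bsub>symgroup m\<^esub> h) u = sym_act g (sym_act h u)"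
proof -
  obtain i a s j b r where gh: "g = ((i, a), s)" "h = ((j, b), r)" by (metis surj_pair)
  have per: "u (t + of_int k * (2 * pi * real m)) = u t" for t k
    using periodic_int[of u] assms(1) by (simp add: C2_periodic_def)
  have red: "u (t + 2 * pi * of_int (x mod int m)) = u (t + 2 * pi * of_int x)"
       "u (- t - 2 * pi * of_int (x mod int m)) = u (- t - 2 * pi * of_int x)" for t x
  proof -
    have e: "real_of_int x = of_int (x mod int m) + real m * of_int (x div int m)"
      by (metis mod_mult_div_eq of_int_add of_int_mult of_int_of_nat_eq)
    show "u (t + 2 * pi * of_int (x mod int m)) = u (t + 2 * pi * of_int x)"
      using per[of "t + 2 * pi * of_int (x mod int m)" "x div int m"]
      by (simp add: e algebra_simps)
    show "u (- t - 2 * pi * of_int (x mod int m)) = u (- t - 2 * pi * of_int x)"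
      using per[of "- t - 2 * pi * of_int x" "x div int m"]
      by (simp add: e algebra_simps)
  qed
  show ?thesis
    using red by (auto simp: gh sym_act_def symgroup_def dihedral_def sign_img_def fun_eq_iff algebra_simps)
qed

end

theory Submission
  imports Defs "HOL-Homology.Brouwer_Degree" "HOL-Complex_Analysis.Great_Picard"
    "HOL-Real_Asymp.Real_Asymp"
begin

text \<open>
  Each of the six statements asks for a nonzero solution of \<open>u'' = f(t, u)\<close> with
  \<open>u(-t) = s u(t)\<close> and \<open>u(t + L) = r u(t)\<close> for suitable signs \<open>s\<close>, \<open>r\<close> and a suitable multiple
  \<open>L\<close> of \<open>2\<pi>\<close>. Such functions are invariant under one of the listed subgroups. Since \<open>u \<noteq> 0\<close>, the
  element \<open>-1\<close> is not in the isotropy group, so that group is the graph of a sign character on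
  a subgroup of the dihedral group; if it were larger than the listed one, then \<open>u\<close> would be invariant up
  to sign under a multiple of \<open>2\<pi>\<close> that is a proper divisor of \<open>L\<close>. For \<open>L = 2\<pi>\<close> there is none; if
  \<open>L\<close> is \<open>2\<pi>\<close> times a power of two, then \<open>r = -1\<close> excludes it; and if \<open>L = 2\<pi>p\<^sub>l\<close>, it leads to the second
  alternative of (iii)
  (\<open>stabilizer_eq_generate\<close>, \<open>antiperiodic_two_power_shift_sym\<close>). The twisted group of (vi) is
  reduced to the untwisted one by moving the origin of time to \<open>-\<pi>\<close>, which leaves all hypotheses
  on \<open>f\<close> intact.

  The solution comes from a degree argument: the degree at infinity is \<open>1\<close>, because
  \<open>f(t, x) \<bullet> x > 0\<close> for large \<open>x\<close> allows a deformation of \<open>f\<close> to the identity, whereas the local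
  degree at \<open>0\<close> is \<open>(-1)\<^sup>n\<close>, where \<open>n\<close> is the number of negative eigenvalues of \<open>-u'' + Au\<close> on the functions
  with the given symmetry. If \<open>n\<close> is odd, there must be another zero. To stay in finite dimension, the
  equation is replaced by a finite difference equation on a grid of step \<open>h = L/N\<close> with the same
  symmetry. Discrete sines and cosines times eigenvectors of \<open>A\<close> form an orthogonal basis of the
  symmetric grid functions and diagonalise the linear part, so only the fact that two
  diagonal maps with different sign parity are not homotopic on the sphere is needed
  (\<open>diagonal_maps_not_homotopic\<close>, \<open>discrete_nonzero_solution\<close>).

  Two bounds are uniform in \<open>h\<close>. The discrete maximum principle gives \<open>|u| < M\<close>, because
  at a maximum of \<open>|u|\<close> the second difference points inwards. The spectrum of the discrete linear part stays
  away from \<open>0\<close> (\<open>uniform_spectral_gap\<close>), which keeps nonzero solutions outside a fixed ball. Then the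
  discrete solutions and their difference quotients are uniformly Lipschitz, and the
  Arzela--Ascoli theorem yields a nonzero \<open>C\<^sup>2\<close> solution (\<open>discrete_solutions_converge\<close>).

  Finally \<open>n\<close> is computed: an eigenfunction of frequency \<open>J/m\<close> contributes for the eigenvalue \<open>\<mu>\<close> of \<open>A\<close> exactly if
  \<open>J \<le> \<jj>\<^sub>\<mu>\<close>. Sorting these integers \<open>J\<close> by residues modulo \<open>m\<close> turns the count into
  the numbers \<open>\<rho>\<^sub>i\<close>; in case (iii) it equals the sum \<open>\<rho>\<^sub>m\<^sub>/\<^sub>p + \<rho>\<^sub>\<ss>\<close> for \<open>p = p\<^sub>l\<close>
  (\<open>rho_prime_cofactor\<close>, \<open>rho_two_power_cofactor\<close>).
\<close>

section \<open>Degree of diagonal maps\<close>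

definition coord_space :: "nat \<Rightarrow> (nat \<Rightarrow> real) set" where
  "coord_space n = {x. \<forall>i>n. x i = 0}"

definition coord_sphere :: "nat \<Rightarrow> (nat \<Rightarrow> real) set" where
  "coord_sphere n = {x. (\<Sum>i\<le>n. (x i)\<^sup>2) = 1 \<and> (\<forall>i>n. x i = 0)}"

lemma nsphere_eq_top_of_coord_sphere: "nsphere n = top_of_set (coord_sphere n)"
  by (simp add: nsphere coord_sphere_def euclidean_product_topology)

lemma continuous_on_coord [continuous_intros]:
  "continuous_on S (\<lambda>x::nat \<Rightarrow> real. x i)"
  by (rule continuous_on_subset[OF continuous_on_product_coordinates subset_UNIV])

lemma continuous_on_coord_compose:
  fixes g :: "'a::topological_space \<Rightarrow> nat \<Rightarrow> real"
  assumes "continuous_on S g"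
  shows "continuous_on S (\<lambda>x. g x i)"
  using continuous_on_compose2[OF continuous_on_coord[of UNIV i] assms] by auto

text \<open>
  The reflection in coordinate \<open>0\<close> has degree \<open>-1\<close>. Conjugating it with a transposition,
  whose degree squares to \<open>1\<close>, gives every coordinate, and degrees multiply.
\<close>

lemma degree_coordinate_reflections:
  assumes "finite K" "K \<subseteq> {..p}"
  shows "Brouwer_degree2 p (\<lambda>x i. if i \<in> K then - x i else x i) = (-1) ^ card K \<and>
    continuous_map (nsphere p) (nsphere p) (\<lambda>x i. if i \<in> K then - x i else x i)"
  using assms
proof (induction K)
  case empty
  then show ?case
    using Brouwer_degree2_id[of p] by (simp add: id_def)
next
  case (insert k K)
  define r0 :: "(nat \<Rightarrow> real) \<Rightarrow> nat \<Rightarrow> real" where "r0 = (\<lambda>x i. if i = 0 then - x i else x i)"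
  define sw :: "(nat \<Rightarrow> real) \<Rightarrow> nat \<Rightarrow> real" where "sw = (\<lambda>x i. x (Transposition.transpose 0 k i))"
  let ?rK = "\<lambda>x::nat \<Rightarrow> real. \<lambda>i. if i \<in> K then - x i else x i"
  have k: "k \<le> p" using insert by auto
  have bij: "bij_betw (Transposition.transpose 0 k) {..p} {..p}"
    using k by (intro permutes_imp_bij permutes_swap_id) auto
  have sw: "continuous_map (nsphere p) (nsphere p) sw"
    unfolding nsphere_eq_top_of_coord_sphere
  proof (intro continuous_map_into_subtopology)
    show "continuous_map (top_of_set (coord_sphere p)) euclidean sw"
      unfolding sw_def by (auto intro!: continuous_on_coordinatewise_then_product continuous_intros)
    show "sw \<in> topspace (top_of_set (coord_sphere p)) \<rightarrow> coord_sphere p"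
    proof
      fix x assume "x \<in> topspace (top_of_set (coord_sphere p))"
      then have x: "(\<Sum>i\<le>p. (x i)\<^sup>2) = 1" "\<forall>i>p. x i = 0" by (auto simp: coord_sphere_def)
      have "(\<Sum>i\<le>p. (sw x i)\<^sup>2) = (\<Sum>i\<le>p. (x i)\<^sup>2)"
        using sum.reindex_bij_betw[OF bij, of "\<lambda>i. (x i)\<^sup>2"] by (simp add: sw_def)
      then show "sw x \<in> coord_sphere p"
        using x k by (auto simp: coord_sphere_def sw_def Transposition.transpose_def)
    qed
  qed
  have r0: "continuous_map (nsphere p) (nsphere p) r0"
    unfolding r0_def using continuous_map_nsphere_reflection[of p 0] by (simp add: if_distrib cong: if_cong)
  have sw2: "sw \<circ> sw = id" by (auto simp: sw_def fun_eq_iff)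
  have d0: "Brouwer_degree2 p r0 = -1"
    unfolding r0_def by (rule Brouwer_degree2_reflection)
  have c: "continuous_map (nsphere p) (nsphere p) (r0 \<circ> sw)"
    "continuous_map (nsphere p) (nsphere p) (sw \<circ> (r0 \<circ> sw))"
    using sw r0 by (auto intro: continuous_map_compose)
  have "Brouwer_degree2 p (sw \<circ> (r0 \<circ> sw)) = - (Brouwer_degree2 p sw * Brouwer_degree2 p sw)"
    using Brouwer_degree2_compose[OF c(1) sw] Brouwer_degree2_compose[OF sw r0] d0 by simp
  also have "\<dots> = -1"
    using Brouwer_degree2_compose[OF sw sw] sw2 Brouwer_degree2_id[of p] by simp
  finally have dk: "Brouwer_degree2 p (sw \<circ> (r0 \<circ> sw)) = -1" .
  have tr: "Transposition.transpose 0 k i = 0 \<longleftrightarrow> i = k" for i by (auto simp: Transposition.transpose_def)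
  have eq: "(sw \<circ> (r0 \<circ> sw)) \<circ> ?rK = (\<lambda>x i. if i \<in> insert k K then - x i else x i)"
    using insert.hyps by (auto simp: sw_def r0_def fun_eq_iff tr)
  have K: "continuous_map (nsphere p) (nsphere p) ?rK" "Brouwer_degree2 p ?rK = (-1) ^ card K"
    using insert by auto
  show ?case
    using Brouwer_degree2_compose[OF K(1) c(2)] continuous_map_compose[OF K(1) c(2)] dk K(2) insert
    unfolding eq by simp
qed

definition normalize_coords :: "nat \<Rightarrow> (nat \<Rightarrow> real) \<Rightarrow> nat \<Rightarrow> real" where
  "normalize_coords n x = (\<lambda>i. x i / sqrt (\<Sum>j\<le>n. (x j)\<^sup>2))"

lemma coord_sum_squares_pos:
  assumes "x \<in> coord_space n - {\<lambda>_. 0}"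
  shows "(\<Sum>j\<le>n. (x j)\<^sup>2) > 0"
proof -
  obtain i where "x i \<noteq> 0" using assms by (auto simp: fun_eq_iff)
  moreover have "i \<le> n" using assms calculation by (auto simp: coord_space_def not_le)
  ultimately show ?thesis by (intro sum_pos2[of _ i]) auto
qed

lemma continuous_map_normalize_coords:
  "continuous_map (top_of_set (coord_space n - {\<lambda>_. 0})) (nsphere n) (normalize_coords n)"
  unfolding nsphere_eq_top_of_coord_sphere
proof (intro continuous_map_into_subtopology)
  show "continuous_map (top_of_set (coord_space n - {\<lambda>_. 0})) euclidean (normalize_coords n)"
    unfolding normalize_coords_def continuous_map_iff_continuous
    by (intro continuous_on_coordinatewise_then_product continuous_intros)
       (use coord_sum_squares_pos in force)
  show "normalize_coords n \<in> topspace (top_of_set (coord_space n - {\<lambda>_. 0})) \<rightarrow> coord_sphere n"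
  proof
    fix x assume "x \<in> topspace (top_of_set (coord_space n - {\<lambda>_. 0}))"
    then have x: "x \<in> coord_space n - {\<lambda>_. 0}" by simp
    have "(\<Sum>i\<le>n. (normalize_coords n x i)\<^sup>2) = (\<Sum>i\<le>n. (x i)\<^sup>2 / (\<Sum>j\<le>n. (x j)\<^sup>2))"
      using coord_sum_squares_pos[OF x] by (simp add: normalize_coords_def power_divide)
    also have "\<dots> = 1"
      using coord_sum_squares_pos[OF x] by (simp flip: sum_divide_distrib)
    finally show "normalize_coords n x \<in> coord_sphere n"
      using x by (auto simp: coord_sphere_def coord_space_def normalize_coords_def)
  qed
qed

lemma homotopic_coord_family:
  fixes H :: "real \<Rightarrow> (nat \<Rightarrow> real) \<Rightarrow> nat \<Rightarrow> real"
  assumes "a \<le> b"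
    and cont: "\<And>i. continuous_on ({a..b} \<times> S) (\<lambda>p. H (fst p) (snd p) i)"
    and mem: "\<And>\<tau> x. \<tau> \<in> {a..b} \<Longrightarrow> x \<in> S \<Longrightarrow> H \<tau> x \<in> T"
  shows "homotopic_with_canon (\<lambda>_. True) S T (H a) (H b)"
proof -
  define K where "K = (\<lambda>p::real \<times> (nat \<Rightarrow> real). H (a + fst p * (b - a)) (snd p))"
  have in_ab: "a + \<tau> * (b - a) \<in> {a..b}" if "\<tau> \<in> {0..1}" for \<tau>
    using that \<open>a \<le> b\<close> mult_right_mono[of \<tau> 1 "b - a"] by auto
  have "continuous_on ({0..1} \<times> S) (\<lambda>p. K p i)" for i
  proof -
    have "continuous_on ({0..1} \<times> S) (\<lambda>p. (a + fst p * (b - a), snd p))"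
      by (intro continuous_intros)
    moreover have "(\<lambda>p. (a + fst p * (b - a), snd p)) ` ({0..1} \<times> S) \<subseteq> {a..b} \<times> S"
      using in_ab by auto
    ultimately show ?thesis
      unfolding K_def using continuous_on_compose2[OF cont[of i]] by fastforce
  qed
  then have "continuous_on ({0..1} \<times> S) K"
    by (rule continuous_on_coordinatewise_then_product)
  moreover have "K ` ({0..1} \<times> S) \<subseteq> T"
    using mem in_ab by (auto simp: K_def)
  ultimately show ?thesis
    unfolding homotopic_with_def
    by (intro exI[of _ K]) (auto simp: K_def)
qed

text \<open>
  Interpolating linearly between each \<open>d i\<close> and its sign never passes through \<open>0\<close>.
\<close>

lemma homotopic_diagonal_sign:
  fixes d :: "nat \<Rightarrow> real"
  assumes "\<And>i. i \<le> n \<Longrightarrow> d i \<noteq> 0"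
  shows "homotopic_with_canon (\<lambda>_. True) (coord_sphere n) (coord_space n - {\<lambda>_. 0})
    (\<lambda>x i. d i * x i) (\<lambda>x i. sgn (d i) * x i)"
proof -
  define H where "H = (\<lambda>\<tau> (x::nat \<Rightarrow> real) i. ((1 - \<tau>) * d i + \<tau> * sgn (d i)) * x i)"
  have snd: "continuous_on X (\<lambda>p::real \<times> (nat \<Rightarrow> real). snd p i)" for X i
    by (rule continuous_on_coord_compose[OF continuous_on_snd[OF continuous_on_id]])
  have "homotopic_with_canon (\<lambda>_. True) (coord_sphere n) (coord_space n - {\<lambda>_. 0}) (H 0) (H 1)"
  proof (rule homotopic_coord_family)
    show "continuous_on ({0..1} \<times> coord_sphere n) (\<lambda>p. H (fst p) (snd p) i)" for i
      unfolding H_def by (intro continuous_intros snd)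
    fix \<tau> :: real and x assume \<tau>: "\<tau> \<in> {0..1}" and x: "x \<in> coord_sphere n"
    have "\<exists>i\<le>n. x i \<noteq> 0"
    proof (rule ccontr)
      assume "\<not> ?thesis"
      then have "(\<Sum>i\<le>n. (x i)\<^sup>2) = 0" by simp
      then show False using x by (simp add: coord_sphere_def)
    qed
    then obtain i where i: "i \<le> n" "x i \<noteq> 0" by blast
    have "((1 - \<tau>) * d i + \<tau> * sgn (d i)) * sgn (d i) = (1 - \<tau>) * \<bar>d i\<bar> + \<tau>"
      using assms[OF i(1)] by (simp add: sgn_if)
    also have "\<dots> > 0"
      using \<tau> assms[OF i(1)] by (cases "\<tau> = 1") (auto intro: add_pos_nonneg)
    finally have "(1 - \<tau>) * d i + \<tau> * sgn (d i) \<noteq> 0" by force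
    then have "H \<tau> x i \<noteq> 0" using i by (simp add: H_def)
    then have "H \<tau> x \<noteq> (\<lambda>_. 0)" by metis
    then show "H \<tau> x \<in> coord_space n - {\<lambda>_. 0}"
      using x by (simp add: H_def coord_space_def coord_sphere_def)
  qed simp
  then show ?thesis by (simp add: H_def)
qed

lemma degree_normalized_signs:
  fixes d :: "nat \<Rightarrow> real"
  assumes d: "\<And>i. i \<le> n \<Longrightarrow> d i \<noteq> 0"
  shows "Brouwer_degree2 n (normalize_coords n \<circ> (\<lambda>x i. sgn (d i) * x i)) = (-1) ^ card {i. i \<le> n \<and> d i < 0}"
proof -
  define K where "K = {i. i \<le> n \<and> d i < 0}"
  have norm1: "normalize_coords n x = x" if "(\<Sum>i\<le>n. (x i)\<^sup>2) = 1" for x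
    using that by (simp add: normalize_coords_def)
  have sgn2: "(sgn (d i) * x)\<^sup>2 = x\<^sup>2" if "i \<le> n" for i x
    using d[OF that] by (cases "d i > 0") (auto simp: sgn_if)
  have D: "Brouwer_degree2 n (normalize_coords n \<circ> (\<lambda>x i. sgn (d i) * x i)) =
      Brouwer_degree2 n (\<lambda>x i. if i \<in> K then - x i else x i)"
  proof (rule Brouwer_degree2_eq)
    fix x assume "x \<in> topspace (nsphere n)"
    then have x: "(\<Sum>i\<le>n. (x i)\<^sup>2) = 1" "\<And>i. i > n \<Longrightarrow> x i = 0"
      by (auto simp: nsphere_eq_top_of_coord_sphere coord_sphere_def)
    have "(\<Sum>i\<le>n. (sgn (d i) * x i)\<^sup>2) = 1" using x sgn2 by simp
    then have "(normalize_coords n \<circ> (\<lambda>x i. sgn (d i) * x i)) x = (\<lambda>i. sgn (d i) * x i)"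
      by (simp add: norm1)
    also have "\<dots> = (\<lambda>i. if i \<in> K then - x i else x i)"
    proof
      fix i show "sgn (d i) * x i = (if i \<in> K then - x i else x i)"
        using x(2)[of i] d[of i] by (cases "i \<le> n") (auto simp: K_def sgn_if)
    qed
    finally show "(normalize_coords n \<circ> (\<lambda>x i. sgn (d i) * x i)) x = (\<lambda>i. if i \<in> K then - x i else x i)" .
  qed
  show ?thesis
  proof -
    have "finite K" "K \<subseteq> {..n}" by (auto simp: K_def)
    from degree_coordinate_reflections[OF this] show ?thesis unfolding D by (simp add: K_def)
  qed
qed

text \<open>
  After normalisation both maps become products of coordinate reflections, of degree
  \<open>-1\<close> on the left and \<open>1\<close> on the right.
\<close>

lemma diagonal_maps_not_homotopic:
  fixes d w :: "nat \<Rightarrow> real"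
  assumes d: "\<And>i. i \<le> n \<Longrightarrow> d i \<noteq> 0" and w: "\<And>i. i \<le> n \<Longrightarrow> w i > 0"
    and "odd (card {i. i \<le> n \<and> d i < 0})"
  shows "\<not> homotopic_with_canon (\<lambda>_. True) (coord_sphere n) (coord_space n - {\<lambda>_. 0})
    (\<lambda>x i. d i * x i) (\<lambda>x i. w i * x i)"
proof
  let ?hom = "homotopic_with_canon (\<lambda>_. True) (coord_sphere n) (coord_space n - {\<lambda>_. 0})"
  assume "?hom (\<lambda>x i. d i * x i) (\<lambda>x i. w i * x i)"
  moreover have "?hom (\<lambda>x i. w i * x i) (\<lambda>x i. sgn (w i) * x i)"
    using w by (intro homotopic_diagonal_sign) force
  moreover have "?hom (\<lambda>x i. sgn (d i) * x i) (\<lambda>x i. d i * x i)"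
    using homotopic_with_symD[OF homotopic_diagonal_sign[of n d]] d by simp
  ultimately have "?hom (\<lambda>x i. sgn (d i) * x i) (\<lambda>x i. sgn (w i) * x i)"
    by (meson homotopic_with_trans)
  then have h: "homotopic_with (\<lambda>_. True) (nsphere n) (nsphere n)
      (normalize_coords n \<circ> (\<lambda>x i. sgn (d i) * x i)) (normalize_coords n \<circ> (\<lambda>x i. sgn (w i) * x i))"
    unfolding nsphere_eq_top_of_coord_sphere[symmetric]
    by (rule homotopic_with_compose_continuous_map_left[OF _ continuous_map_normalize_coords]) auto
  have w': "w i \<noteq> 0" if "i \<le> n" for i using w[OF that] by simp
  have "(-1) ^ card {i. i \<le> n \<and> d i < 0} = (-1::int) ^ card {i. i \<le> n \<and> w i < 0}"
  proof -
    have "Brouwer_degree2 n (normalize_coords n \<circ> (\<lambda>x i. sgn (d i) * x i)) = (-1) ^ card {i. i \<le> n \<and> d i < 0}"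
      by (rule degree_normalized_signs) (erule d)
    moreover have "Brouwer_degree2 n (normalize_coords n \<circ> (\<lambda>x i. sgn (w i) * x i)) = (-1) ^ card {i. i \<le> n \<and> w i < 0}"
      by (rule degree_normalized_signs) (erule w')
    ultimately show ?thesis using Brouwer_degree2_homotopic[OF h] by argo
  qed
  moreover have "{i. i \<le> n \<and> w i < 0} = {}" using w by (auto dest: less_asym)
  ultimately show False using assms(3) by simp
qed

section \<open>Orthonormal eigenbases of symmetric matrices\<close>

text \<open>
  First order condition at \<open>t = 0\<close>, used to show that a maximiser of the Rayleigh quotient is
  an eigenvector.
\<close>

lemma linear_part_of_nonpos_quadratic:
  fixes a b :: real
  assumes "\<And>t. a * t + b * t\<^sup>2 \<le> 0"
  shows "a = 0"
proof (rule ccontr)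
  assume a: "a \<noteq> 0"
  define t where "t = a / (\<bar>b\<bar> + 1)"
  have t: "t * (\<bar>b\<bar> + 1) = a" by (simp add: t_def)
  have tnz: "t \<noteq> 0" using a by (auto simp: t_def)
  have "a * t + b * t\<^sup>2 = t\<^sup>2 * (\<bar>b\<bar> + 1 + b)"
    unfolding t[symmetric] by (simp add: power2_eq_square algebra_simps)
  moreover have "\<dots> > 0" using tnz by (intro mult_pos_pos) auto
  ultimately show False using assms[of t] by simp
qed

lemma symmetric_matrix_inner:
  fixes A :: "real ^ 'k ^ 'k"
  assumes "transpose A = A"
  shows "x \<bullet> (A *v y) = (A *v x) \<bullet> y"
  using dot_lmul_matrix[of x A y] assms by (metis transpose_matrix_vector)

text \<open>
  A maximiser \<open>v\<close> of \<open>x \<bullet> A x\<close> on the unit sphere of \<open>W\<close>: the deviation \<open>w = A v - \<mu> v\<close> lies in \<open>W\<close> and is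
  an admissible direction of variation, which forces \<open>w \<bullet> w = 0\<close>.
\<close>

lemma symmetric_matrix_eigenvector_in_subspace:
  fixes A :: "real ^ 'k ^ 'k"
  assumes sym: "transpose A = A" and W: "subspace W" "W \<noteq> {0}"
    and inv: "\<And>x. x \<in> W \<Longrightarrow> A *v x \<in> W"
  obtains v \<mu> where "v \<in> W" "norm v = 1" "A *v v = \<mu> *\<^sub>R v"
proof -
  have "compact (sphere 0 1 \<inter> W)"
    using W by (intro compact_Int_closed closed_subspace) auto
  moreover have "sphere 0 1 \<inter> W \<noteq> {}"
  proof -
    obtain w where w: "w \<in> W" "w \<noteq> 0" using W subspace_0 by blast
    then have "w /\<^sub>R norm w \<in> sphere 0 1 \<inter> W" using W by (auto intro: subspace_scale)
    then show ?thesis by blast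
  qed
  moreover have "continuous_on (sphere 0 1 \<inter> W) (\<lambda>x. x \<bullet> (A *v x))"
    by (intro continuous_intros matrix_vector_mult_linear_continuous_on)
  ultimately obtain v where v: "v \<in> sphere 0 1 \<inter> W"
    and max: "\<And>x. x \<in> sphere 0 1 \<inter> W \<Longrightarrow> x \<bullet> (A *v x) \<le> v \<bullet> (A *v v)"
    using continuous_attains_sup[of "sphere 0 1 \<inter> W" "\<lambda>x. x \<bullet> (A *v x)"] by blast
  define \<mu> where "\<mu> = v \<bullet> (A *v v)"
  have ray: "x \<bullet> (A *v x) \<le> \<mu> * (x \<bullet> x)" if "x \<in> W" for x
  proof (cases "x = 0")
    case False
    have "(x /\<^sub>R norm x) \<bullet> (A *v (x /\<^sub>R norm x)) \<le> \<mu>"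
      unfolding \<mu>_def using False that W by (intro max) (auto intro: subspace_scale)
    then have "(x \<bullet> (A *v x)) / (norm x)\<^sup>2 \<le> \<mu>"
      by (simp add: matrix_vector_mult_scaleR power2_eq_square divide_simps)
    then show ?thesis using False by (simp add: divide_le_eq power2_norm_eq_inner[symmetric] mult.commute)
  qed simp
  define w where "w = A *v v - \<mu> *\<^sub>R v"
  have w: "w \<in> W" using v W inv by (auto simp: w_def intro: subspace_diff subspace_scale)
  have vv: "v \<bullet> v = 1" using v by (simp add: norm_eq_1)
  have "2 * (w \<bullet> w) * t + (w \<bullet> (A *v w) - \<mu> * (w \<bullet> w)) * t\<^sup>2 \<le> 0" for t
  proof -
    have "v + t *\<^sub>R w \<in> W" using v w W by (auto intro: subspace_add subspace_scale)
    from ray[OF this] have "(v + t *\<^sub>R w) \<bullet> (A *v (v + t *\<^sub>R w)) - \<mu> * ((v + t *\<^sub>R w) \<bullet> (v + t *\<^sub>R w)) \<le> 0"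
      by simp
    moreover have "(v + t *\<^sub>R w) \<bullet> (A *v (v + t *\<^sub>R w)) - \<mu> * ((v + t *\<^sub>R w) \<bullet> (v + t *\<^sub>R w)) =
       2 * t * (w \<bullet> (A *v v) - \<mu> * (w \<bullet> v)) + (w \<bullet> (A *v w) - \<mu> * (w \<bullet> w)) * t\<^sup>2"
      using symmetric_matrix_inner[OF sym, of v w] vv
      by (simp add: matrix_vector_right_distrib matrix_vector_mult_scaleR inner_add_left inner_add_right
          \<mu>_def[symmetric] power2_eq_square algebra_simps inner_commute)
    moreover have "w \<bullet> (A *v v) - \<mu> * (w \<bullet> v) = w \<bullet> w"
      by (simp add: w_def inner_diff_right inner_diff_left algebra_simps)
    ultimately show ?thesis by (simp add: algebra_simps)
  qed
  then have "2 * (w \<bullet> w) = 0" by (rule linear_part_of_nonpos_quadratic)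
  then have "A *v v = \<mu> *\<^sub>R v" by (simp add: w_def)
  then show thesis using that[of v \<mu>] v by auto
qed

definition orthonormal_eigenbasis :: "real ^ 'k ^ 'k \<Rightarrow> (real ^ 'k) set \<Rightarrow> bool" where
  "orthonormal_eigenbasis A B \<longleftrightarrow> finite B \<and> pairwise orthogonal B \<and> (\<forall>e\<in>B. norm e = 1) \<and> span B = UNIV \<and>
    (\<forall>e\<in>B. A *v e = (e \<bullet> (A *v e)) *\<^sub>R e)"

text \<open>
  Induction on the dimension: split off one eigenvector and continue in its orthogonal complement within
  \<open>W\<close>, which is again invariant because \<open>A\<close> is symmetric.
\<close>

lemma symmetric_matrix_eigenbasis_of_subspace:
  fixes A :: "real ^ 'k ^ 'k"
  assumes sym: "transpose A = A" and "subspace W" and "\<And>x. x \<in> W \<Longrightarrow> A *v x \<in> W"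
  shows "\<exists>B. finite B \<and> pairwise orthogonal B \<and> (\<forall>e\<in>B. norm e = 1) \<and> span B = W \<and>
    (\<forall>e\<in>B. A *v e = (e \<bullet> (A *v e)) *\<^sub>R e)"
  using assms(2,3)
proof (induction "dim W" arbitrary: W rule: less_induct)
  case less
  show ?case
  proof (cases "W = {0}")
    case True
    then show ?thesis by (intro exI[of _ "{}"]) auto
  next
    case False
    obtain v \<mu> where v: "v \<in> W" "norm v = 1" "A *v v = \<mu> *\<^sub>R v"
      using symmetric_matrix_eigenvector_in_subspace[OF sym less.prems(1) False less.prems(2)] by blast
    define W' where "W' = {x\<in>W. v \<bullet> x = 0}"
    have vv: "v \<bullet> v = 1" using v by (simp add: norm_eq_1)
    have sub: "subspace W'"
      using less.prems(1) by (auto simp: W'_def subspace_def inner_add_right)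
    have inv: "A *v x \<in> W'" if "x \<in> W'" for x
      using that less.prems(2) symmetric_matrix_inner[OF sym, of v x] v by (auto simp: W'_def)
    have "v \<notin> W'" using vv by (simp add: W'_def)
    moreover have "W' \<subseteq> W" by (auto simp: W'_def)
    ultimately have "W' \<subset> W" using v by blast
    then have "dim W' < dim W"
      using sub less.prems(1) by (intro dim_psubset) (simp add: span_eq_iff[THEN iffD2])
    then obtain B where B: "finite B" "pairwise orthogonal B" "\<forall>e\<in>B. norm e = 1" "span B = W'"
      "\<forall>e\<in>B. A *v e = (e \<bullet> (A *v e)) *\<^sub>R e"
      using less.hyps[OF _ sub inv] by blast
    have orth: "v \<bullet> e = 0" if "e \<in> B" for e
      using that B(4) span_base[of e B] by (auto simp: W'_def)
    have "span (insert v B) = W"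
    proof
      show "span (insert v B) \<subseteq> W"
        using B(4) v \<open>W' \<subset> W\<close> less.prems(1) by (intro span_minimal) (auto dest: span_base)
      show "W \<subseteq> span (insert v B)"
      proof
        fix x assume x: "x \<in> W"
        have "x - (v \<bullet> x) *\<^sub>R v \<in> span B"
          using x v vv less.prems(1) unfolding B(4) W'_def
          by (auto simp: inner_diff_right intro: subspace_diff subspace_scale)
        then show "x \<in> span (insert v B)" using span_breakdown_eq by blast
      qed
    qed
    moreover have "pairwise orthogonal (insert v B)"
      using B(2) orth by (auto simp: pairwise_insert orthogonal_def inner_commute)
    moreover have "A *v v = (v \<bullet> (A *v v)) *\<^sub>R v" using v vv by simp
    ultimately show ?thesis using B v by (intro exI[of _ "insert v B"]) auto
  qed
qed

theorem symmetric_matrix_orthonormal_eigenbasis: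
  fixes A :: "real ^ 'k ^ 'k"
  assumes "transpose A = A"
  obtains B where "orthonormal_eigenbasis A B"
  using symmetric_matrix_eigenbasis_of_subspace[OF assms subspace_UNIV]
  by (auto simp: orthonormal_eigenbasis_def)

context
  fixes A :: "real ^ 'k ^ 'k" and B
  assumes B: "orthonormal_eigenbasis A B"
begin

lemma eigenbasis_inner: "e \<in> B \<Longrightarrow> e' \<in> B \<Longrightarrow> e \<bullet> e' = (if e = e' then 1 else 0)"
  using B by (auto simp: orthonormal_eigenbasis_def pairwise_def orthogonal_def norm_eq_1)

lemma eigenbasis_expansion: "(\<Sum>e\<in>B. (x \<bullet> e) *\<^sub>R e) = x"
proof -
  have "x \<in> span B" "finite B" using B by (auto simp: orthonormal_eigenbasis_def)
  then obtain c where x: "x = (\<Sum>e\<in>B. c e *\<^sub>R e)" by (auto simp: span_finite)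
  have "x \<bullet> e = c e" if "e \<in> B" for e
  proof -
    have "x \<bullet> e = (\<Sum>e'\<in>B. c e' * (e' \<bullet> e))" by (simp add: x inner_sum_left)
    also have "\<dots> = (\<Sum>e'\<in>B. if e' = e then c e' else 0)"
      using that by (intro sum.cong) (auto simp: eigenbasis_inner)
    also have "\<dots> = c e" using that \<open>finite B\<close> by simp
    finally show ?thesis .
  qed
  then show ?thesis using x by simp
qed

lemma eigenbasis_inner_matrix:
  assumes "transpose A = A" "e \<in> B"
  shows "(A *v x) \<bullet> e = (e \<bullet> (A *v e)) * (x \<bullet> e)"
proof -
  have e: "A *v e = (e \<bullet> (A *v e)) *\<^sub>R e" using B assms(2) by (simp add: orthonormal_eigenbasis_def)
  have "(A *v x) \<bullet> e = x \<bullet> (A *v e)" using symmetric_matrix_inner[OF assms(1)] by simp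
  then show ?thesis by (subst (asm) e) simp
qed

lemma eigenspace_eq_span:
  assumes sym: "transpose A = A"
  shows "eigenspace A \<mu> = span {e\<in>B. e \<bullet> (A *v e) = \<mu>}"
proof
  have "subspace (eigenspace A \<mu>)"
    by (auto simp: subspace_def eigenspace_def matrix_vector_right_distrib matrix_vector_mult_scaleR
        scaleR_add_right)
  moreover have "{e\<in>B. e \<bullet> (A *v e) = \<mu>} \<subseteq> eigenspace A \<mu>"
    using B by (auto simp: eigenspace_def orthonormal_eigenbasis_def)
  ultimately show "span {e\<in>B. e \<bullet> (A *v e) = \<mu>} \<subseteq> eigenspace A \<mu>"
    by (rule span_minimal[rotated])
  show "eigenspace A \<mu> \<subseteq> span {e\<in>B. e \<bullet> (A *v e) = \<mu>}"
  proof
    fix x assume x: "x \<in> eigenspace A \<mu>"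
    have "(x \<bullet> e) *\<^sub>R e \<in> span {e\<in>B. e \<bullet> (A *v e) = \<mu>}" if "e \<in> B" for e
    proof (cases "e \<bullet> (A *v e) = \<mu>")
      case True
      then show ?thesis using that by (intro span_scale span_base) auto
    next
      case False
      then have "x \<bullet> e = 0"
        using eigenbasis_inner_matrix[OF sym that, of x] x by (simp add: eigenspace_def)
      then show ?thesis by (simp add: span_zero)
    qed
    then have "(\<Sum>e\<in>B. (x \<bullet> e) *\<^sub>R e) \<in> span {e\<in>B. e \<bullet> (A *v e) = \<mu>}" by (rule span_sum)
    then show "x \<in> span {e\<in>B. e \<bullet> (A *v e) = \<mu>}" by (simp add: eigenbasis_expansion)
  qed
qed

lemma eig_mult_eq_card:
  assumes "transpose A = A"
  shows "eig_mult A \<mu> = card {e\<in>B. e \<bullet> (A *v e) = \<mu>}"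
proof -
  have "independent {e\<in>B. e \<bullet> (A *v e) = \<mu>}"
    using B by (intro pairwise_orthogonal_independent)
      (auto simp: orthonormal_eigenbasis_def pairwise_def)
  then show ?thesis
    by (simp add: eig_mult_def eigenspace_eq_span[OF assms] dim_eq_card_independent)
qed

lemma real_spectrum_eq_image:
  assumes sym: "transpose A = A"
  shows "real_spectrum A = (\<lambda>e. e \<bullet> (A *v e)) ` B"
proof
  have "e \<noteq> 0" if "e \<in> B" for e using B that by (auto simp: orthonormal_eigenbasis_def)
  moreover have "A *v e = (e \<bullet> (A *v e)) *\<^sub>R e" if "e \<in> B" for e
    using B that by (simp add: orthonormal_eigenbasis_def)
  ultimately show "(\<lambda>e. e \<bullet> (A *v e)) ` B \<subseteq> real_spectrum A"
    unfolding real_spectrum_def eigenspace_def by blast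
  show "real_spectrum A \<subseteq> (\<lambda>e. e \<bullet> (A *v e)) ` B"
  proof
    fix \<mu> assume "\<mu> \<in> real_spectrum A"
    then obtain v where "v \<noteq> 0" "v \<in> span {e\<in>B. e \<bullet> (A *v e) = \<mu>}"
      by (auto simp: real_spectrum_def eigenspace_eq_span[OF sym])
    then have "{e\<in>B. e \<bullet> (A *v e) = \<mu>} \<noteq> {}" by (metis span_empty singletonD)
    then show "\<mu> \<in> (\<lambda>e. e \<bullet> (A *v e)) ` B" by auto
  qed
qed

lemma sum_neg_spectrum_mult:
  fixes g :: "real \<Rightarrow> nat"
  assumes sym: "transpose A = A"
  shows "(\<Sum>\<mu>\<in>neg_spectrum A. eig_mult A \<mu> * g \<mu>) = (\<Sum>e\<in>{e\<in>B. e \<bullet> (A *v e) < 0}. g (e \<bullet> (A *v e)))"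
proof -
  let ?q = "\<lambda>e. e \<bullet> (A *v e)" and ?B = "{e\<in>B. e \<bullet> (A *v e) < 0}"
  have fin: "finite ?B" using B by (simp add: orthonormal_eigenbasis_def)
  have "neg_spectrum A = ?q ` ?B"
    using real_spectrum_eq_image[OF sym] by (auto simp: neg_spectrum_def)
  moreover have "eig_mult A \<mu> * g \<mu> = (\<Sum>e\<in>{e\<in>?B. ?q e = \<mu>}. g (?q e))" if "\<mu> \<in> ?q ` ?B" for \<mu>
  proof -
    have "{e\<in>?B. ?q e = \<mu>} = {e\<in>B. ?q e = \<mu>}" using that by auto
    then show ?thesis by (simp add: eig_mult_eq_card[OF sym])
  qed
  ultimately have "(\<Sum>\<mu>\<in>neg_spectrum A. eig_mult A \<mu> * g \<mu>) = (\<Sum>\<mu>\<in>?q ` ?B. \<Sum>e\<in>{e\<in>?B. ?q e = \<mu>}. g (?q e))"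
    by (metis (no_types, lifting) sum.cong)
  also have "\<dots> = (\<Sum>e\<in>?B. g (?q e))"
    using sum.image_gen[OF fin, of "\<lambda>e. g (?q e)" ?q] by simp
  finally show ?thesis .
qed

end

section \<open>Discrete trigonometric modes\<close>

text \<open>
  Multiplication by \<open>2 sin \<theta>\<close> makes the sum telescope.
\<close>

lemma sum_cos_arith_progression:
  fixes \<theta> c :: real
  shows "2 * sin \<theta> * (\<Sum>j<N. cos (c + 2 * \<theta> * real j)) = sin (c - \<theta> + 2 * \<theta> * real N) - sin (c - \<theta>)"
proof (induction N)
  case (Suc N)
  have eq: "c - \<theta> + 2 * \<theta> * real (Suc N) = (c + 2 * \<theta> * real N) + \<theta>"
    "c - \<theta> + 2 * \<theta> * real N = (c + 2 * \<theta> * real N) - \<theta>"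
    by (simp_all add: algebra_simps)
  have "2 * sin \<theta> * cos y = sin (y + \<theta>) - sin (y - \<theta>)" for y
    by (simp add: sin_add sin_diff)
  then show ?case using Suc unfolding eq by (simp add: distrib_left)
qed simp

lemma sin_int_pi_div_nonzero:
  fixes m :: int
  assumes "N > 0" "\<not> int N dvd m"
  shows "sin (of_int m * pi / real N) \<noteq> 0"
proof
  assume "sin (of_int m * pi / real N) = 0"
  then obtain k :: int where "of_int m * pi / real N = of_int k * pi"
    by (auto simp: sin_zero_iff_int2)
  then have "real_of_int m = of_int (k * int N)" using assms by (simp add: field_simps)
  then have "m = k * int N" by (rule of_int_eq_iff[THEN iffD1])
  then show False using assms by simp
qed

lemma sum_cos_roots_of_unity:
  fixes m :: int
  assumes "N > 0"
  shows "(\<Sum>x<N. cos (2 * of_int m * pi * real x / real N)) = (if int N dvd m then real N else 0)"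
proof (cases "int N dvd m")
  case True
  then obtain k where k: "m = int N * k" by blast
  have "cos (2 * of_int m * pi * real x / real N) = 1" for x
    using cos_int_2pin[of "k * int x"] assms by (simp add: k algebra_simps)
  then show ?thesis using True by simp
next
  case False
  let ?t = "of_int m * pi / real N"
  have "2 * sin ?t * (\<Sum>x<N. cos (0 + 2 * ?t * real x)) = sin (0 - ?t + 2 * ?t * real N) - sin (0 - ?t)"
    by (rule sum_cos_arith_progression)
  also have "0 - ?t + 2 * ?t * real N = - ?t + of_int m * (2 * pi)"
    using assms by simp
  also have "sin \<dots> = sin (- ?t)"
    using sin.plus_of_int[of "- ?t" m] by simp
  finally have "(\<Sum>x<N. cos (0 + 2 * ?t * real x)) = 0"
    using sin_int_pi_div_nonzero[OF assms False] by simp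
  then show ?thesis using False by (simp add: algebra_simps)
qed

text \<open>
  The frequencies \<open>-N + 1, -N + 3, \<dots>, N - 1\<close> represent all \<open>N\<close> characters of a fixed parity, so their sum is
  the discrete delta function. The symmetric range matters: the cosine and the sine of a negative
  frequency agree up to sign with those of its absolute value.
\<close>

lemma sum_cos_symmetric_frequencies:
  fixes z :: int
  assumes "N > 0" "\<bar>z\<bar> < int N"
  shows "(\<Sum>j<N. cos ((2 * real j + 1 - real N) * pi * of_int z / real N)) = (if z = 0 then real N else 0)"
proof (cases "z = 0")
  case False
  let ?t = "of_int z * pi / real N"
  have nd: "\<not> int N dvd z" using assms False zdvd_not_zless[of "\<bar>z\<bar>" "int N"] by auto
  have "2 * sin ?t * (\<Sum>j<N. cos ((1 - real N) * ?t + 2 * ?t * real j)) =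
      sin ((1 - real N) * ?t - ?t + 2 * ?t * real N) - sin ((1 - real N) * ?t - ?t)"
    by (rule sum_cos_arith_progression)
  also have "(1 - real N) * ?t - ?t + 2 * ?t * real N = of_int z * pi"
    using assms by (simp add: field_simps)
  also have "(1 - real N) * ?t - ?t = - (of_int z * pi)"
    using assms by (simp add: field_simps)
  also have "sin (of_int z * pi) - sin (- (of_int z * pi)) = 0"
    using sin_npi_int[of z] by (simp add: mult.commute)
  finally have "(\<Sum>j<N. cos ((1 - real N) * ?t + 2 * ?t * real j)) = 0"
    using sin_int_pi_div_nonzero[OF assms(1) nd] by (simp only: mult_eq_0_iff, simp)
  moreover have "(1 - real N) * ?t + 2 * ?t * real j = (2 * real j + 1 - real N) * pi * of_int z / real N" for j
    by (simp add: algebra_simps add_divide_distrib diff_divide_distrib)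
  ultimately show ?thesis using False by simp
qed simp

lemma sum_odd_periodic_zero:
  fixes g :: "int \<Rightarrow> real"
  assumes per: "\<And>x. g (x + int N) = g x" and odd: "\<And>x. g (- x) = - g x"
  shows "(\<Sum>x<N. g (int x)) = 0"
proof -
  have "(\<Sum>x<N. g (int x)) = (\<Sum>i<N. g (int (N - Suc i)))"
    by (rule sum.nat_diff_reindex[symmetric])
  also have "\<dots> = (\<Sum>i<N. - g (int (Suc i)))"
  proof (rule sum.cong)
    fix i assume "i \<in> {..<N}"
    then have "int (N - Suc i) = - int (Suc i) + int N" by simp
    then show "g (int (N - Suc i)) = - g (int (Suc i))" using per odd by metis
  qed simp
  also have "\<dots> = - (\<Sum>i<N. g (int (Suc i)))" by (rule sum_negf)
  also have "(\<Sum>i<N. g (int (Suc i))) = (\<Sum>i<N. g (int i))"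
    using sum.lessThan_Suc_shift[of "\<lambda>i. g (int i)" N] per[of 0] by simp
  finally show ?thesis by simp
qed

text \<open>
  A symmetric grid function represents a function on the line with \<open>u(-t) = s u(t)\<close> and
  \<open>u(t + L) = (-1)\<^sup>\<sigma> u(t)\<close>, sampled at the multiples of \<open>L/N\<close>. The modes are the samples of \<open>cos\<close> or
  \<open>sin\<close> of \<open>a \<pi> t/L\<close>; the second symmetry fixes the parity of \<open>a\<close>. Taking \<open>N\<close> of the parity opposite to \<open>\<sigma>\<close>
  excludes the exceptional frequency \<open>a = N\<close>.
\<close>

definition mode :: "real \<Rightarrow> nat \<Rightarrow> nat \<Rightarrow> int \<Rightarrow> real" where
  "mode s N a x = (if s = 1 then cos (real a * pi * of_int x / real N) else sin (real a * pi * of_int x / real N))"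

definition mode_set :: "real \<Rightarrow> nat \<Rightarrow> nat \<Rightarrow> nat set" where
  "mode_set s \<sigma> N = {a. a < N \<and> even (a + \<sigma>) \<and> (s = 1 \<or> a > 0)}"

definition sym_grid :: "real \<Rightarrow> nat \<Rightarrow> nat \<Rightarrow> (int \<Rightarrow> 'v::real_vector) \<Rightarrow> bool" where
  "sym_grid s \<sigma> N u \<longleftrightarrow> (\<forall>x. u (- x) = s *\<^sub>R u x) \<and> (\<forall>x. u (x + int N) = (-1) ^ \<sigma> *\<^sub>R u x)"

lemma pm_one_power: "(-1::real) ^ \<sigma> = 1 \<or> (-1::real) ^ \<sigma> = -1"
  by (cases "even \<sigma>") auto

lemma sym_grid_norm_mod:
  fixes u :: "int \<Rightarrow> 'v::real_normed_vector"
  assumes "sym_grid s \<sigma> N u"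
  shows "norm (u (x mod int N)) = norm (u x)"
proof -
  have step: "norm (u (y + int N)) = norm (u y)" for y
    using assms pm_one_power[of \<sigma>] by (auto simp: sym_grid_def)
  have up: "norm (u (y + int n * int N)) = norm (u y)" for n y
  proof (induction n)
    case (Suc n)
    have "y + int (Suc n) * int N = (y + int n * int N) + int N" by (simp add: algebra_simps)
    then show ?case using Suc step by metis
  qed simp
  show ?thesis
  proof (cases "x div int N \<ge> 0")
    case True
    have "x = x mod int N + int (nat (x div int N)) * int N" using True by simp
    then show ?thesis using up by metis
  next
    case False
    then have "x mod int N = x + int (nat (- (x div int N))) * int N"
      by (simp add: minus_div_mult_eq_mod[symmetric])
    then show ?thesis using up by metis
  qed
qed

lemma cos_sin_add_int_pi:
  fixes b :: int
  assumes "even (b + int \<sigma>)"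
  shows "cos (t + of_int b * pi) = (-1) ^ \<sigma> * cos t" "sin (t + of_int b * pi) = (-1) ^ \<sigma> * sin t"
proof -
  have e: "even b \<longleftrightarrow> even \<sigma>" using assms by simp
  have "cos (of_int b * pi) = (-1) ^ \<sigma>"
    using e by (cases "even b") (auto simp: cos_npi_int mult.commute)
  moreover have "sin (of_int b * pi) = 0" by (simp add: sin_npi_int mult.commute)
  ultimately show "cos (t + of_int b * pi) = (-1) ^ \<sigma> * cos t" "sin (t + of_int b * pi) = (-1) ^ \<sigma> * sin t"
    by (simp_all add: cos_add sin_add)
qed

lemma sym_grid_mode:
  assumes "N > 0" "s = 1 \<or> s = -1" "a \<in> mode_set s \<sigma> N"
  shows "sym_grid s \<sigma> N (mode s N a)"
proof -
  have e: "even (int a + int \<sigma>)" using assms by (simp add: mode_set_def)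
  have "real a * pi * of_int (x + int N) / real N = real a * pi * of_int x / real N + of_int (int a) * pi" for x
    using assms by (simp add: field_simps)
  then show ?thesis
    using assms(2) cos_sin_add_int_pi[OF e] by (auto simp: sym_grid_def mode_def)
qed

lemma mode_second_difference:
  "2 * mode s N a x - mode s N a (x + 1) - mode s N a (x - 1) = (2 - 2 * cos (real a * pi / real N)) * mode s N a x"
proof -
  define t where "t = real a * pi / real N"
  define y where "y = real a * pi * of_int x / real N"
  have eq: "real a * pi * of_int (x + 1) / real N = y + t" "real a * pi * of_int (x - 1) / real N = y - t"
    by (simp_all add: t_def y_def algebra_simps add_divide_distrib diff_divide_distrib)
  show ?thesis
    unfolding mode_def eq t_def[symmetric] y_def[symmetric] cos_add cos_diff sin_add sin_diff
    by (simp add: algebra_simps)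
qed

definition mode_norm :: "nat \<Rightarrow> nat \<Rightarrow> real" where
  "mode_norm N a = (if a = 0 then real N else real N / 2)"

text \<open>
  By the product formulas this is a statement about the frequencies \<open>(a - b)/2\<close> and
  \<open>(a + b)/2\<close>, both of absolute value less than \<open>N\<close>.
\<close>

lemma mode_orthogonality:
  assumes N: "N > 0" and s: "s = 1 \<or> s = -1" and a: "a \<in> mode_set s \<sigma> N" and b: "b \<in> mode_set s \<sigma> N"
  shows "(\<Sum>x<N. mode s N a (int x) * mode s N b (int x)) = (if a = b then mode_norm N a else 0)"
proof -
  have ab: "a < N" "b < N" "even (a + b)"
    using a b by (auto simp: mode_set_def)
  define m where "m = (int a - int b) div 2"
  define p where "p = (int a + int b) div 2"
  have m: "2 * m = int a - int b" and p: "2 * p = int a + int b"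
    using ab by (auto simp: m_def p_def)
  have rm: "2 * real_of_int m = real a - real b" and rp: "2 * real_of_int p = real a + real b"
    using m p by linarith+
  have prod: "mode s N a (int x) * mode s N b (int x) =
      (cos (2 * of_int m * pi * real x / real N) + s * cos (2 * of_int p * pi * real x / real N)) / 2" for x
  proof -
    define u where "u = real a * pi * real x / real N"
    define v where "v = real b * pi * real x / real N"
    have eq: "2 * of_int m * pi * real x / real N = u - v" "2 * of_int p * pi * real x / real N = u + v"
      unfolding rm rp u_def v_def by (simp_all add: algebra_simps add_divide_distrib diff_divide_distrib)
    have "mode s N a (int x) = (if s = 1 then cos u else sin u)" "mode s N b (int x) = (if s = 1 then cos v else sin v)"
      by (simp_all add: mode_def u_def v_def)
    then have "mode s N a (int x) * mode s N b (int x) = (if s = 1 then cos u * cos v else sin u * sin v)" by simp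
    then show ?thesis unfolding eq cos_times_cos sin_times_sin using s
      by (elim disjE) (simp_all del: cos_diff_cos cos_plus_cos)
  qed
  have dm: "int N dvd m \<longleftrightarrow> a = b"
  proof
    assume "int N dvd m"
    moreover have "\<bar>m\<bar> < int N" using m ab by linarith
    ultimately have "m = 0" using zdvd_not_zless[of "\<bar>m\<bar>" "int N"] by auto
    then show "a = b" using m by simp
  qed (use m in auto)
  have dp: "int N dvd p \<longleftrightarrow> a = 0 \<and> b = 0"
  proof
    assume "int N dvd p"
    moreover have "\<bar>p\<bar> < int N" using p ab by linarith
    ultimately have "p = 0" using zdvd_not_zless[of "\<bar>p\<bar>" "int N"] by auto
    then show "a = 0 \<and> b = 0" using p by simp
  qed (use p in auto)
  have "(\<Sum>x<N. mode s N a (int x) * mode s N b (int x)) =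
      ((\<Sum>x<N. cos (2 * of_int m * pi * real x / real N)) + s * (\<Sum>x<N. cos (2 * of_int p * pi * real x / real N))) / 2"
    unfolding prod by (simp only: sum.distrib sum_distrib_left sum_divide_distrib[symmetric])
  also have "\<dots> = ((if int N dvd m then real N else 0) + s * (if int N dvd p then real N else 0)) / 2"
    by (simp only: sum_cos_roots_of_unity[OF N])
  finally have "(\<Sum>x<N. mode s N a (int x) * mode s N b (int x)) =
      ((if int N dvd m then real N else 0) + s * (if int N dvd p then real N else 0)) / 2" .
  then show ?thesis
    using a b s unfolding dm dp by (auto simp: mode_norm_def mode_set_def)
qed

text \<open>
  Discrete Fourier inversion, from the delta function written as a sum of cosines of \<open>\<theta> j (i - x)\<close>.
\<close>

lemma cosine_inversion:
  fixes w :: "int \<Rightarrow> real"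
  assumes i: "i < N"
  defines "\<theta> \<equiv> \<lambda>j x. (2 * real j + 1 - real N) * pi * of_int x / real N"
  shows "real N * w (int i) = (\<Sum>j<N. cos (\<theta> j (int i)) * (\<Sum>x<N. w (int x) * cos (\<theta> j (int x)))
      + sin (\<theta> j (int i)) * (\<Sum>x<N. w (int x) * sin (\<theta> j (int x))))"
proof -
  have N: "N > 0" using i by simp
  have kernel: "(\<Sum>j<N. cos (\<theta> j (int i - int x))) = (if x = i then real N else 0)" if "x < N" for x
    unfolding \<theta>_def using that i by (subst sum_cos_symmetric_frequencies[OF N]) auto
  have diff: "cos (\<theta> j (int i - int x)) = cos (\<theta> j (int i)) * cos (\<theta> j (int x)) + sin (\<theta> j (int i)) * sin (\<theta> j (int x))" for j x
  proof -
    have "\<theta> j (int i - int x) = \<theta> j (int i) - \<theta> j (int x)"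
      by (simp add: \<theta>_def algebra_simps diff_divide_distrib add_divide_distrib)
    then show ?thesis by (simp only: cos_diff)
  qed
  have "real N * w (int i) = (\<Sum>x<N. w (int x) * (if x = i then real N else 0))"
    using i by (simp add: if_distrib[of "\<lambda>y. _ * y"] cong: if_cong)
  also have "\<dots> = (\<Sum>x<N. w (int x) * (\<Sum>j<N. cos (\<theta> j (int i - int x))))"
    using kernel by (intro sum.cong) auto
  also have "\<dots> = (\<Sum>x<N. \<Sum>j<N. cos (\<theta> j (int i)) * (w (int x) * cos (\<theta> j (int x)))
      + sin (\<theta> j (int i)) * (w (int x) * sin (\<theta> j (int x))))"
    unfolding diff by (simp add: sum_distrib_left distrib_left mult_ac)
  also have "\<dots> = (\<Sum>j<N. cos (\<theta> j (int i)) * (\<Sum>x<N. w (int x) * cos (\<theta> j (int x)))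
      + sin (\<theta> j (int i)) * (\<Sum>x<N. w (int x) * sin (\<theta> j (int x))))"
    by (subst sum.swap) (simp only: sum.distrib sum_distrib_left)
  finally show ?thesis .
qed

text \<open>
  Completeness of the modes. In the inversion formula one of the two families of coefficients vanishes
  because the summand is odd and periodic, the other one by assumption.
\<close>

lemma sym_grid_orthogonal_modes_zero:
  fixes w :: "int \<Rightarrow> real"
  assumes par: "odd (N + \<sigma>)" and s: "s = 1 \<or> s = -1" and N: "N > 0" and w: "sym_grid s \<sigma> N w"
    and orth: "\<And>a. a \<in> mode_set s \<sigma> N \<Longrightarrow> (\<Sum>x<N. mode s N a (int x) * w (int x)) = 0"
  shows "w x = 0"
proof -
  have wneg: "w (- x) = s * w x" and wper: "w (x + int N) = (-1) ^ \<sigma> * w x" for x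
    using w by (auto simp: sym_grid_def)
  have r2: "(-1) ^ \<sigma> * ((-1) ^ \<sigma> * y) = (y::real)" for y
    by (simp add: power_mult_distrib[symmetric] mult.assoc[symmetric] flip: power_add)
  have freq: "(\<Sum>x<N. w (int x) * cos (of_int b * pi * real x / real N)) = 0"
    "(\<Sum>x<N. w (int x) * sin (of_int b * pi * real x / real N)) = 0"
    if b: "even (b + int \<sigma>)" "\<bar>b\<bar> < int N" for b :: int
  proof -
    have ad: "of_int b * pi * of_int (x + int N) / real N = of_int b * pi * of_int x / real N + of_int b * pi" for x :: int
      using N by (simp add: field_simps)
    let ?c = "\<lambda>x. w x * cos (of_int b * pi * of_int x / real N)"
    let ?s = "\<lambda>x. w x * sin (of_int b * pi * of_int x / real N)"
    have per: "?c (x + int N) = ?c x" "?s (x + int N) = ?s x" for x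
      unfolding ad cos_sin_add_int_pi[OF b(1)] wper by (simp_all add: r2 mult_ac)
    have a: "nat \<bar>b\<bar> \<in> mode_set s \<sigma> N" if "s = 1 \<or> b \<noteq> 0"
      using that b by (auto simp: mode_set_def even_nat_iff)
    have rb: "real (nat \<bar>b\<bar>) = \<bar>real_of_int b\<bar>" by simp
    show "(\<Sum>x<N. w (int x) * cos (of_int b * pi * real x / real N)) = 0"
    proof (cases "s = 1")
      case True
      have "mode s N (nat \<bar>b\<bar>) (int x) = cos (of_int b * pi * real x / real N)" for x
        unfolding mode_def rb using True by (auto simp: abs_if)
      then show ?thesis using orth[OF a] True by (simp add: mult.commute)
    next
      case False
      then have "?c (- x) = - ?c x" for x using s wneg by simp
      from sum_odd_periodic_zero[of ?c, OF per(1) this] show ?thesis by simp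
    qed
    show "(\<Sum>x<N. w (int x) * sin (of_int b * pi * real x / real N)) = 0"
    proof (cases "s = 1 \<or> b = 0")
      case True
      then have "?s (- x) = - ?s x" for x using wneg[of x] by auto
      from sum_odd_periodic_zero[of ?s, OF per(2) this] show ?thesis by simp
    next
      case False
      have "mode s N (nat \<bar>b\<bar>) (int x) = sgn (of_int b) * sin (of_int b * pi * real x / real N)" for x
        unfolding mode_def rb using False by (auto simp: abs_if sgn_if)
      then have "sgn (of_int b) * (\<Sum>x<N. w (int x) * sin (of_int b * pi * real x / real N)) = 0"
        using orth[OF a] False by (simp add: mult_ac sum_distrib_left)
      then show ?thesis using False by (simp add: sgn_if split: if_splits)
    qed
  qed
  have period_zero: "w (int i) = 0" if i: "i < N" for i
  proof -
    have zero: "(\<Sum>x<N. w (int x) * cos ((2 * real j + 1 - real N) * pi * of_int (int x) / real N)) = 0"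
      "(\<Sum>x<N. w (int x) * sin ((2 * real j + 1 - real N) * pi * of_int (int x) / real N)) = 0" if "j < N" for j
    proof -
      have b: "even (2 * int j + 1 - int N + int \<sigma>)" "\<bar>2 * int j + 1 - int N\<bar> < int N"
        using par that by auto
      show "(\<Sum>x<N. w (int x) * cos ((2 * real j + 1 - real N) * pi * of_int (int x) / real N)) = 0"
        "(\<Sum>x<N. w (int x) * sin ((2 * real j + 1 - real N) * pi * of_int (int x) / real N)) = 0"
        using freq[OF b] by simp_all
    qed
    have "real N * w (int i) = 0"
      unfolding cosine_inversion[OF i, of w] by (intro sum.neutral) (simp add: zero del: of_int_of_nat_eq)
    then show ?thesis using N by simp
  qed
  have "w (x mod int N) = 0"
    using period_zero[of "nat (x mod int N)"] N by (simp add: nat_less_iff)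
  then show ?thesis using sym_grid_norm_mod[OF w, of x] by simp
qed

section \<open>Symmetric solutions of the difference equation\<close>

definition grid_laplacian :: "real \<Rightarrow> (int \<Rightarrow> 'v::real_vector) \<Rightarrow> int \<Rightarrow> 'v" where
  "grid_laplacian h u x = (u (x + 1) - 2 *\<^sub>R u x + u (x - 1)) /\<^sub>R h\<^sup>2"

text \<open>
  The symmetries make the residual of a symmetric grid function symmetric again, so that it vanishes as soon
  as its coefficients do.
\<close>

definition sym_nonlinearity :: "nat \<Rightarrow> (int \<Rightarrow> 'v::real_normed_vector \<Rightarrow> 'v) \<Rightarrow> bool" where
  "sym_nonlinearity N g \<longleftrightarrow> (\<forall>x. continuous_on UNIV (g x)) \<and> (\<forall>x v. g (x + int N) v = g x v) \<and>
     (\<forall>x v. g (- x) v = g x v) \<and> (\<forall>x v. g x (- v) = - g x v)"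

lemma sym_grid_residual:
  assumes u: "sym_grid s \<sigma> N u" and g: "sym_nonlinearity N g" and s: "s = 1 \<or> s = -1"
  shows "sym_grid s \<sigma> N (\<lambda>x. g x (u x) - grid_laplacian h u x)"
proof -
  have un: "u (- x) = s *\<^sub>R u x" and up: "u (x + int N) = (-1) ^ \<sigma> *\<^sub>R u x" for x
    using u by (auto simp: sym_grid_def)
  have neg: "g x (r *\<^sub>R v) = r *\<^sub>R g x v" if "r = 1 \<or> r = -1" for r x v
    using that g by (auto simp: sym_nonlinearity_def)
  have "u (- x + 1) = s *\<^sub>R u (x - 1)" "u (- x - 1) = s *\<^sub>R u (x + 1)" for x
    using un[of "x - 1"] un[of "x + 1"] by simp_all
  then have 1: "g (- x) (u (- x)) - grid_laplacian h u (- x) = s *\<^sub>R (g x (u x) - grid_laplacian h u x)" for x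
    using g neg[OF s] by (simp add: grid_laplacian_def sym_nonlinearity_def un algebra_simps)
  have e: "u (x + int N + 1) = (-1) ^ \<sigma> *\<^sub>R u (x + 1)" "u (x + int N - 1) = (-1) ^ \<sigma> *\<^sub>R u (x - 1)" for x
    using up[of "x + 1"] up[of "x - 1"] by (simp_all add: algebra_simps)
  have 2: "g (x + int N) (u (x + int N)) - grid_laplacian h u (x + int N) =
      (-1) ^ \<sigma> *\<^sub>R (g x (u x) - grid_laplacian h u x)" for x
    unfolding grid_laplacian_def e up using g neg[OF pm_one_power]
    by (simp add: sym_nonlinearity_def scaleR_right_distrib scaleR_right_diff_distrib mult.commute)
  show ?thesis using 1 2 by (simp add: sym_grid_def)
qed

lemma sym_grid_norm_attains_max:
  fixes u :: "int \<Rightarrow> 'v::real_normed_vector"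
  assumes "sym_grid s \<sigma> N u" "N > 0"
  obtains x0 where "\<And>x. norm (u x) \<le> norm (u x0)"
proof -
  have mod: "norm (u x) = norm (u (x mod int N))" for x
    by (rule sym_grid_norm_mod[OF assms(1), symmetric])
  define S where "S = (\<lambda>x. norm (u x)) ` {0..<int N}"
  have S: "finite S" "S \<noteq> {}" using assms by (auto simp: S_def)
  obtain x0 where x0: "norm (u x0) = Max S" using Max_in[OF S] by (auto simp: S_def)
  have "norm (u x) \<le> norm (u x0)" for x
    unfolding x0 mod[of x] using S assms by (intro Max_ge) (auto simp: S_def)
  then show thesis by (rule that)
qed

text \<open>
  At a point where \<open>|u|\<close> is maximal, the Cauchy--Schwarz inequality gives \<open>\<Delta>u \<bullet> u \<le> 0\<close>, so the
  nonlinearity cannot point outwards there.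
\<close>

lemma discrete_maximum_principle:
  fixes u :: "int \<Rightarrow> 'v::real_inner"
  assumes u: "sym_grid s \<sigma> N u" and N: "N > 0" and eq: "\<And>x. grid_laplacian h u x = g x (u x)"
    and out: "\<And>x v. norm v \<ge> M \<Longrightarrow> g x v \<bullet> v > 0"
  shows "norm (u x) < M"
proof -
  obtain x0 where max: "\<And>x. norm (u x) \<le> norm (u x0)"
    using sym_grid_norm_attains_max[OF u N] by blast
  have cs: "u y \<bullet> u x0 \<le> u x0 \<bullet> u x0" for y
    using norm_cauchy_schwarz[of "u y" "u x0"] mult_right_mono[OF max[of y] norm_ge_zero[of "u x0"]]
    by (simp add: power2_norm_eq_inner[symmetric] power2_eq_square)
  have "grid_laplacian h u x0 \<bullet> u x0 = (u (x0 + 1) \<bullet> u x0 - 2 * (u x0 \<bullet> u x0) + u (x0 - 1) \<bullet> u x0) / h\<^sup>2"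
    by (simp add: grid_laplacian_def inner_diff_left inner_add_left divide_inverse mult.commute)
  also have "\<dots> \<le> 0"
    using cs[of "x0 + 1"] cs[of "x0 - 1"] by (intro divide_nonpos_nonneg) auto
  finally have "norm (u x0) < M" using out[of "u x0" x0] eq[of x0] by force
  then show ?thesis using max[of x] by simp
qed

text \<open>
  Grid functions are described by coefficients \<open>c 0, \<dots>, c n\<close> with respect to the products of modes and eigenvectors,
  listed by \<open>en\<close>. The coefficient vectors are functions on the naturals because
  this is the form in which the sphere appears in the degree theory.
\<close>

locale discrete_problem =
  fixes s :: real and \<sigma> N n :: nat and h :: real and A :: "real ^ 'k ^ 'k" and B :: "(real ^ 'k) set"
    and en :: "nat \<Rightarrow> nat \<times> (real ^ 'k)"
  assumes s: "s = 1 \<or> s = -1" and N: "N > 0" and parity: "odd (N + \<sigma>)" and h: "h > 0"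
    and sym: "transpose A = A" and basis: "orthonormal_eigenbasis A B"
    and en: "bij_betw en {..n} (mode_set s \<sigma> N \<times> B)"
begin

definition wave :: "nat \<Rightarrow> int \<Rightarrow> real" where "wave i = mode s N (fst (en i))"

definition dir :: "nat \<Rightarrow> real ^ 'k" where "dir i = snd (en i)"

definition weight :: "nat \<Rightarrow> real" where "weight i = mode_norm N (fst (en i))"

definition lap_eig :: "nat \<Rightarrow> real" where
  "lap_eig i = (2 - 2 * cos (real (fst (en i)) * pi / real N)) / h\<^sup>2"

definition mat_eig :: "nat \<Rightarrow> real" where "mat_eig i = dir i \<bullet> (A *v dir i)"

definition synth :: "(nat \<Rightarrow> real) \<Rightarrow> int \<Rightarrow> real ^ 'k" where
  "synth c x = (\<Sum>i\<le>n. (c i * wave i x) *\<^sub>R dir i)"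

definition coef :: "(int \<Rightarrow> real ^ 'k) \<Rightarrow> nat \<Rightarrow> real" where
  "coef w i = (if i \<le> n then \<Sum>x<N. wave i (int x) * (w (int x) \<bullet> dir i) else 0)"

lemma en_mem: "i \<le> n \<Longrightarrow> fst (en i) \<in> mode_set s \<sigma> N" "i \<le> n \<Longrightarrow> dir i \<in> B"
  using bij_betwE[OF en] by (auto simp: dir_def mem_Times_iff)

lemma weight_pos: "weight i \<ge> real N / 2" "weight i > 0"
  using N by (auto simp: weight_def mode_norm_def)

lemma lap_eig_nonneg: "lap_eig i \<ge> 0"
  unfolding lap_eig_def by (intro divide_nonneg_nonneg) auto

lemma dir_eigen: "i \<le> n \<Longrightarrow> A *v dir i = mat_eig i *\<^sub>R dir i"
  using basis en_mem(2) by (simp add: mat_eig_def orthonormal_eigenbasis_def)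

lemma sym_wave: "i \<le> n \<Longrightarrow> sym_grid s \<sigma> N (wave i)"
  unfolding wave_def by (intro sym_grid_mode N s en_mem)

lemma sym_synth: "sym_grid s \<sigma> N (synth c)"
  using sym_wave
  by (auto simp: sym_grid_def synth_def scaleR_sum_right mult.left_commute intro!: sum.cong)

lemma grid_laplacian_synth: "grid_laplacian h (synth c) x = - synth (\<lambda>i. lap_eig i * c i) x"
proof -
  have w: "wave i (x + 1) - 2 * wave i x + wave i (x - 1) = - (lap_eig i * h\<^sup>2 * wave i x)" for i
    using mode_second_difference[of s N "fst (en i)" x] h by (simp add: wave_def lap_eig_def)
  have "synth c (x + 1) - 2 *\<^sub>R synth c x + synth c (x - 1) =
      (\<Sum>i\<le>n. (c i * (wave i (x + 1) - 2 * wave i x + wave i (x - 1))) *\<^sub>R dir i)"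
    by (simp add: synth_def scaleR_sum_right sum_subtractf[symmetric] sum.distrib[symmetric] algebra_simps)
  also have "\<dots> = h\<^sup>2 *\<^sub>R (- synth (\<lambda>i. lap_eig i * c i) x)"
    unfolding w by (simp add: synth_def scaleR_sum_right sum_negf[symmetric] algebra_simps)
  finally show ?thesis using h by (simp add: grid_laplacian_def)
qed

lemma matrix_synth: "A *v synth c x = synth (\<lambda>i. mat_eig i * c i) x"
  by (simp add: synth_def linear_sum[OF matrix_vector_mul_linear]
      matrix_vector_mult_scaleR dir_eigen mult_ac)

lemma synth_add: "synth (\<lambda>i. c i + d i) x = synth c x + synth d x"
  by (simp add: synth_def algebra_simps sum.distrib)

lemma synth_scale: "synth (\<lambda>i. r * c i) x = r *\<^sub>R synth c x"
  by (simp add: synth_def scaleR_sum_right mult.assoc)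

lemma coef_synth:
  assumes i: "i \<le> n"
  shows "coef (synth c) i = weight i * c i"
proof -
  have "(\<Sum>x<N. wave i (int x) * wave j (int x)) * (dir j \<bullet> dir i) = (if j = i then weight i else 0)" if j: "j \<le> n" for j
  proof (cases "j = i")
    case True
    then show ?thesis
      using mode_orthogonality[OF N s en_mem(1)[OF i] en_mem(1)[OF i]] eigenbasis_inner[OF basis en_mem(2)[OF i] en_mem(2)[OF i]]
      by (simp add: wave_def weight_def)
  next
    case False
    then have "en j \<noteq> en i" using en i j by (auto simp: bij_betw_def inj_on_def)
    then have "fst (en j) \<noteq> fst (en i) \<or> dir j \<noteq> dir i" by (auto simp: dir_def prod_eq_iff)
    then show ?thesis
      using False mode_orthogonality[OF N s en_mem(1)[OF i] en_mem(1)[OF j]] eigenbasis_inner[OF basis en_mem(2)[OF j] en_mem(2)[OF i]]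
      by (auto simp: wave_def)
  qed
  note orth = this
  have "coef (synth c) i = (\<Sum>x<N. \<Sum>j\<le>n. c j * (wave i (int x) * wave j (int x) * (dir j \<bullet> dir i)))"
    using i by (simp add: coef_def synth_def inner_sum_left sum_distrib_left mult_ac)
  also have "\<dots> = (\<Sum>j\<le>n. c j * ((\<Sum>x<N. wave i (int x) * wave j (int x)) * (dir j \<bullet> dir i)))"
    by (subst sum.swap) (simp add: sum_distrib_left sum_distrib_right)
  also have "\<dots> = (\<Sum>j\<le>n. if j = i then c j * weight i else 0)"
    using orth by (intro sum.cong) auto
  also have "\<dots> = weight i * c i" using i by simp
  finally show ?thesis .
qed

lemma parseval: "(\<Sum>x<N. (norm (synth c (int x)))\<^sup>2) = (\<Sum>i\<le>n. weight i * (c i)\<^sup>2)"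
proof -
  have "(\<Sum>x<N. (norm (synth c (int x)))\<^sup>2) = (\<Sum>x<N. synth c (int x) \<bullet> (\<Sum>i\<le>n. (c i * wave i (int x)) *\<^sub>R dir i))"
    by (simp add: power2_norm_eq_inner synth_def)
  also have "\<dots> = (\<Sum>x<N. \<Sum>i\<le>n. c i * (wave i (int x) * (synth c (int x) \<bullet> dir i)))"
    by (simp add: inner_sum_right mult_ac)
  also have "\<dots> = (\<Sum>i\<le>n. c i * coef (synth c) i)"
    by (subst sum.swap) (simp add: coef_def sum_distrib_left)
  also have "\<dots> = (\<Sum>i\<le>n. weight i * (c i)\<^sup>2)"
    by (simp add: coef_synth power2_eq_square mult_ac)
  finally show ?thesis .
qed

lemma coef_zero_imp_zero:
  assumes w: "sym_grid s \<sigma> N w" and z: "\<And>i. i \<le> n \<Longrightarrow> coef w i = 0"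
  shows "w x = 0"
proof -
  have "w x \<bullet> e = 0" if e: "e \<in> B" for e
  proof -
    have "sym_grid s \<sigma> N (\<lambda>x. w x \<bullet> e)" using w by (simp add: sym_grid_def)
    moreover have "(\<Sum>x<N. mode s N a (int x) * (w (int x) \<bullet> e)) = 0" if a: "a \<in> mode_set s \<sigma> N" for a
    proof -
      obtain i where "i \<le> n" "en i = (a, e)"
        using en a e by (force simp: bij_betw_def image_iff)
      then show ?thesis using z[of i] by (simp add: coef_def wave_def dir_def)
    qed
    ultimately show ?thesis by (rule sym_grid_orthogonal_modes_zero[OF parity s N])
  qed
  then show ?thesis
    using eigenbasis_expansion[OF basis, of "w x"] by simp
qed

end

context discrete_problem
begin

definition residual_coef :: "(int \<Rightarrow> real ^ 'k \<Rightarrow> real ^ 'k) \<Rightarrow> (nat \<Rightarrow> real) \<Rightarrow> nat \<Rightarrow> real" where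
  "residual_coef g c = coef (\<lambda>x. g x (synth c x) - grid_laplacian h (synth c) x)"

lemma residual_coef_zero_imp_solution:
  assumes "sym_nonlinearity N g" and "residual_coef g c = (\<lambda>_. 0)"
  shows "grid_laplacian h (synth c) x = g x (synth c x)"
proof -
  have "g x (synth c x) - grid_laplacian h (synth c) x = 0"
    by (rule coef_zero_imp_zero[OF sym_grid_residual[OF sym_synth assms(1) s]])
       (use assms(2) in \<open>simp add: residual_coef_def\<close>)
  then show ?thesis by simp
qed

lemma residual_coef_linear:
  assumes "i \<le> n"
  shows "residual_coef (\<lambda>x v. q *\<^sub>R (A *v v) + r *\<^sub>R v) c i = weight i * (lap_eig i + q * mat_eig i + r) * c i"
proof -
  have "q *\<^sub>R (A *v synth c x) + r *\<^sub>R synth c x - grid_laplacian h (synth c) x =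
      synth (\<lambda>i. (lap_eig i + q * mat_eig i + r) * c i) x" for x
  proof -
    have "synth (\<lambda>i. (lap_eig i + q * mat_eig i + r) * c i) x =
        synth (\<lambda>i. lap_eig i * c i + (q * (mat_eig i * c i) + r * c i)) x"
      by (rule arg_cong[where f = "\<lambda>d. synth d x"]) (simp add: fun_eq_iff algebra_simps)
    then show ?thesis by (simp add: matrix_synth grid_laplacian_synth synth_add synth_scale)
  qed
  then show ?thesis
    unfolding residual_coef_def by (simp add: coef_synth assms)
qed

text \<open>
  For \<open>u\<close> inside the ball of radius \<open>\<delta>\<close> the nonlinear remainder is at most \<open>c0/2\<close> times \<open>|u|\<close>
  pointwise, but by Parseval's identity the linear part enlarges the mean square norm at least by the factor \<open>c0\<close>.
\<close>

lemma nonzero_solution_lower_bound: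
  assumes c: "c \<in> coord_space n" "c \<noteq> (\<lambda>_. 0)"
    and gap: "\<And>i. i \<le> n \<Longrightarrow> \<bar>lap_eig i + mat_eig i\<bar> \<ge> c0" and c0: "c0 > 0"
    and small: "\<And>x v. norm v \<le> \<delta> \<Longrightarrow> norm (g x v - A *v v) \<le> c0 / 2 * norm v"
    and sol: "\<And>x. grid_laplacian h (synth c) x = g x (synth c x)"
  shows "\<exists>x. norm (synth c x) > \<delta>"
proof (rule ccontr)
  assume "\<not> ?thesis"
  then have le: "norm (synth c x) \<le> \<delta>" for x by (simp add: not_less)
  define d where "d = (\<lambda>i. (lap_eig i + mat_eig i) * c i)"
  have d: "synth d x = A *v synth c x - grid_laplacian h (synth c) x" for x
    by (simp add: d_def matrix_synth grid_laplacian_synth distrib_right synth_add)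
  have nd: "norm (synth d x) \<le> c0 / 2 * norm (synth c x)" for x
    using small[OF le[of x], of x] unfolding d sol by (simp add: norm_minus_commute)
  have "c0\<^sup>2 * (\<Sum>i\<le>n. weight i * (c i)\<^sup>2) \<le> (\<Sum>i\<le>n. weight i * (d i)\<^sup>2)"
    unfolding sum_distrib_left
  proof (rule sum_mono)
    fix i assume "i \<in> {..n}"
    then have "c0\<^sup>2 \<le> (lap_eig i + mat_eig i)\<^sup>2"
      using gap[of i] c0 by (intro abs_le_square_iff[THEN iffD1]) auto
    then have "c0\<^sup>2 * (weight i * (c i)\<^sup>2) \<le> (lap_eig i + mat_eig i)\<^sup>2 * (weight i * (c i)\<^sup>2)"
      using weight_pos(2)[of i] by (intro mult_right_mono) auto
    then show "c0\<^sup>2 * (weight i * (c i)\<^sup>2) \<le> weight i * (d i)\<^sup>2"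
      by (simp add: d_def power_mult_distrib mult_ac)
  qed
  also have "\<dots> = (\<Sum>x<N. (norm (synth d (int x)))\<^sup>2)" by (simp add: parseval)
  also have "\<dots> \<le> (\<Sum>x<N. (c0 / 2)\<^sup>2 * (norm (synth c (int x)))\<^sup>2)"
    unfolding power_mult_distrib[symmetric] using nd by (intro sum_mono power_mono) auto
  also have "\<dots> = (c0 / 2)\<^sup>2 * (\<Sum>i\<le>n. weight i * (c i)\<^sup>2)"
    by (simp add: sum_distrib_left[symmetric] parseval)
  finally have "c0\<^sup>2 * (\<Sum>i\<le>n. weight i * (c i)\<^sup>2) \<le> c0\<^sup>2 * (\<Sum>i\<le>n. weight i * (c i)\<^sup>2) / 4"
    by (simp add: power_divide)
  moreover have "(\<Sum>i\<le>n. weight i * (c i)\<^sup>2) > 0"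
  proof -
    obtain i where i: "i \<le> n" "c i \<noteq> 0" using c by (force simp: coord_space_def fun_eq_iff not_le[symmetric])
    then show ?thesis
      using weight_pos(2) by (intro sum_pos2[of _ i]) (auto intro!: mult_nonneg_nonneg less_imp_le[OF weight_pos(2)])
  qed
  then have "c0\<^sup>2 * (\<Sum>i\<le>n. weight i * (c i)\<^sup>2) > 0" using c0 by simp
  ultimately show False by simp
qed

lemma continuous_on_synth:
  assumes "\<And>i. continuous_on S (\<lambda>p. c p i)"
  shows "continuous_on S (\<lambda>p. synth (c p) x)"
  unfolding synth_def by (intro continuous_intros assms)

text \<open>
  All deformations below change the nonlinearity or the radius of the sphere; they are homotopies as long as no
  coefficient vector on the way solves the equation.
\<close>

lemma homotopic_residuals:
  fixes a b :: real
  assumes "a \<le> b"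
    and g: "\<And>x. continuous_on ({a..b} \<times> UNIV) (\<lambda>p. G (fst p) x (snd p))"
    and nz: "\<And>\<tau> c. \<tau> \<in> {a..b} \<Longrightarrow> c \<in> coord_sphere n \<Longrightarrow>
      residual_coef (G \<tau>) (\<lambda>i. \<rho> \<tau> * c i) \<noteq> (\<lambda>_. 0)"
    and \<rho>: "continuous_on {a..b} \<rho>"
  shows "homotopic_with_canon (\<lambda>_. True) (coord_sphere n) (coord_space n - {\<lambda>_. 0})
    (\<lambda>c. residual_coef (G a) (\<lambda>i. \<rho> a * c i)) (\<lambda>c. residual_coef (G b) (\<lambda>i. \<rho> b * c i))"
proof (rule homotopic_coord_family[where H = "\<lambda>\<tau> c. residual_coef (G \<tau>) (\<lambda>i. \<rho> \<tau> * c i)", OF \<open>a \<le> b\<close>])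
  fix i
  let ?S = "{a..b} \<times> coord_sphere n"
  have snd: "continuous_on X (\<lambda>p::real \<times> (nat \<Rightarrow> real). snd p i)" for X i
    by (rule continuous_on_coord_compose[OF continuous_on_snd[OF continuous_on_id]])
  have \<rho>': "continuous_on ?S (\<lambda>p. \<rho> (fst p))"
    by (rule continuous_on_compose2[OF \<rho>]) (auto intro!: continuous_intros)
  have syn: "continuous_on ?S (\<lambda>p. synth (\<lambda>i. \<rho> (fst p) * snd p i) x)" for x
    by (intro continuous_on_synth continuous_intros snd \<rho>')
  have nl: "continuous_on ?S (\<lambda>p. G (fst p) x (synth (\<lambda>i. \<rho> (fst p) * snd p i) x))" for x
  proof -
    have "continuous_on ?S (\<lambda>p. (fst p, synth (\<lambda>i. \<rho> (fst p) * snd p i) x))"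
      by (intro continuous_intros syn)
    from continuous_on_compose2[OF g[of x] this] show ?thesis by (auto simp: image_subset_iff)
  qed
  show "continuous_on ?S (\<lambda>p. residual_coef (G (fst p)) (\<lambda>i. \<rho> (fst p) * snd p i) i)"
    unfolding residual_coef_def coef_def grid_laplacian_def
    by (cases "i \<le> n") (auto intro!: continuous_intros syn nl)
next
  fix \<tau> c assume "\<tau> \<in> {a..b}" "c \<in> coord_sphere n"
  then show "residual_coef (G \<tau>) (\<lambda>i. \<rho> \<tau> * c i) \<in> coord_space n - {\<lambda>_. 0}"
    using nz by (simp add: coord_space_def residual_coef_def coef_def)
qed

text \<open>
  Otherwise three homotopies would connect two diagonal maps of different parity: from
  the linearisation to \<open>g\<close> on a small sphere (excluded zeros: spectral gap), from the small to a large sphere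
  (excluded zeros: the contradiction hypothesis), and from \<open>g\<close> to the identity on the large sphere (excluded
  zeros: maximum principle).
\<close>

theorem discrete_nonzero_solution:
  assumes g: "sym_nonlinearity N g"
    and gap: "\<And>i. i \<le> n \<Longrightarrow> \<bar>lap_eig i + mat_eig i\<bar> \<ge> c0" and c0: "c0 > 0" and \<delta>: "\<delta> > 0"
    and small: "\<And>x v. norm v \<le> \<delta> \<Longrightarrow> norm (g x v - A *v v) \<le> c0 / 2 * norm v"
    and out: "\<And>x v. norm v \<ge> M \<Longrightarrow> g x v \<bullet> v > 0"
    and M: "M > 0"
    and odd: "odd (card {i. i \<le> n \<and> lap_eig i + mat_eig i < 0})"
  shows "\<exists>u. sym_grid s \<sigma> N u \<and> (\<forall>x. grid_laplacian h u x = g x (u x)) \<and> (\<forall>x. norm (u x) < M) \<and>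
    (\<exists>x. norm (u x) > \<delta>)"
proof -
  have "\<exists>c\<in>coord_space n - {\<lambda>_. 0}. residual_coef g c = (\<lambda>_. 0)"
  proof (rule ccontr)
    assume none: "\<not> ?thesis"
    have gx: "continuous_on UNIV (g x)" for x using g by (simp add: sym_nonlinearity_def)
    have gc: "continuous_on X (\<lambda>p. g x (snd p))" for x and X :: "(real \<times> (real ^ 'k)) set"
      by (rule continuous_on_compose2[OF gx]) (auto intro!: continuous_intros)
    have Ac: "continuous_on X (\<lambda>p. A *v snd p)" for X :: "(real \<times> (real ^ 'k)) set"
      by (rule continuous_on_compose2[OF matrix_vector_mult_linear_continuous_on[of UNIV]]) (auto intro!: continuous_intros)
    have scaled: "(\<lambda>i. r * c i) \<in> coord_space n - {\<lambda>_. 0}" if "c \<in> coord_sphere n" "r > 0" for r c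
    proof -
      have "c \<noteq> (\<lambda>_. 0)" using that by (auto simp: coord_sphere_def)
      then show ?thesis using that by (auto simp: coord_sphere_def coord_space_def fun_eq_iff)
    qed
    \<comment> \<open>The function with coefficients \<open>\<epsilon> c\<close> is a sum of \<open>n + 1\<close> terms of norm at most \<open>\<epsilon>\<close>.\<close>
    define \<epsilon> where "\<epsilon> = \<delta> / real (n + 1)"
    have \<epsilon>: "\<epsilon> > 0" using \<delta> by (simp add: \<epsilon>_def)
    have wave1: "\<bar>wave i x\<bar> \<le> 1" for i x by (simp add: wave_def mode_def)
    have dir1: "norm (dir i) = 1" if "i \<le> n" for i
      using basis en_mem(2)[OF that] by (simp add: orthonormal_eigenbasis_def)
    have small_synth: "norm (synth (\<lambda>i. \<epsilon> * c i) x) \<le> \<delta>" if c: "c \<in> coord_sphere n" for c x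
    proof -
      have c1: "\<bar>c i\<bar> \<le> 1" if "i \<le> n" for i
      proof -
        have "(c i)\<^sup>2 \<le> (\<Sum>i\<le>n. (c i)\<^sup>2)" using that by (intro member_le_sum) auto
        then show ?thesis using c by (simp add: coord_sphere_def abs_square_le_1)
      qed
      have "norm (synth (\<lambda>i. \<epsilon> * c i) x) \<le> (\<Sum>i\<le>n. \<epsilon>)"
        unfolding synth_def
      proof (rule sum_norm_le)
        fix i assume i: "i \<in> {..n}"
        have "\<bar>c i\<bar> * \<bar>wave i x\<bar> \<le> 1 * 1" using c1 wave1 i by (intro mult_mono) auto
        then show "norm ((\<epsilon> * c i * wave i x) *\<^sub>R dir i) \<le> \<epsilon>"
          using dir1 i \<epsilon> by (simp add: abs_mult mult.assoc)
      qed
      also have "\<dots> = \<delta>" by (simp add: \<epsilon>_def add.commute)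
      finally show ?thesis .
    qed
    \<comment> \<open>Every weight is at least \<open>N/2\<close>, so \<open>R\<^sup>2 / 2 > M\<^sup>2\<close> suffices for a value of norm at least \<open>M\<close>.\<close>
    define R where "R = 2 * M + \<epsilon>"
    have R: "R \<ge> \<epsilon>" "R > 0" using \<epsilon> M by (auto simp: R_def)
    have large_synth: "\<exists>x. norm (synth (\<lambda>i. R * c i) x) \<ge> M" if c: "c \<in> coord_sphere n" for c
    proof (rule ccontr)
      assume "\<not> ?thesis"
      then have lt: "norm (synth (\<lambda>i. R * c i) x) < M" for x by (simp add: not_le)
      have "real N * (R\<^sup>2 / 2) = (\<Sum>i\<le>n. real N / 2 * (R * c i)\<^sup>2)"
      proof -
        have "(\<Sum>i\<le>n. real N / 2 * (R * c i)\<^sup>2) = real N / 2 * R\<^sup>2 * (\<Sum>i\<le>n. (c i)\<^sup>2)"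
          by (simp add: sum_distrib_left power_mult_distrib mult.assoc)
        then show ?thesis using c by (simp add: coord_sphere_def)
      qed
      also have "\<dots> \<le> (\<Sum>i\<le>n. weight i * (R * c i)\<^sup>2)"
        using weight_pos(1) by (intro sum_mono mult_right_mono) auto
      also have "\<dots> = (\<Sum>x<N. (norm (synth (\<lambda>i. R * c i) (int x)))\<^sup>2)" by (simp add: parseval)
      also have "\<dots> \<le> (\<Sum>x<N. M\<^sup>2)"
        using lt by (intro sum_mono power_mono) (auto intro: less_imp_le)
      finally have "R\<^sup>2 / 2 \<le> M\<^sup>2" using N by simp
      moreover have "(2 * M)\<^sup>2 \<le> R\<^sup>2" using M \<epsilon> by (intro power_mono) (auto simp: R_def)
      moreover have "M\<^sup>2 > 0" using M by simp
      ultimately show False by simp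
    qed
    let ?hom = "homotopic_with_canon (\<lambda>_. True) (coord_sphere n) (coord_space n - {\<lambda>_. 0})"
    define G0 where "G0 = (\<lambda>\<tau> x v. (1 - \<tau>) *\<^sub>R (A *v v) + \<tau> *\<^sub>R g x v)"
    define G1 where "G1 = (\<lambda>\<tau> x v. (1 - \<tau>) *\<^sub>R g x v + \<tau> *\<^sub>R v)"
    have h1: "?hom (\<lambda>c. residual_coef (G0 0) (\<lambda>i. \<epsilon> * c i)) (\<lambda>c. residual_coef (G0 1) (\<lambda>i. \<epsilon> * c i))"
    proof (rule homotopic_residuals[where \<rho> = "\<lambda>_. \<epsilon>"])
      show "continuous_on ({0..1} \<times> UNIV) (\<lambda>p. G0 (fst p) x (snd p))" for x
        unfolding G0_def by (intro continuous_intros gc Ac)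
      fix \<tau> :: real and c assume \<tau>: "\<tau> \<in> {0..1}" and c: "c \<in> coord_sphere n"
      have "sym_nonlinearity N (G0 \<tau>)"
        using g by (auto simp: sym_nonlinearity_def G0_def intro!: continuous_intros matrix_vector_mult_linear_continuous_on
            simp: linear_neg[OF matrix_vector_mul_linear])
      moreover have "norm (G0 \<tau> x v - A *v v) \<le> c0 / 2 * norm v" if "norm v \<le> \<delta>" for x v
      proof -
        have "G0 \<tau> x v - A *v v = \<tau> *\<^sub>R (g x v - A *v v)" by (simp add: G0_def algebra_simps)
        then have "norm (G0 \<tau> x v - A *v v) \<le> 1 * norm (g x v - A *v v)"
          using \<tau> mult_right_mono[of \<tau> 1 "norm (g x v - A *v v)"] by simp
        then show ?thesis using small[OF that, of x] by simp
      qed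
      ultimately show "residual_coef (G0 \<tau>) (\<lambda>i. \<epsilon> * c i) \<noteq> (\<lambda>_. 0)"
        using nonzero_solution_lower_bound[of "\<lambda>i. \<epsilon> * c i" c0 \<delta> "G0 \<tau>"] residual_coef_zero_imp_solution[of "G0 \<tau>"]
          scaled[OF c \<epsilon>] gap c0 small_synth[OF c] by (metis DiffE insertCI not_less)
    qed auto
    have h2: "?hom (\<lambda>c. residual_coef g (\<lambda>i. \<epsilon> * c i)) (\<lambda>c. residual_coef g (\<lambda>i. R * c i))"
    proof (rule homotopic_residuals[where \<rho> = "\<lambda>\<tau>. \<tau>" and G = "\<lambda>_. g"])
      show "residual_coef g (\<lambda>i. \<tau> * c i) \<noteq> (\<lambda>_. 0)" if "\<tau> \<in> {\<epsilon>..R}" "c \<in> coord_sphere n" for \<tau> c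
        using none scaled[OF that(2), of \<tau>] that(1) \<epsilon> by auto
    qed (use R gc in auto)
    have h3: "?hom (\<lambda>c. residual_coef (G1 0) (\<lambda>i. R * c i)) (\<lambda>c. residual_coef (G1 1) (\<lambda>i. R * c i))"
    proof (rule homotopic_residuals[where \<rho> = "\<lambda>_. R"])
      show "continuous_on ({0..1} \<times> UNIV) (\<lambda>p. G1 (fst p) x (snd p))" for x
        unfolding G1_def by (intro continuous_intros gc)
      fix \<tau> :: real and c assume \<tau>: "\<tau> \<in> {0..1}" and c: "c \<in> coord_sphere n"
      obtain x where x: "norm (synth (\<lambda>i. R * c i) x) \<ge> M" using large_synth[OF c] by blast
      have G1: "sym_nonlinearity N (G1 \<tau>)"
        using g by (auto simp: sym_nonlinearity_def G1_def intro!: continuous_intros)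
      show "residual_coef (G1 \<tau>) (\<lambda>i. R * c i) \<noteq> (\<lambda>_. 0)"
      proof
        assume "residual_coef (G1 \<tau>) (\<lambda>i. R * c i) = (\<lambda>_. 0)"
        then have sol: "grid_laplacian h (synth (\<lambda>i. R * c i)) y = G1 \<tau> y (synth (\<lambda>i. R * c i) y)" for y
          by (rule residual_coef_zero_imp_solution[OF G1])
        have "norm (synth (\<lambda>i. R * c i) x) < M"
        proof (rule discrete_maximum_principle[where g = "G1 \<tau>", OF sym_synth N sol])
          fix y and v :: "real ^ 'k" assume v: "norm v \<ge> M"
          then have "v \<bullet> v > 0" using M by auto
          moreover have "G1 \<tau> y v \<bullet> v = (1 - \<tau>) * (g y v \<bullet> v) + \<tau> * (v \<bullet> v)"
            by (simp add: G1_def inner_add_left)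
          moreover have "g y v \<bullet> v > 0" using out v by simp
          ultimately show "G1 \<tau> y v \<bullet> v > 0" using \<tau> by (cases "\<tau> = 0") (auto intro: add_nonneg_pos)
        qed
        then show False using x by simp
      qed
    qed auto
    define d where "d = (\<lambda>i. if i \<le> n then weight i * (lap_eig i + mat_eig i) * \<epsilon> else 0)"
    define w where "w = (\<lambda>i. if i \<le> n then weight i * (lap_eig i + 1) * R else 0)"
    have "G0 0 = (\<lambda>x v. 1 *\<^sub>R (A *v v) + 0 *\<^sub>R v)" "G0 1 = g" "G1 0 = g"
      "G1 1 = (\<lambda>x v. 0 *\<^sub>R (A *v v) + 1 *\<^sub>R v)"
      by (auto simp: G0_def G1_def fun_eq_iff)
    note ends = this
    have out_n: "residual_coef g' c i = 0" if "\<not> i \<le> n" for g' c i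
      using that by (simp add: residual_coef_def coef_def)
    have "(\<lambda>c. residual_coef (G0 0) (\<lambda>i. \<epsilon> * c i)) = (\<lambda>c i. d i * c i)"
    proof (intro ext)
      fix c i show "residual_coef (G0 0) (\<lambda>i. \<epsilon> * c i) i = d i * c i"
        using residual_coef_linear[of i 1 0 "\<lambda>i. \<epsilon> * c i"] out_n[of i]
        unfolding ends by (cases "i \<le> n") (auto simp: d_def)
    qed
    moreover have "(\<lambda>c. residual_coef (G1 1) (\<lambda>i. R * c i)) = (\<lambda>c i. w i * c i)"
    proof (intro ext)
      fix c i show "residual_coef (G1 1) (\<lambda>i. R * c i) i = w i * c i"
        using residual_coef_linear[of i 0 1 "\<lambda>i. R * c i"] out_n[of i]
        unfolding ends by (cases "i \<le> n") (auto simp: w_def)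
    qed
    ultimately have "?hom (\<lambda>c i. d i * c i) (\<lambda>c i. w i * c i)"
      using homotopic_with_trans[OF homotopic_with_trans[OF h1[unfolded ends] h2] h3[unfolded ends]] unfolding ends
      by simp
    moreover have "{i. i \<le> n \<and> d i < 0} = {i. i \<le> n \<and> lap_eig i + mat_eig i < 0}"
    proof -
      have "weight i * (lap_eig i + mat_eig i) * \<epsilon> < 0 \<longleftrightarrow> lap_eig i + mat_eig i < 0" for i
        using weight_pos(2)[of i] \<epsilon> by (simp add: mult_less_0_iff zero_less_mult_iff not_less less_imp_le)
      then show ?thesis by (auto simp: d_def)
    qed
    moreover have "d i \<noteq> 0" if "i \<le> n" for i
      using gap[OF that] c0 weight_pos(2)[of i] \<epsilon> that by (auto simp: d_def)
    moreover have "w i > 0" if "i \<le> n" for i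
      using weight_pos(2)[of i] lap_eig_nonneg[of i] R that by (simp add: w_def)
    ultimately show False
      using diagonal_maps_not_homotopic[of n d w] odd by simp
  qed
  then obtain c where c: "c \<in> coord_space n" "c \<noteq> (\<lambda>_. 0)" "residual_coef g c = (\<lambda>_. 0)" by auto
  note sol = residual_coef_zero_imp_solution[OF g c(3)]
  show ?thesis
    using sym_synth sol discrete_maximum_principle[where g = g, OF sym_synth N sol out]
      nonzero_solution_lower_bound[OF c(1,2) gap c0 small sol] by blast
qed

end

section \<open>Passage to the limit\<close>

text \<open>
  Pairs \<open>(k, x)\<close> with \<open>k\<close> tending to infinity and the grid point \<open>x h\<^sub>k\<close> tending to \<open>t\<close>. Convergence of
  grid functions along all these filters is continuous convergence; it is preserved by
  continuous nonlinearities and by shifting \<open>x\<close> by one, without further equicontinuity arguments.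
\<close>

definition grid_filter :: "(nat \<Rightarrow> real) \<Rightarrow> real \<Rightarrow> (nat \<times> int) filter" where
  "grid_filter h t = filtercomap (\<lambda>(k, x). (k, of_int x * h k)) (sequentially \<times>\<^sub>F nhds t)"

lemma filterlim_grid_filter:
  "filterlim (\<lambda>y. (K y, X y)) (grid_filter h t) F \<longleftrightarrow>
    filterlim K sequentially F \<and> ((\<lambda>y. of_int (X y) * h (K y)) \<longlongrightarrow> t) F"
proof -
  have "filterlim (\<lambda>y. (K y, X y)) (grid_filter h t) F \<longleftrightarrow>
      filterlim (\<lambda>y. (K y, of_int (X y) * h (K y))) (sequentially \<times>\<^sub>F nhds t) F"
    unfolding grid_filter_def filterlim_filtercomap_iff by (simp add: o_def)
  also have "\<dots> \<longleftrightarrow> filterlim K sequentially F \<and> ((\<lambda>y. of_int (X y) * h (K y)) \<longlongrightarrow> t) F"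
  proof
    assume l: "filterlim (\<lambda>y. (K y, of_int (X y) * h (K y))) (sequentially \<times>\<^sub>F nhds t) F"
    show "filterlim K sequentially F \<and> ((\<lambda>y. of_int (X y) * h (K y)) \<longlongrightarrow> t) F"
      using filterlim_compose[OF filterlim_fst l] filterlim_compose[OF filterlim_snd l] by simp
  qed (auto intro: filterlim_Pair)
  finally show ?thesis .
qed

lemma grid_filter_limits:
  "filterlim fst sequentially (grid_filter h t)"
  "((\<lambda>p. of_int (snd p) * h (fst p)) \<longlongrightarrow> t) (grid_filter h t)"
  using filterlim_grid_filter[of fst snd h t "grid_filter h t"] by (simp_all add: filterlim_ident)

lemma eventually_grid_filterD:
  assumes "eventually P (grid_filter h t)"
  obtains \<delta> K where "\<delta> > 0" "\<And>k x. k \<ge> K \<Longrightarrow> \<bar>of_int x * h k - t\<bar> < \<delta> \<Longrightarrow> P (k, x)"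
proof -
  obtain Q where Q: "eventually Q (sequentially \<times>\<^sub>F nhds t)" "\<And>k x. Q (k, of_int x * h k) \<Longrightarrow> P (k, x)"
    using assms unfolding grid_filter_def eventually_filtercomap by auto
  obtain P1 P2 where P: "eventually P1 sequentially" "eventually P2 (nhds t)" "\<And>k y. P1 k \<Longrightarrow> P2 y \<Longrightarrow> Q (k, y)"
    using Q(1) unfolding eventually_prod_filter by blast
  obtain K where "\<And>k. k \<ge> K \<Longrightarrow> P1 k" using P(1) by (auto simp: eventually_sequentially)
  moreover obtain \<delta> where "\<delta> > 0" "\<And>y. \<bar>y - t\<bar> < \<delta> \<Longrightarrow> P2 y"
    using P(2) by (auto simp: eventually_nhds_metric dist_real_def)
  ultimately show thesis using that[of \<delta> K] P(3) Q(2) by blast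
qed

lemma floor_grid_tendsto:
  fixes h :: "nat \<Rightarrow> real"
  assumes h: "\<And>k. h k > 0" "h \<longlonglongrightarrow> 0"
  shows "(\<lambda>k. of_int \<lfloor>t / h k\<rfloor> * h k) \<longlonglongrightarrow> t"
proof (rule tendsto_sandwich)
  have fl: "of_int \<lfloor>t / h k\<rfloor> * h k \<le> t" "t - h k \<le> of_int \<lfloor>t / h k\<rfloor> * h k" for k
  proof -
    have "of_int \<lfloor>t / h k\<rfloor> \<le> t / h k" "t / h k - 1 \<le> of_int \<lfloor>t / h k\<rfloor>" by linarith+
    then have "of_int \<lfloor>t / h k\<rfloor> * h k \<le> t / h k * h k" "(t / h k - 1) * h k \<le> of_int \<lfloor>t / h k\<rfloor> * h k"
      using mult_right_mono[OF _ less_imp_le[OF h(1)[of k]]] by blast+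
    moreover have "t / h k * h k = t" using h(1)[of k] by simp
    ultimately show "of_int \<lfloor>t / h k\<rfloor> * h k \<le> t" "t - h k \<le> of_int \<lfloor>t / h k\<rfloor> * h k"
      by (simp_all add: left_diff_distrib)
  qed
  show "\<forall>\<^sub>F k in sequentially. t - h k \<le> of_int \<lfloor>t / h k\<rfloor> * h k" using fl by simp
  show "\<forall>\<^sub>F k in sequentially. of_int \<lfloor>t / h k\<rfloor> * h k \<le> t" using fl by simp
  show "(\<lambda>k. t - h k) \<longlonglongrightarrow> t" using tendsto_diff[OF tendsto_const h(2), of t] by simp
qed simp

lemma floor_filterlim_grid_filter:
  assumes "\<And>k. h k > 0" "h \<longlonglongrightarrow> 0"
  shows "filterlim (\<lambda>k. (k, \<lfloor>t / h k\<rfloor>)) (grid_filter h t) sequentially"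
  unfolding filterlim_grid_filter using floor_grid_tendsto[OF assms] by (simp add: filterlim_ident)

lemma norm_diff_grid_le:
  fixes a :: "int \<Rightarrow> 'v::real_normed_vector"
  assumes "\<And>x. i \<le> x \<Longrightarrow> x < j \<Longrightarrow> norm (a (x + 1) - a x - w) \<le> C" and "i \<le> j"
  shows "norm (a j - a i - of_int (j - i) *\<^sub>R w) \<le> of_int (j - i) * C"
  using assms(2,1)
proof (induction j rule: int_ge_induct)
  case (step j)
  have "norm (a (j + 1) - a i - of_int (j + 1 - i) *\<^sub>R w) \<le>
      norm (a j - a i - of_int (j - i) *\<^sub>R w) + norm (a (j + 1) - a j - w)"
    by (rule norm_triangle_le[THEN order_trans[rotated]])
       (auto simp: algebra_simps intro: norm_triangle_ineq[THEN order_trans[rotated]])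
  also have "\<dots> \<le> of_int (j - i) * C + C"
    using step by (intro add_mono) auto
  finally show ?case by (simp add: algebra_simps)
qed simp

text \<open>
  Near \<open>t0\<close> the increments of \<open>a k\<close> over one step differ from \<open>h k *\<^sub>R \<beta>\<close> by at most \<open>\<epsilon> h k\<close>. Summing and
  passing to the limit gives the same estimate for the increments of \<open>\<alpha>\<close>.
\<close>

lemma grid_limit_has_vector_derivative:
  fixes a b :: "nat \<Rightarrow> int \<Rightarrow> 'v::real_normed_vector"
  assumes h: "\<And>k. h k > 0" "h \<longlonglongrightarrow> 0"
    and step: "\<And>k x. a k (x + 1) - a k x = h k *\<^sub>R b k x"
    and a: "\<And>t. ((\<lambda>(k, x). a k x) \<longlongrightarrow> \<alpha> t) (grid_filter h t)"
    and b: "((\<lambda>(k, x). b k x) \<longlongrightarrow> \<beta>) (grid_filter h t0)"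
  shows "(\<alpha> has_vector_derivative \<beta>) (at t0)"
proof -
  have key: "\<exists>\<delta>>0. \<forall>t t'. t0 - \<delta> < t \<and> t \<le> t' \<and> t' < t0 + \<delta> \<longrightarrow> norm (\<alpha> t' - \<alpha> t - (t' - t) *\<^sub>R \<beta>) \<le> \<epsilon> * (t' - t)"
    if \<epsilon>: "\<epsilon> > 0" for \<epsilon>
  proof -
    have "eventually (\<lambda>p. dist (case p of (k, x) \<Rightarrow> b k x) \<beta> < \<epsilon>) (grid_filter h t0)"
      using b \<epsilon> by (rule tendstoD)
    then obtain \<delta> K where \<delta>: "\<delta> > 0" and K: "\<And>k x. k \<ge> K \<Longrightarrow> \<bar>of_int x * h k - t0\<bar> < \<delta> \<Longrightarrow> norm (b k x - \<beta>) < \<epsilon>"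
      by (rule eventually_grid_filterD) (auto simp: dist_norm)
    show ?thesis
    proof (intro exI conjI allI impI)
      show "\<delta> > 0" by fact
      fix t t' assume t: "t0 - \<delta> < t \<and> t \<le> t' \<and> t' < t0 + \<delta>"
      let ?i = "\<lambda>k. \<lfloor>t / h k\<rfloor>" and ?j = "\<lambda>k. \<lfloor>t' / h k\<rfloor>"
      have at: "(\<lambda>k. a k \<lfloor>s / h k\<rfloor>) \<longlonglongrightarrow> \<alpha> s" for s
        using filterlim_compose[OF a floor_filterlim_grid_filter[OF h]] by simp
      have gt: "(\<lambda>k. of_int (?j k) * h k - of_int (?i k) * h k) \<longlonglongrightarrow> t' - t"
        by (intro tendsto_diff floor_grid_tendsto h)
      have l1: "(\<lambda>k. norm (a k (?j k) - a k (?i k) - (of_int (?j k) * h k - of_int (?i k) * h k) *\<^sub>R \<beta>))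
          \<longlonglongrightarrow> norm (\<alpha> t' - \<alpha> t - (t' - t) *\<^sub>R \<beta>)"
        by (intro tendsto_intros at gt)
      have l2: "(\<lambda>k. \<epsilon> * (of_int (?j k) * h k - of_int (?i k) * h k)) \<longlonglongrightarrow> \<epsilon> * (t' - t)"
        by (intro tendsto_intros gt)
      have "\<forall>\<^sub>F k in sequentially. \<bar>of_int (?i k) * h k - t\<bar> < t - (t0 - \<delta>)"
        using tendstoD[OF floor_grid_tendsto[OF h, of t], of "t - (t0 - \<delta>)"] t by (simp add: dist_real_def)
      then have "\<forall>\<^sub>F k in sequentially. norm (a k (?j k) - a k (?i k) - (of_int (?j k) * h k - of_int (?i k) * h k) *\<^sub>R \<beta>)
          \<le> \<epsilon> * (of_int (?j k) * h k - of_int (?i k) * h k)"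
        using eventually_ge_at_top[of K]
      proof eventually_elim
        case (elim k)
        have ij: "?i k \<le> ?j k" using t h(1)[of k] by (intro floor_mono divide_right_mono) auto
        have "norm (a k (?j k) - a k (?i k) - of_int (?j k - ?i k) *\<^sub>R (h k *\<^sub>R \<beta>)) \<le> of_int (?j k - ?i k) * (h k * \<epsilon>)"
        proof (rule norm_diff_grid_le[OF _ ij])
          fix x assume x: "?i k \<le> x" "x < ?j k"
          have "of_int (?i k) * h k \<le> of_int x * h k" using x h(1)[of k] by simp
          moreover have "of_int x * h k \<le> t'"
          proof -
            have "of_int x \<le> t' / h k" using x by linarith
            then show ?thesis using h(1)[of k] by (simp add: field_simps)
          qed
          ultimately have "\<bar>of_int x * h k - t0\<bar> < \<delta>" using elim(1) t by linarith
          then have "norm (b k x - \<beta>) \<le> \<epsilon>" using K[OF elim(2)] less_imp_le by blast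
          moreover have "a k (x + 1) - a k x - h k *\<^sub>R \<beta> = h k *\<^sub>R (b k x - \<beta>)"
            by (simp add: step scaleR_diff_right)
          ultimately show "norm (a k (x + 1) - a k x - h k *\<^sub>R \<beta>) \<le> h k * \<epsilon>"
            using h(1)[of k] by simp
        qed
        then show ?case by (simp add: algebra_simps)
      qed
      then show "norm (\<alpha> t' - \<alpha> t - (t' - t) *\<^sub>R \<beta>) \<le> \<epsilon> * (t' - t)"
        by (rule tendsto_le[OF trivial_limit_sequentially l2 l1])
    qed
  qed
  show ?thesis
    unfolding has_vector_derivative_def has_derivative_at_alt
  proof (intro conjI allI impI)
    fix \<epsilon> :: real assume "\<epsilon> > 0"
    then obtain \<delta> where \<delta>: "\<delta> > 0" and D: "\<And>t t'. t0 - \<delta> < t \<and> t \<le> t' \<and> t' < t0 + \<delta> \<Longrightarrow>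
        norm (\<alpha> t' - \<alpha> t - (t' - t) *\<^sub>R \<beta>) \<le> \<epsilon> * (t' - t)"
      using key by blast
    have "norm (\<alpha> y - \<alpha> t0 - (y - t0) *\<^sub>R \<beta>) \<le> \<epsilon> * norm (y - t0)" if "norm (y - t0) < \<delta>" for y
    proof (cases "t0 \<le> y")
      case True
      then show ?thesis using D[of t0 y] that by simp
    next
      case False
      then have "norm (\<alpha> t0 - \<alpha> y - (t0 - y) *\<^sub>R \<beta>) \<le> \<epsilon> * (t0 - y)" using D[of y t0] that by simp
      moreover have "\<alpha> t0 - \<alpha> y - (t0 - y) *\<^sub>R \<beta> = - (\<alpha> y - \<alpha> t0 - (y - t0) *\<^sub>R \<beta>)" by (simp add: algebra_simps)
      ultimately show ?thesis using False by (simp only: norm_minus_cancel) simp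
    qed
    then show "\<exists>d>0. \<forall>y. norm (y - t0) < d \<longrightarrow> norm (\<alpha> y - \<alpha> t0 - (y - t0) *\<^sub>R \<beta>) \<le> \<epsilon> * norm (y - t0)"
      using \<delta> by blast
  qed (rule bounded_linear_scaleR_left)
qed

definition linear_interpolation :: "real \<Rightarrow> (int \<Rightarrow> 'v::real_vector) \<Rightarrow> real \<Rightarrow> 'v" where
  "linear_interpolation h a t = a \<lfloor>t / h\<rfloor> + (t / h - of_int \<lfloor>t / h\<rfloor>) *\<^sub>R (a (\<lfloor>t / h\<rfloor> + 1) - a \<lfloor>t / h\<rfloor>)"

lemma linear_interpolation_grid: "h > 0 \<Longrightarrow> linear_interpolation h a (of_int x * h) = a x"
  by (simp add: linear_interpolation_def)

lemma linear_interpolation_lipschitz: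
  fixes a :: "int \<Rightarrow> 'v::real_normed_vector"
  assumes h: "h > 0" and B: "\<And>x. norm (a (x + 1) - a x) \<le> B * h"
  shows "norm (linear_interpolation h a t' - linear_interpolation h a t) \<le> B * \<bar>t' - t\<bar>"
proof -
  have le: "norm (linear_interpolation h a t' - linear_interpolation h a t) \<le> B * (t' - t)" if "t \<le> t'" for t t'
  proof -
    let ?i = "\<lfloor>t / h\<rfloor>" and ?j = "\<lfloor>t' / h\<rfloor>"
    have ij: "?i \<le> ?j" using that h by (intro floor_mono divide_right_mono) auto
    have B': "norm (r *\<^sub>R (a (x + 1) - a x)) \<le> B * (r * h)" if "r \<ge> 0" for r x
      using mult_left_mono[OF B[of x] that] that by (simp add: mult_ac)
    have th: "t / h * h = t" "t' / h * h = t'" using h by auto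
    show ?thesis
    proof (cases "?i = ?j")
      case True
      have "linear_interpolation h a t' - linear_interpolation h a t = (t' / h - t / h) *\<^sub>R (a (?i + 1) - a ?i)"
        unfolding linear_interpolation_def True[symmetric] by (simp add: algebra_simps)
      then show ?thesis
        using B'[of "t' / h - t / h" ?i] that h by (simp add: divide_right_mono left_diff_distrib)
    next
      case False
      then have ij1: "?i + 1 \<le> ?j" using ij by simp
      have "linear_interpolation h a t' - linear_interpolation h a t =
          (t' / h - of_int ?j) *\<^sub>R (a (?j + 1) - a ?j) + (a ?j - a (?i + 1)) + (of_int ?i + 1 - t / h) *\<^sub>R (a (?i + 1) - a ?i)"
        by (simp add: linear_interpolation_def algebra_simps)
      also have "norm \<dots> \<le> B * ((t' / h - of_int ?j) * h) + of_int (?j - (?i + 1)) * (B * h) + B * ((of_int ?i + 1 - t / h) * h)"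
      proof (intro norm_triangle_le add_mono)
        show "norm ((t' / h - of_int ?j) *\<^sub>R (a (?j + 1) - a ?j)) \<le> B * ((t' / h - of_int ?j) * h)"
          by (rule B') simp
        show "norm (a ?j - a (?i + 1)) \<le> of_int (?j - (?i + 1)) * (B * h)"
          using norm_diff_grid_le[of "?i + 1" ?j a 0 "B * h"] B ij1 by simp
        show "norm ((of_int ?i + 1 - t / h) *\<^sub>R (a (?i + 1) - a ?i)) \<le> B * ((of_int ?i + 1 - t / h) * h)"
          by (rule B') linarith
      qed
      also have "\<dots> = B * (t' / h * h - t / h * h)" by (simp only: of_int_diff of_int_add of_int_1) (simp add: algebra_simps)
      finally show ?thesis unfolding th .
    qed
  qed
  show ?thesis
    using le[of t t'] le[of t' t] by (cases "t \<le> t'") (auto simp: norm_minus_commute)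
qed

lemma linear_interpolation_quasiperiodic:
  assumes h: "h > 0" "h * real N = L" and per: "\<And>x. a (x + int N) = r *\<^sub>R a x"
  shows "linear_interpolation h a (t + L) = r *\<^sub>R linear_interpolation h a t"
proof -
  have e: "(t + L) / h = t / h + of_int (int N)"
    using h by (simp add: field_simps)
  have p1: "a (x + int N + 1) = r *\<^sub>R a (x + 1)" for x using per[of "x + 1"] by (simp add: algebra_simps)
  show ?thesis
    unfolding linear_interpolation_def e floor_add_int[symmetric] per p1
    by (simp add: algebra_simps)
qed

lemma reduce_mod_period:
  fixes L :: real
  assumes "L > 0"
  obtains k :: int where "t - of_int k * L \<in> {0..L}"
proof
  have fl: "of_int \<lfloor>t / L\<rfloor> \<le> t / L" "t / L \<le> of_int \<lfloor>t / L\<rfloor> + 1" by linarith+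
  have "of_int \<lfloor>t / L\<rfloor> * L \<le> t / L * L" "t / L * L \<le> (of_int \<lfloor>t / L\<rfloor> + 1) * L"
    using mult_right_mono[OF fl(1) less_imp_le[OF assms]] mult_right_mono[OF fl(2) less_imp_le[OF assms]] by blast+
  then show "t - of_int \<lfloor>t / L\<rfloor> * L \<in> {0..L}" using assms by (auto simp: distrib_right)
qed

text \<open>
  Arzela--Ascoli for the piecewise linear interpolations on one period. Uniformity extends to the whole line, since
  the distance of two quasiperiodic functions with the same factor \<open>r\<close> of modulus \<open>1\<close> is periodic.
\<close>

theorem grid_sequence_compactness:
  fixes a :: "nat \<Rightarrow> int \<Rightarrow> 'v::euclidean_space"
  assumes h: "\<And>k. h k > 0" and L: "L > 0" "\<And>k. h k * real (N k) = L"
    and bd: "\<And>k x. norm (a k x) \<le> M" and lip: "\<And>k x. norm (a k (x + 1) - a k x) \<le> B * h k"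
    and per: "\<And>k x. a k (x + int (N k)) = r *\<^sub>R a k x" and r: "\<bar>r\<bar> = 1"
  obtains \<phi> \<alpha> where "strict_mono (\<phi> :: nat \<Rightarrow> nat)" "continuous_on UNIV \<alpha>"
    "\<And>\<epsilon>. \<epsilon> > 0 \<Longrightarrow> \<forall>\<^sub>F k in sequentially. \<forall>x. norm (a (\<phi> k) x - \<alpha> (of_int x * h (\<phi> k))) < \<epsilon>"
proof -
  define F where "F = (\<lambda>k. linear_interpolation (h k) (a k))"
  have B: "B \<ge> 0"
    using order_trans[OF norm_ge_zero lip[of 0 0]] h[of 0] by (simp add: zero_le_mult_iff)
  have lipF: "norm (F k t' - F k t) \<le> B * \<bar>t' - t\<bar>" for k t t'
    unfolding F_def by (rule linear_interpolation_lipschitz[where a = "a k", OF h lip])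
  have F0: "F k 0 = a k 0" for k
    using linear_interpolation_grid[OF h, of k "a k" 0] by (simp add: F_def)
  have perF: "F k (t + L) = r *\<^sub>R F k t" for k t
    unfolding F_def by (rule linear_interpolation_quasiperiodic[where a = "a k", OF h L(2) per])
  have bdF: "norm (F k t) \<le> M + B * L" if "t \<in> {0..L}" for k t
  proof -
    have "norm (F k t) \<le> norm (F k 0) + norm (F k t - F k 0)" by (rule norm_triangle_sub)
    also have "\<dots> \<le> M + B * \<bar>t - 0\<bar>" unfolding F0 using bd lipF[of k t 0] F0 by (intro add_mono) auto
    also have "\<dots> \<le> M + B * L" using that B by (intro add_left_mono mult_left_mono) auto
    finally show ?thesis .
  qed
  have eqF: "\<exists>d>0. \<forall>k y. y \<in> {0..L} \<and> norm (t - y) < d \<longrightarrow> norm (F k t - F k y) < e" if "t \<in> {0..L}" "0 < e" for t e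
  proof (intro exI[of _ "e / (B + 1)"] conjI allI impI)
    fix k y assume "y \<in> {0..L} \<and> norm (t - y) < e / (B + 1)"
    then have "(B + 1) * \<bar>t - y\<bar> < e" using B by (simp add: field_simps)
    moreover have "norm (F k t - F k y) \<le> (B + 1) * \<bar>t - y\<bar>"
      using lipF[of k t y] by (simp add: distrib_right)
    ultimately show "norm (F k t - F k y) < e" by linarith
  qed (use that B in simp)
  obtain g \<phi> where \<phi>: "strict_mono (\<phi> :: nat \<Rightarrow> nat)"
    and g: "\<And>e. 0 < e \<Longrightarrow> \<exists>K. \<forall>k t. k \<ge> K \<and> t \<in> {0..L} \<longrightarrow> norm (F (\<phi> k) t - g t) < e"
    by (rule Arzela_Ascoli[where \<F> = F, OF compact_Icc bdF eqF]) (assumption+, blast)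
  have "uniformly_Cauchy_on UNIV (\<lambda>k. F (\<phi> k))"
    unfolding uniformly_Cauchy_on_def
  proof (intro allI impI)
    fix e :: real assume e: "e > 0"
    then obtain K where K: "\<And>k t. k \<ge> K \<Longrightarrow> t \<in> {0..L} \<Longrightarrow> norm (F (\<phi> k) t - g t) < e / 2"
      using g[of "e / 2"] by auto
    have "dist (F (\<phi> k) t) (F (\<phi> l) t) < e" if "k \<ge> K" "l \<ge> K" for k l t
    proof -
      let ?D = "\<lambda>t. norm (F (\<phi> k) t - F (\<phi> l) t)"
      obtain j :: int where t': "t - of_int j * L \<in> {0..L}" using reduce_mod_period[OF L(1)] by blast
      let ?t = "t - of_int j * L"
      have "?D (s + L) = ?D s" for s
        unfolding perF scaleR_diff_right[symmetric] using r by simp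
      from periodic_int[of ?D, OF this, of ?t j] have "?D t = ?D ?t" by simp
      also have "\<dots> \<le> norm (F (\<phi> k) ?t - g ?t) + norm (F (\<phi> l) ?t - g ?t)"
        using norm_triangle_ineq4[of "F (\<phi> k) ?t - g ?t" "F (\<phi> l) ?t - g ?t"] by simp
      also have "\<dots> < e / 2 + e / 2" using K[OF that(1) t'] K[OF that(2) t'] by (rule add_strict_mono)
      finally show ?thesis by (simp add: dist_norm)
    qed
    then show "\<exists>K. \<forall>x\<in>UNIV. \<forall>k\<ge>K. \<forall>l\<ge>K. dist (F (\<phi> k) x) (F (\<phi> l) x) < e" by blast
  qed
  then have "uniformly_convergent_on UNIV (\<lambda>k. F (\<phi> k))" by (rule Cauchy_uniformly_convergent)
  then obtain \<alpha> where \<alpha>: "uniform_limit UNIV (\<lambda>k. F (\<phi> k)) \<alpha> sequentially"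
    by (auto simp: uniformly_convergent_on_def)
  have "continuous_on UNIV (F k)" for k
  proof (rule continuous_onI)
    fix t and e :: real assume e: "e > 0"
    have "dist (F k t') (F k t) \<le> e" if "dist t' t < e / (B + 1)" for t'
    proof -
      have "(B + 1) * \<bar>t' - t\<bar> < e" using that B by (simp add: field_simps dist_real_def)
      then show ?thesis using lipF[of k t' t] by (simp add: distrib_right dist_norm)
    qed
    then show "\<exists>d>0. \<forall>t'\<in>UNIV. dist t' t < d \<longrightarrow> dist (F k t') (F k t) \<le> e"
      using e B by (intro exI[of _ "e / (B + 1)"]) auto
  qed
  then have "continuous_on UNIV \<alpha>"
    by (intro uniform_limit_theorem[OF _ \<alpha>]) auto
  moreover have "\<forall>\<^sub>F k in sequentially. \<forall>x. norm (a (\<phi> k) x - \<alpha> (of_int x * h (\<phi> k))) < \<epsilon>" if "\<epsilon> > 0" for \<epsilon>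
    using uniform_limitD[OF \<alpha> that]
  proof eventually_elim
    case (elim k)
    then show ?case
      using linear_interpolation_grid[OF h, of "\<phi> k" "a (\<phi> k)"] by (auto simp: F_def dist_norm) metis
  qed
  ultimately show thesis using that \<phi> by blast
qed

lemma uniform_grid_limit_tendsto:
  fixes a :: "nat \<Rightarrow> int \<Rightarrow> 'v::real_normed_vector"
  assumes unif: "\<And>\<epsilon>. \<epsilon> > 0 \<Longrightarrow> \<forall>\<^sub>F k in sequentially. \<forall>x. norm (a k x - \<alpha> (of_int x * h k)) < \<epsilon>"
    and cont: "continuous_on UNIV \<alpha>"
  shows "((\<lambda>(k, x). a k x) \<longlongrightarrow> \<alpha> t) (grid_filter h t)"
proof -
  have "((\<lambda>p. \<alpha> (of_int (snd p) * h (fst p))) \<longlongrightarrow> \<alpha> t) (grid_filter h t)"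
    by (rule continuous_on_tendsto_compose[OF cont grid_filter_limits(2)]) auto
  moreover have "((\<lambda>p. a (fst p) (snd p) - \<alpha> (of_int (snd p) * h (fst p))) \<longlongrightarrow> 0) (grid_filter h t)"
  proof (rule tendstoI)
    fix e :: real assume "e > 0"
    from unif[OF this] have "\<forall>\<^sub>F p in grid_filter h t. \<forall>x. norm (a (fst p) x - \<alpha> (of_int x * h (fst p))) < e"
      by (rule eventually_compose_filterlim[OF _ grid_filter_limits(1)])
    then show "\<forall>\<^sub>F p in grid_filter h t. dist (a (fst p) (snd p) - \<alpha> (of_int (snd p) * h (fst p))) 0 < e"
      by eventually_elim simp
  qed
  ultimately show ?thesis
    using tendsto_add by (fastforce simp: case_prod_unfold)
qed

definition has_sym_solution ::
    "(real \<Rightarrow> 'v::real_normed_vector \<Rightarrow> 'v) \<Rightarrow> real \<Rightarrow> nat \<Rightarrow> real \<Rightarrow> bool" where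
  "has_sym_solution f s \<sigma> L \<longleftrightarrow> (\<exists>w v. (\<forall>t. (w has_vector_derivative v t) (at t)) \<and>
    (\<forall>t. (v has_vector_derivative f t (w t)) (at t)) \<and> (\<forall>t. w (- t) = s *\<^sub>R w t) \<and>
    (\<forall>t. w (t + L) = (-1) ^ \<sigma> *\<^sub>R w t) \<and> (\<exists>t. w t \<noteq> 0))"

text \<open>
  The second differences are bounded by the equation. The difference quotients \<open>d\<close> are bounded as well: over one
  period \<open>u\<close> changes by at most \<open>2M\<close>, while \<open>d\<close> varies by at most \<open>C L\<close>. Hence both \<open>u\<close> and \<open>d\<close> have
  convergent subsequences, with limits \<open>w\<close> and \<open>v = w'\<close>.
\<close>

theorem discrete_solutions_converge:
  fixes f :: "real \<Rightarrow> 'v::euclidean_space \<Rightarrow> 'v" and u :: "nat \<Rightarrow> int \<Rightarrow> 'v"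
  assumes h: "\<And>k. h k > 0" "h \<longlonglongrightarrow> 0" and L: "L > 0" "\<And>k. h k * real (N k) = L"
    and sym: "\<And>k. sym_grid s \<sigma> (N k) (u k)" and bd: "\<And>k x. norm (u k x) < M"
    and eq: "\<And>k x. grid_laplacian (h k) (u k) x = f (of_int x * h k) (u k x)"
    and cont: "continuous_on UNIV (\<lambda>(t, v). f t v)" and C: "\<And>t v. norm v \<le> M \<Longrightarrow> norm (f t v) \<le> C"
    and \<delta>: "\<delta> > 0" "\<And>k. \<exists>x. norm (u k x) > \<delta>"
  shows "has_sym_solution f s \<sigma> L"
proof -
  define d where "d = (\<lambda>k x. (u k (x + 1) - u k x) /\<^sub>R h k)"
  define g where "g = (\<lambda>k x. f (of_int (x + 1) * h k) (u k (x + 1)))"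
  have M: "M > 0" using bd[of 0 0] norm_ge_zero le_less_trans by blast
  have Npos: "N k > 0" for k using L(1) L(2)[of k] by (cases "N k") auto
  have du: "u k (x + 1) - u k x = h k *\<^sub>R d k x" for k x
    using h(1)[of k] by (simp add: d_def)
  have dd: "d k (x + 1) - d k x = h k *\<^sub>R g k x" for k x
  proof -
    have "g k x = grid_laplacian (h k) (u k) (x + 1)" by (simp add: g_def eq)
    also have "h k *\<^sub>R \<dots> = (u k (x + 1 + 1) - 2 *\<^sub>R u k (x + 1) + u k x) /\<^sub>R h k"
      using h(1)[of k] by (simp add: grid_laplacian_def power2_eq_square)
    also have "\<dots> = (u k (x + 1 + 1) - u k (x + 1) - (u k (x + 1) - u k x)) /\<^sub>R h k"
      by (simp add: scaleR_2)
    also have "\<dots> = d k (x + 1) - d k x" by (simp add: d_def scaleR_diff_right)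
    finally show ?thesis by simp
  qed
  have gC: "norm (g k x) \<le> C" for k x unfolding g_def by (intro C less_imp_le bd)
  have C0: "C \<ge> 0" using order_trans[OF norm_ge_zero gC] .
  define D where "D = 2 * M / L + C * L"
  have lip_d: "norm (d k (x + 1) - d k x) \<le> C * h k" for k x
    unfolding dd using gC[of k x] h(1)[of k] by (simp add: mult.commute)
  have per_u: "u k (x + int (N k)) = (-1) ^ \<sigma> *\<^sub>R u k x" for k x
    using sym by (simp add: sym_grid_def)
  have per_d: "d k (x + int (N k)) = (-1) ^ \<sigma> *\<^sub>R d k x" for k x
    using per_u[of k x] per_u[of k "x + 1"] by (simp add: d_def algebra_simps)
  have bd_d: "norm (d k x) \<le> D" for k x
  proof -
    have "norm (u k (x + int (N k)) - u k x - of_int (x + int (N k) - x) *\<^sub>R (h k *\<^sub>R d k x)) \<le>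
        of_int (x + int (N k) - x) * (h k * (C * L))"
    proof (rule norm_diff_grid_le)
      fix y assume y: "x \<le> y" "y < x + int (N k)"
      have "norm (d k y - d k x - of_int (y - x) *\<^sub>R 0) \<le> of_int (y - x) * (C * h k)"
        using lip_d y(1) by (intro norm_diff_grid_le) auto
      also have "\<dots> \<le> of_int (int (N k)) * (C * h k)"
        using y C0 h(1)[of k] by (intro mult_right_mono) (auto intro: mult_nonneg_nonneg less_imp_le)
      also have "\<dots> = C * L" using L(2)[of k] by (simp add: mult_ac)
      finally have "norm (d k y - d k x) \<le> C * L" by simp
      moreover have "u k (y + 1) - u k y - h k *\<^sub>R d k x = h k *\<^sub>R (d k y - d k x)"
        by (simp add: du scaleR_diff_right)
      ultimately show "norm (u k (y + 1) - u k y - h k *\<^sub>R d k x) \<le> h k * (C * L)"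
        using h(1)[of k] by simp
    qed simp
    then have "norm (u k (x + int (N k)) - u k x - (h k * real (N k)) *\<^sub>R d k x) \<le> (h k * real (N k)) * (C * L)"
      by (simp add: mult_ac)
    then have "norm (u k (x + int (N k)) - u k x - L *\<^sub>R d k x) \<le> L * (C * L)" unfolding L(2) .
    moreover have "norm (u k (x + int (N k)) - u k x) \<le> M + M"
      using bd[of k x] bd[of k "x + int (N k)"] by (intro norm_triangle_le_diff) linarith
    moreover have "norm (L *\<^sub>R d k x) \<le> norm (u k (x + int (N k)) - u k x) + norm (u k (x + int (N k)) - u k x - L *\<^sub>R d k x)"
      using norm_triangle_ineq4[of "u k (x + int (N k)) - u k x" "u k (x + int (N k)) - u k x - L *\<^sub>R d k x"] by simp
    ultimately have "L * norm (d k x) \<le> 2 * M + L * (C * L)" using L(1) by simp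
    then show ?thesis using L(1) by (simp add: D_def field_simps)
  qed
  have r: "\<bar>(-1) ^ \<sigma>\<bar> = (1::real)" by (simp add: power_abs)
  have lip_u: "norm (u k (x + 1) - u k x) \<le> D * h k" for k x
    unfolding du using bd_d[of k x] h(1)[of k] by (simp add: mult.commute)
  obtain \<phi> w where \<phi>: "strict_mono (\<phi> :: nat \<Rightarrow> nat)" and w: "continuous_on UNIV w"
    and wlim: "\<And>\<epsilon>. \<epsilon> > 0 \<Longrightarrow> \<forall>\<^sub>F k in sequentially. \<forall>x. norm (u (\<phi> k) x - w (of_int x * h (\<phi> k))) < \<epsilon>"
    by (rule grid_sequence_compactness[where a = u and N = N, OF h(1) L less_imp_le[OF bd] lip_u per_u r]) blast
  obtain \<psi> v where \<psi>: "strict_mono (\<psi> :: nat \<Rightarrow> nat)" and v: "continuous_on UNIV v"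
    and vlim: "\<And>\<epsilon>. \<epsilon> > 0 \<Longrightarrow> \<forall>\<^sub>F k in sequentially. \<forall>x. norm (d (\<phi> (\<psi> k)) x - v (of_int x * h (\<phi> (\<psi> k)))) < \<epsilon>"
    by (rule grid_sequence_compactness[where a = "\<lambda>k. d (\<phi> k)" and N = "\<lambda>k. N (\<phi> k)" and h = "\<lambda>k. h (\<phi> k)",
          OF h(1) L bd_d lip_d per_d r]) blast
  define \<theta> where "\<theta> = (\<lambda>k. \<phi> (\<psi> k))"
  define H where "H = (\<lambda>k. h (\<theta> k))"
  have \<theta>: "filterlim \<theta> sequentially sequentially"
    unfolding \<theta>_def using \<phi> \<psi> by (auto intro!: filterlim_subseq strict_monoI dest: strict_monoD)
  have H: "H k > 0" "H \<longlonglongrightarrow> 0" for k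
    unfolding H_def using h(1) filterlim_compose[OF h(2) \<theta>] by auto
  have wlim': "\<forall>\<^sub>F k in sequentially. \<forall>x. norm (u (\<theta> k) x - w (of_int x * H k)) < \<epsilon>" if "\<epsilon> > 0" for \<epsilon>
    unfolding \<theta>_def H_def using eventually_compose_filterlim[OF wlim[OF that] filterlim_subseq[OF \<psi>]] .
  have tw: "((\<lambda>(k, x). u (\<theta> k) x) \<longlongrightarrow> w t) (grid_filter H t)" for t
    by (rule uniform_grid_limit_tendsto[OF wlim' w])
  have tv: "((\<lambda>(k, x). d (\<theta> k) x) \<longlongrightarrow> v t) (grid_filter H t)" for t
    by (rule uniform_grid_limit_tendsto[OF _ v]) (use vlim in \<open>simp add: \<theta>_def H_def\<close>)
  have shift: "filterlim (\<lambda>p. (fst p, snd p + 1)) (grid_filter H t) (grid_filter H t)" for t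
  proof -
    have "((\<lambda>p. H (fst p)) \<longlongrightarrow> 0) (grid_filter H t)"
      by (rule filterlim_compose[OF H(2) grid_filter_limits(1)])
    then have "((\<lambda>p. of_int (snd p) * H (fst p) + H (fst p)) \<longlongrightarrow> t + 0) (grid_filter H t)"
      by (intro tendsto_add grid_filter_limits(2))
    then show ?thesis
      unfolding filterlim_grid_filter by (simp add: grid_filter_limits(1) algebra_simps)
  qed
  have tg: "((\<lambda>(k, x). g (\<theta> k) x) \<longlongrightarrow> f t (w t)) (grid_filter H t)" for t
  proof -
    have "((\<lambda>p. (of_int (snd p + 1) * H (fst p), u (\<theta> (fst p)) (snd p + 1))) \<longlongrightarrow> (t, w t)) (grid_filter H t)"
      using filterlim_compose[OF grid_filter_limits(2) shift] filterlim_compose[OF tw shift]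
      by (intro tendsto_Pair) simp_all
    from continuous_on_tendsto_compose[OF cont this] show ?thesis
      by (simp add: g_def H_def case_prod_unfold)
  qed
  have "(w has_vector_derivative v t) (at t)" for t
    by (rule grid_limit_has_vector_derivative[OF H _ tw tv]) (simp add: du H_def)
  moreover have "(v has_vector_derivative f t (w t)) (at t)" for t
    by (rule grid_limit_has_vector_derivative[OF H _ tv tg]) (simp add: dd H_def)
  moreover have "w (- t) = s *\<^sub>R w t" for t
  proof -
    let ?i = "\<lambda>k. \<lfloor>t / H k\<rfloor>"
    have "filterlim (\<lambda>k. (k, - ?i k)) (grid_filter H (- t)) sequentially"
      unfolding filterlim_grid_filter using tendsto_minus[OF floor_grid_tendsto[OF H, of t]]
      by (simp add: filterlim_ident)
    from filterlim_compose[OF tw this] have "(\<lambda>k. u (\<theta> k) (- ?i k)) \<longlonglongrightarrow> w (- t)" by simp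
    moreover have "(\<lambda>k. s *\<^sub>R u (\<theta> k) (?i k)) \<longlonglongrightarrow> s *\<^sub>R w t"
      using filterlim_compose[OF tw floor_filterlim_grid_filter[OF H]] by (intro tendsto_intros) simp
    moreover have "u (\<theta> k) (- ?i k) = s *\<^sub>R u (\<theta> k) (?i k)" for k using sym by (simp add: sym_grid_def)
    ultimately show ?thesis using LIMSEQ_unique by fastforce
  qed
  moreover have "w (t + L) = (-1) ^ \<sigma> *\<^sub>R w t" for t
  proof -
    let ?i = "\<lambda>k. \<lfloor>t / H k\<rfloor>"
    have "H k * real (N (\<theta> k)) = L" for k using L(2) by (simp add: H_def)
    then have "of_int (?i k + int (N (\<theta> k))) * H k = of_int (?i k) * H k + L" for k by (simp add: algebra_simps)
    then have "filterlim (\<lambda>k. (k, ?i k + int (N (\<theta> k)))) (grid_filter H (t + L)) sequentially"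
      unfolding filterlim_grid_filter using tendsto_add[OF floor_grid_tendsto[OF H, of t] tendsto_const[of L]]
      by (simp add: filterlim_ident)
    from filterlim_compose[OF tw this] have "(\<lambda>k. u (\<theta> k) (?i k + int (N (\<theta> k)))) \<longlonglongrightarrow> w (t + L)" by simp
    moreover have "(\<lambda>k. (-1) ^ \<sigma> *\<^sub>R u (\<theta> k) (?i k)) \<longlonglongrightarrow> (-1) ^ \<sigma> *\<^sub>R w t"
      using filterlim_compose[OF tw floor_filterlim_grid_filter[OF H]] by (intro tendsto_intros) simp
    ultimately show ?thesis unfolding per_u using LIMSEQ_unique by blast
  qed
  moreover have "\<exists>t. w t \<noteq> 0"
  proof -
    obtain k where k: "\<And>x. norm (u (\<theta> k) x - w (of_int x * H k)) < \<delta>"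
      using eventually_happens'[OF sequentially_bot wlim'[OF \<delta>(1)]] by blast
    obtain x where "norm (u (\<theta> k) x) > \<delta>" using \<delta>(2) by blast
    then have "w (of_int x * H k) \<noteq> 0" using k[of x] by auto
    then show ?thesis by blast
  qed
  ultimately show ?thesis unfolding has_sym_solution_def by blast
qed

section \<open>Symmetric solutions of the differential equation\<close>

text \<open>
  The eigenvalue of the negative discrete Laplacian of step \<open>L/N\<close> on the mode of index \<open>a\<close>.
\<close>

definition mode_eig :: "real \<Rightarrow> nat \<Rightarrow> nat \<Rightarrow> real" where
  "mode_eig L N a = (2 - 2 * cos (real a * pi / real N)) / (L / real N)\<^sup>2"

lemma mode_eig_tendsto:
  fixes L :: real
  assumes "L > 0"
  shows "(\<lambda>N. mode_eig L N a) \<longlonglongrightarrow> (real a * pi / L)\<^sup>2"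
proof (cases "a = 0")
  case True
  then show ?thesis by (simp add: mode_eig_def)
next
  case False
  define c where "c = real a * pi"
  have "c > 0" using False by (simp add: c_def)
  have "((\<lambda>x::real. (2 - 2 * cos (c / x)) / (L / x)\<^sup>2) \<longlongrightarrow> c * c * inverse (L\<^sup>2)) at_top"
    using \<open>c > 0\<close> \<open>L > 0\<close> by real_asymp
  moreover have "c * c * inverse (L\<^sup>2) = (c / L)\<^sup>2"
    by (simp add: power2_eq_square divide_inverse)
  ultimately show ?thesis
    using filterlim_compose[OF _ filterlim_real_sequentially] by (fastforce simp: c_def mode_eig_def)
qed

text \<open>
  The discrete eigenvalues are increasing in \<open>a\<close>, so for \<open>a \<ge> a0\<close> it suffices to control \<open>a0\<close>; for the finitely many
  smaller \<open>a\<close> they converge to the continuous ones. The same dichotomy shows that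
  the numbers of negative eigenvalues of the discrete and the continuous problem agree for large \<open>N\<close>.
\<close>

lemma uniform_spectral_gap:
  fixes S :: "real set"
  assumes L: "L > 0" and S: "finite S"
    and nonres: "\<And>a \<mu>. even (a + \<sigma>) \<Longrightarrow> s = 1 \<or> a > 0 \<Longrightarrow> \<mu> \<in> S \<Longrightarrow> (real a * pi / L)\<^sup>2 + \<mu> \<noteq> 0"
  obtains c0 a0 where "c0 > 0"
    "\<And>a \<mu>. a \<ge> a0 \<Longrightarrow> \<mu> \<in> S \<Longrightarrow> (real a * pi / L)\<^sup>2 + \<mu> > 0"
    "\<forall>\<^sub>F N in sequentially. \<forall>a\<in>mode_set s \<sigma> N. \<forall>\<mu>\<in>S.
       \<bar>mode_eig L N a + \<mu>\<bar> \<ge> c0 \<and>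
       (mode_eig L N a + \<mu> < 0 \<longleftrightarrow> (real a * pi / L)\<^sup>2 + \<mu> < 0)"
proof -
  define K where "K = (\<Sum>\<mu>\<in>S. \<bar>\<mu>\<bar>)"
  have K: "\<bar>\<mu>\<bar> \<le> K" if "\<mu> \<in> S" for \<mu>
    unfolding K_def using that S by (intro member_le_sum) auto
  obtain a0 :: nat where a0: "real a0 > sqrt (K + 2) * L / pi" using reals_Archimedean2 by blast
  then have "sqrt (K + 2) < real a0 * pi / L" using L by (simp add: field_simps)
  moreover have K0: "K \<ge> 0" by (simp add: K_def sum_nonneg)
  ultimately have a0K: "(real a0 * pi / L)\<^sup>2 > K + 2"
    using power_strict_mono[of "sqrt (K + 2)" "real a0 * pi / L" 2] by simp
  have large: "(real a * pi / L)\<^sup>2 + \<mu> > 0" if "a \<ge> a0" "\<mu> \<in> S" for a \<mu>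
  proof -
    have "(real a0 * pi / L)\<^sup>2 \<le> (real a * pi / L)\<^sup>2"
      using that L by (intro power_mono divide_right_mono mult_right_mono) auto
    then show ?thesis using a0K K[OF that(2)] by linarith
  qed
  define T where "T = insert 2 ((\<lambda>(a, \<mu>). \<bar>(real a * pi / L)\<^sup>2 + \<mu>\<bar>) ` {(a, \<mu>). a < a0 \<and> even (a + \<sigma>) \<and> (s = 1 \<or> a > 0) \<and> \<mu> \<in> S})"
  have "finite {(a, \<mu>). a < a0 \<and> even (a + \<sigma>) \<and> (s = 1 \<or> a > 0) \<and> \<mu> \<in> S}"
    by (rule finite_subset[of _ "{..<a0} \<times> S"]) (use S in auto)
  then have T: "finite T" "T \<noteq> {}" by (auto simp: T_def)
  define c1 where "c1 = Min T"
  have c1: "c1 > 0" unfolding c1_def using T nonres by (subst Min_gr_iff) (auto simp: T_def)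
  have c1_le: "c1 \<le> 2" "\<And>a \<mu>. a < a0 \<Longrightarrow> even (a + \<sigma>) \<Longrightarrow> s = 1 \<or> a > 0 \<Longrightarrow> \<mu> \<in> S \<Longrightarrow> c1 \<le> \<bar>(real a * pi / L)\<^sup>2 + \<mu>\<bar>"
    unfolding c1_def using T(1) by (auto intro!: Min_le simp: T_def)
  have lim: "(\<lambda>N. mode_eig L N a) \<longlonglongrightarrow> (real a * pi / L)\<^sup>2" for a
    by (rule mode_eig_tendsto[OF L])
  have "\<forall>\<^sub>F N in sequentially. mode_eig L N a0 > K + 2"
    using order_tendstoD(1)[OF lim a0K] .
  moreover have "\<forall>\<^sub>F N in sequentially. \<forall>a\<in>{..<a0}. dist (mode_eig L N a) ((real a * pi / L)\<^sup>2) < c1 / 2"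
    using tendstoD[OF lim, of "c1 / 2"] c1 by (intro eventually_ball_finite) auto
  ultimately have "\<forall>\<^sub>F N in sequentially. \<forall>a\<in>mode_set s \<sigma> N. \<forall>\<mu>\<in>S.
       \<bar>mode_eig L N a + \<mu>\<bar> \<ge> c1 / 2 \<and> (mode_eig L N a + \<mu> < 0 \<longleftrightarrow> (real a * pi / L)\<^sup>2 + \<mu> < 0)"
    using eventually_gt_at_top[of 0]
  proof eventually_elim
    case (elim N)
    show ?case
    proof (intro ballI)
      fix a \<mu> assume a: "a \<in> mode_set s \<sigma> N" and \<mu>: "\<mu> \<in> S"
      show "\<bar>mode_eig L N a + \<mu>\<bar> \<ge> c1 / 2 \<and> (mode_eig L N a + \<mu> < 0 \<longleftrightarrow> (real a * pi / L)\<^sup>2 + \<mu> < 0)"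
      proof (cases "a < a0")
        case True
        have "\<bar>mode_eig L N a - (real a * pi / L)\<^sup>2\<bar> < c1 / 2" using elim(2) True by (simp add: dist_real_def)
        moreover have "c1 \<le> \<bar>(real a * pi / L)\<^sup>2 + \<mu>\<bar>"
          using a \<mu> True by (intro c1_le) (auto simp: mode_set_def)
        ultimately show ?thesis by linarith
      next
        case False
        have "cos (real a * pi / real N) \<le> cos (real a0 * pi / real N)"
        proof (rule cos_monotone_0_pi_le)
          show "real a0 * pi / real N \<le> real a * pi / real N"
            using False by (intro divide_right_mono mult_right_mono) auto
          show "real a * pi / real N \<le> pi" using a elim(3) by (auto simp: mode_set_def field_simps)
        qed auto
        then have "mode_eig L N a0 \<le> mode_eig L N a" unfolding mode_eig_def by (intro divide_right_mono) auto
        then have "mode_eig L N a + \<mu> > 2" using elim(1) K[OF \<mu>] by linarith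
        then show ?thesis using large[of a \<mu>] False \<mu> c1_le(1) by auto
      qed
    qed
  qed
  then show thesis using that[of "c1 / 2" a0] c1 large by simp
qed

lemma eq_uminus_self_imp_zero:
  fixes v :: "'v::real_vector"
  assumes "v = - v"
  shows "v = 0"
proof -
  have "v + v = 0" using assms by (metis add.right_inverse)
  then have "2 *\<^sub>R v = 0" by (simp only: scaleR_2)
  then show ?thesis by (simp only: scaleR_eq_0_iff) simp
qed

definition negative_modes :: "real \<Rightarrow> nat \<Rightarrow> real \<Rightarrow> real \<Rightarrow> nat set" where
  "negative_modes s \<sigma> L \<mu> = {a. even (a + \<sigma>) \<and> (s = 1 \<or> a > 0) \<and> (real a * pi / L)\<^sup>2 + \<mu> < 0}"

lemma periodic_continuous_bounded:
  fixes f :: "real \<Rightarrow> 'v::euclidean_space \<Rightarrow> 'v"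
  assumes cont: "continuous_on UNIV (\<lambda>(t, v). f t v)" and L: "L > 0" and per: "\<And>t v. f (t + L) v = f t v"
  obtains C where "\<And>t v. norm v \<le> M \<Longrightarrow> norm (f t v) \<le> C"
proof -
  have "compact ((\<lambda>(t, v). f t v) ` ({0..L} \<times> cball 0 M))"
    by (intro compact_continuous_image continuous_on_subset[OF cont] compact_Times) auto
  then obtain C where "\<forall>y\<in>(\<lambda>(t, v). f t v) ` ({0..L} \<times> cball 0 M). norm y \<le> C"
    using compact_imp_bounded bounded_iff by blast
  then have C: "norm (f t v) \<le> C" if "t \<in> {0..L}" "norm v \<le> M" for t v
    using that by auto
  have "norm (f t v) \<le> C" if "norm v \<le> M" for t v
  proof -
    obtain j :: int where t': "t - of_int j * L \<in> {0..L}" using reduce_mod_period[OF L] by blast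
    have "f t v = f (t - of_int j * L) v"
      using periodic_int[of "\<lambda>t. f t v", OF per, of "t - of_int j * L" j] by simp
    then show ?thesis using C[OF t' that] by simp
  qed
  then show thesis by (rule that)
qed

text \<open>
  The index is the number of negative eigenvalues, with multiplicity, of \<open>-u'' + Au\<close> on the functions with the
  given symmetry.
\<close>

theorem nonzero_symmetric_solution:
  fixes f :: "real \<Rightarrow> real ^ 'k \<Rightarrow> real ^ 'k" and A :: "real ^ 'k ^ 'k"
  assumes s: "s = 1 \<or> s = -1" and L: "L > 0" and M: "M > 0"
    and cont: "continuous_on UNIV (\<lambda>(t, x). f t x)"
    and per: "\<And>t x. f (t + L) x = f t x" and even: "\<And>t x. f (- t) x = f t x" and odd: "\<And>t x. f t (- x) = - f t x"
    and sym: "transpose A = A"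
    and lin: "uniform_limit UNIV (\<lambda>x t. (f t x - A *v x) /\<^sub>R norm x) (\<lambda>t. 0) (at 0)"
    and nonres: "\<And>a \<mu>. even (a + \<sigma>) \<Longrightarrow> s = 1 \<or> a > 0 \<Longrightarrow> \<mu> \<in> real_spectrum A \<Longrightarrow> (real a * pi / L)\<^sup>2 + \<mu> \<noteq> 0"
    and out: "\<And>t x. norm x \<ge> M \<Longrightarrow> f t x \<bullet> x > 0"
    and index: "odd (\<Sum>\<mu>\<in>neg_spectrum A. eig_mult A \<mu> *
      card (negative_modes s \<sigma> L \<mu>))"
  shows "has_sym_solution f s \<sigma> L"
proof -
  obtain B where B: "orthonormal_eigenbasis A B"
    using symmetric_matrix_orthonormal_eigenbasis[OF sym] by blast
  let ?q = "\<lambda>e. e \<bullet> (A *v e)"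
  have spec: "real_spectrum A = ?q ` B" by (rule real_spectrum_eq_image[OF B sym])
  have finB: "finite B" using B by (simp add: orthonormal_eigenbasis_def)
  obtain c0 a0 where c0: "c0 > 0"
    and large: "\<And>a \<mu>. a \<ge> a0 \<Longrightarrow> \<mu> \<in> real_spectrum A \<Longrightarrow> (real a * pi / L)\<^sup>2 + \<mu> > 0"
    and gap: "\<forall>\<^sub>F N in sequentially. \<forall>a\<in>mode_set s \<sigma> N. \<forall>\<mu>\<in>real_spectrum A.
       \<bar>mode_eig L N a + \<mu>\<bar> \<ge> c0 \<and>
       (mode_eig L N a + \<mu> < 0 \<longleftrightarrow> (real a * pi / L)\<^sup>2 + \<mu> < 0)"
    by (rule uniform_spectral_gap[where S = "real_spectrum A" and \<sigma> = \<sigma> and s = s, OF L _ nonres])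
      (use finB spec in auto)
  obtain \<delta> where \<delta>: "\<delta> > 0" and small: "\<And>t v. norm v \<le> \<delta> \<Longrightarrow> norm (f t v - A *v v) \<le> c0 / 2 * norm v"
  proof -
    have "\<forall>\<^sub>F x in at 0. \<forall>t\<in>UNIV. dist ((f t x - A *v x) /\<^sub>R norm x) 0 < c0 / 2"
      by (rule uniform_limitD[OF lin]) (use c0 in simp)
    then obtain d where d: "d > 0" "\<And>x t. x \<noteq> 0 \<Longrightarrow> norm x < d \<Longrightarrow> norm ((f t x - A *v x) /\<^sub>R norm x) < c0 / 2"
      unfolding eventually_at by (auto simp: dist_norm)
    have "norm (f t v - A *v v) \<le> c0 / 2 * norm v" if "norm v \<le> d / 2" for t v
    proof (cases "v = 0")
      case True
      have "f t 0 = 0" using odd[of t 0] by (intro eq_uminus_self_imp_zero) simp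
      then show ?thesis using True by simp
    next
      case False
      have "norm v < d" using that d(1) by linarith
      from d(2)[OF False this, of t] have "norm (f t v - A *v v) / norm v < c0 / 2"
        by (simp only: norm_scaleR abs_inverse abs_norm_cancel divide_inverse mult.commute)
      moreover have "norm v > 0" using False by simp
      ultimately have "norm (f t v - A *v v) < c0 / 2 * norm v" using pos_divide_less_eq by blast
      then show ?thesis by simp
    qed
    then show thesis using that[of "d / 2"] d(1) by auto
  qed
  obtain C where C: "\<And>t v. norm v \<le> M \<Longrightarrow> norm (f t v) \<le> C"
    using periodic_continuous_bounded[of f L M] cont L per by blast
  have discrete: "\<exists>u. sym_grid s \<sigma> N u \<and> (\<forall>x. grid_laplacian (L / real N) u x = f (of_int x * (L / real N)) (u x)) \<and>
      (\<forall>x. norm (u x) < M) \<and> (\<exists>x. norm (u x) > \<delta>)"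
    if N: "N > 0" "N \<ge> a0" "odd (N + \<sigma>)"
      and gapN: "\<forall>a\<in>mode_set s \<sigma> N. \<forall>\<mu>\<in>real_spectrum A.
       \<bar>mode_eig L N a + \<mu>\<bar> \<ge> c0 \<and>
       (mode_eig L N a + \<mu> < 0 \<longleftrightarrow> (real a * pi / L)\<^sup>2 + \<mu> < 0)" for N
  proof -
    have fin: "finite (mode_set s \<sigma> N)" by (rule finite_subset[of _ "{..<N}"]) (auto simp: mode_set_def)
    define P where "P = {(a, e) \<in> mode_set s \<sigma> N \<times> B. (real a * pi / L)\<^sup>2 + ?q e < 0}"
    have "card P = (\<Sum>e\<in>B. card {a\<in>mode_set s \<sigma> N. (real a * pi / L)\<^sup>2 + ?q e < 0})"
    proof -
      have "P = (\<lambda>(e, a). (a, e)) ` (SIGMA e:B. {a\<in>mode_set s \<sigma> N. (real a * pi / L)\<^sup>2 + ?q e < 0})"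
        by (auto simp: P_def)
      then have "card P = card (SIGMA e:B. {a\<in>mode_set s \<sigma> N. (real a * pi / L)\<^sup>2 + ?q e < 0})"
        by (simp add: card_image inj_on_def)
      also have "\<dots> = (\<Sum>e\<in>B. card {a\<in>mode_set s \<sigma> N. (real a * pi / L)\<^sup>2 + ?q e < 0})"
        using finB fin by (intro card_SigmaI) auto
      finally show ?thesis .
    qed
    also have "\<dots> = (\<Sum>e\<in>B. card (negative_modes s \<sigma> L (?q e)))"
    proof (intro sum.cong refl arg_cong[where f = card] Set.set_eqI)
      fix e a assume e: "e \<in> B"
      have "a < N" if "(real a * pi / L)\<^sup>2 + ?q e < 0"
        using large[of a "?q e"] that e N(2) by (fastforce simp: spec not_less)
      then show "a \<in> {a\<in>mode_set s \<sigma> N. (real a * pi / L)\<^sup>2 + ?q e < 0} \<longleftrightarrow>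
          a \<in> (negative_modes s \<sigma> L (?q e))"
        by (auto simp: mode_set_def negative_modes_def)
    qed
    also have "\<dots> = (\<Sum>e\<in>{e\<in>B. ?q e < 0}. card (negative_modes s \<sigma> L (?q e)))"
    proof (rule sum.mono_neutral_right[OF finB])
      show "\<forall>e\<in>B - {e\<in>B. ?q e < 0}. card (negative_modes s \<sigma> L (?q e)) = 0"
      proof
        fix e assume "e \<in> B - {e\<in>B. ?q e < 0}"
        then have "0 \<le> ?q e" by (auto simp: not_less)
        then have "\<not> (real a * pi / L)\<^sup>2 + ?q e < 0" for a
          using zero_le_power2[of "real a * pi / L"] by linarith
        then show "card (negative_modes s \<sigma> L (?q e)) = 0" by (simp add: negative_modes_def)
      qed
    qed auto
    also have "\<dots> = (\<Sum>\<mu>\<in>neg_spectrum A. eig_mult A \<mu> *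
      card (negative_modes s \<sigma> L \<mu>))"
      by (rule sum_neg_spectrum_mult[OF B sym, symmetric])
    finally have oddP: "odd (card P)" using index by simp
    define I where "I = mode_set s \<sigma> N \<times> B"
    have finI: "finite I" using fin finB by (simp add: I_def)
    have PI: "P \<subseteq> I" by (auto simp: P_def I_def)
    then have "I \<noteq> {}" using oddP by auto
    then obtain n where n: "card I = Suc n" using finI by (metis card_0_eq not0_implies_Suc)
    obtain en where "bij_betw en {0..<card I} I" using ex_bij_betw_nat_finite[OF finI] by blast
    then have en: "bij_betw en {..n} (mode_set s \<sigma> N \<times> B)"
      using n unfolding I_def by (simp only: atLeast0LessThan lessThan_Suc_atMost)
    have h: "L / real N > 0" using L N by simp
    interpret discrete_problem s \<sigma> N n "L / real N" A B en
      by unfold_locales (use s N h sym B en in auto)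
    have eig: "fst (en i) \<in> mode_set s \<sigma> N" "mat_eig i \<in> real_spectrum A" if "i \<le> n" for i
      using en_mem[OF that] by (auto simp: spec mat_eig_def)
    have gap': "\<bar>lap_eig i + mat_eig i\<bar> \<ge> c0" if "i \<le> n" for i
      using gapN eig[OF that] by (simp add: lap_eig_def mode_eig_def)
    have "{i. i \<le> n \<and> lap_eig i + mat_eig i < 0} = {i. i \<le> n \<and> en i \<in> P}"
    proof (intro Collect_cong conj_cong refl)
      fix i assume i: "i \<le> n"
      have "lap_eig i + mat_eig i < 0 \<longleftrightarrow> (real (fst (en i)) * pi / L)\<^sup>2 + mat_eig i < 0"
        using gapN eig[OF i] by (simp add: lap_eig_def mode_eig_def)
      also have "\<dots> \<longleftrightarrow> en i \<in> P"
        using en_mem[OF i] by (auto simp: P_def mat_eig_def dir_def split: prod.splits)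
      finally show "lap_eig i + mat_eig i < 0 \<longleftrightarrow> en i \<in> P" .
    qed
    moreover have "card {i. i \<le> n \<and> en i \<in> P} = card P"
    proof (rule bij_betw_same_card)
      have surj: "en ` {..n} = I" using bij_betw_imp_surj_on[OF en] by (simp only: I_def)
      have "en ` {i. i \<le> n \<and> en i \<in> P} = P"
      proof
        show "P \<subseteq> en ` {i. i \<le> n \<and> en i \<in> P}"
        proof
          fix y assume y: "y \<in> P"
          then have "y \<in> en ` {..n}" using PI surj by blast
          then show "y \<in> en ` {i. i \<le> n \<and> en i \<in> P}" using y by auto
        qed
      qed auto
      moreover have "inj_on en {i. i \<le> n \<and> en i \<in> P}"
        by (rule inj_on_subset[OF bij_betw_imp_inj_on[OF en]]) auto
      ultimately show "bij_betw en {i. i \<le> n \<and> en i \<in> P} P" by (simp only: bij_betw_def)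
    qed
    ultimately have odd_card: "odd (card {i. i \<le> n \<and> lap_eig i + mat_eig i < 0})" using oddP by simp
    have "sym_nonlinearity N (\<lambda>x. f (of_int x * (L / real N)))"
      unfolding sym_nonlinearity_def
    proof (intro conjI allI)
      show "continuous_on UNIV (f (of_int x * (L / real N)))" for x
      proof -
        have "continuous_on UNIV (\<lambda>v::real ^ 'k. (of_int x * (L / real N), v))" by (intro continuous_intros)
        from continuous_on_compose2[OF cont this] show ?thesis by simp
      qed
      show "f (of_int (x + int N) * (L / real N)) v = f (of_int x * (L / real N)) v" for x v
      proof -
        have "of_int (x + int N) * (L / real N) = of_int x * (L / real N) + L"
          using N(1) by (simp add: field_simps)
        then show ?thesis by (simp only: per)
      qed
      show "f (of_int (- x) * (L / real N)) v = f (of_int x * (L / real N)) v" for x v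
        using even[of "of_int x * (L / real N)" v] by simp
    qed (rule odd)
    from discrete_nonzero_solution[OF this gap' c0 \<delta> small out M odd_card] show ?thesis by blast
  qed
  from gap obtain N0 where N0: "\<And>N. N \<ge> N0 \<Longrightarrow> \<forall>a\<in>mode_set s \<sigma> N. \<forall>\<mu>\<in>real_spectrum A.
       \<bar>mode_eig L N a + \<mu>\<bar> \<ge> c0 \<and>
       (mode_eig L N a + \<mu> < 0 \<longleftrightarrow> (real a * pi / L)\<^sup>2 + \<mu> < 0)"
    unfolding eventually_sequentially by blast
  define Ns where "Ns = (\<lambda>k. 2 * (k + N0 + a0) + 1 + \<sigma>)"
  have Ns: "Ns k > 0" "Ns k \<ge> a0" "odd (Ns k + \<sigma>)" "Ns k \<ge> N0" for k by (auto simp: Ns_def)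
  have "\<forall>k. \<exists>u. sym_grid s \<sigma> (Ns k) u \<and> (\<forall>x. grid_laplacian (L / real (Ns k)) u x = f (of_int x * (L / real (Ns k))) (u x)) \<and>
      (\<forall>x. norm (u x) < M) \<and> (\<exists>x. norm (u x) > \<delta>)"
    using discrete[OF Ns(1-3) N0[OF Ns(4)]] by blast
  then obtain u where u: "\<And>k. sym_grid s \<sigma> (Ns k) (u k)"
    "\<And>k x. grid_laplacian (L / real (Ns k)) (u k) x = f (of_int x * (L / real (Ns k))) (u k x)"
    "\<And>k x. norm (u k x) < M" "\<And>k. \<exists>x. norm (u k x) > \<delta>"
    by metis
  have "(\<lambda>k. L / real (Ns k)) \<longlonglongrightarrow> 0"
  proof (rule tendsto_divide_0[OF tendsto_const filterlim_at_top_imp_at_infinity])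
    have "filterlim Ns at_top sequentially"
      by (rule filterlim_at_top_mono[OF filterlim_ident]) (auto simp: Ns_def)
    then show "filterlim (\<lambda>k. real (Ns k)) at_top sequentially"
      by (rule filterlim_compose[OF filterlim_real_sequentially])
  qed
  moreover have "L / real (Ns k) > 0" "L / real (Ns k) * real (Ns k) = L" for k
    using L Ns(1)[of k] by auto
  ultimately show ?thesis
    by (intro discrete_solutions_converge[where h = "\<lambda>k. L / real (Ns k)" and N = Ns and u = u and \<delta> = \<delta> and M = M and C = C,
          OF _ _ L _ u(1,3,2) cont C \<delta> u(4)])
qed

section \<open>Parity of the numbers \<open>\<rho>\<^sub>i\<close>\<close>

lemma card_odd_le: "card {k. odd k \<and> k \<le> (x::nat)} = (x + 1) div 2"
proof -
  have "{k. odd k \<and> k \<le> x} = (\<lambda>i. 2 * i + 1) ` {..<(x + 1) div 2}"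
  proof (intro Set.set_eqI iffI)
    fix k assume "k \<in> {k. odd k \<and> k \<le> x}"
    then obtain i where "k = 2 * i + 1" "k \<le> x" by (auto elim: oddE)
    then show "k \<in> (\<lambda>i. 2 * i + 1) ` {..<(x + 1) div 2}" by auto
  qed auto
  then show ?thesis by (simp add: card_image inj_on_def)
qed

text \<open>
  The reflection \<open>k \<mapsto> P - k\<close> exchanges the lower and the upper half of the residues coprime to \<open>P\<close>; the
  midpoint \<open>P/2\<close> is not coprime to \<open>P\<close> since \<open>P \<ge> 3\<close>. The two halves correspond to the two thresholds \<open>i\<close>
  and \<open>m - i\<close> in the definition of \<open>\<beta>\<^sub>i\<close>.
\<close>

lemma sum_fold_reflection:
  fixes F :: "nat \<Rightarrow> nat"
  assumes "P \<ge> 3"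
  shows "(\<Sum>k | 0 < k \<and> 2 * k < P \<and> coprime k P. F k + F (P - k)) = (\<Sum>k | 0 < k \<and> k < P \<and> coprime k P. F k)"
proof -
  let ?S = "{k. 0 < k \<and> 2 * k < P \<and> coprime k P}" and ?T = "{k. 0 < k \<and> k < P \<and> coprime k P}"
  have fin: "finite ?T" by simp
  have finS: "finite ?S" by (rule finite_subset[OF _ fin]) auto
  have copr: "coprime (P - k) P \<longleftrightarrow> coprime k P" if "k \<le> P" for k
    using that by (metis coprime_diff_one_left_nat coprime_iff_gcd_eq_1 gcd.commute gcd_diff2_nat gcd_diff1_nat diff_diff_cancel diff_le_self)
  have half: "2 * k \<noteq> P" if "coprime k P" for k
  proof
    assume P: "2 * k = P"
    then have "k dvd P" by (metis dvd_triv_right)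
    then have "k dvd 1" using that by (simp add: coprime_absorb_left)
    then show False using P assms by simp
  qed
  have "(\<lambda>k. P - k) ` ?S = ?T - ?S"
  proof (intro Set.set_eqI iffI)
    fix k assume "k \<in> (\<lambda>k. P - k) ` ?S"
    then show "k \<in> ?T - ?S" using copr by auto
  next
    fix k assume k: "k \<in> ?T - ?S"
    then have "P - k \<in> ?S" using copr[of k] half[of k] by auto
    moreover have "k = P - (P - k)" using k by auto
    ultimately show "k \<in> (\<lambda>k. P - k) ` ?S" by blast
  qed
  moreover have "inj_on (\<lambda>k. P - k) ?S" by (auto simp: inj_on_def)
  ultimately have "(\<Sum>k\<in>?S. F (P - k)) = (\<Sum>k\<in>?T - ?S. F k)"
    using sum.reindex[of "\<lambda>k. P - k" ?S F] by (simp add: o_def)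
  moreover have "(\<Sum>k\<in>?T. F k) = (\<Sum>k\<in>?T - ?S. F k) + (\<Sum>k\<in>?S. F k)"
    by (rule sum.subset_diff[OF _ fin]) auto
  ultimately show ?thesis by (simp add: sum.distrib)
qed

lemma gcd_class_eq:
  fixes n P :: nat
  assumes "n > 0"
  shows "{i. 0 < i \<and> 2 * i < n * P \<and> gcd i (n * P) = gcd n (n * P)} = (\<lambda>k. n * k) ` {k. 0 < k \<and> 2 * k < P \<and> coprime k P}"
proof -
  have gn: "gcd n (n * P) = n" by (simp add: gcd_proj1_if_dvd_nat)
  show ?thesis
  proof (intro Set.set_eqI iffI)
    fix i assume "i \<in> {i. 0 < i \<and> 2 * i < n * P \<and> gcd i (n * P) = gcd n (n * P)}"
    then have i: "0 < i" "2 * i < n * P" "gcd i (n * P) = n" by (auto simp: gn)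
    then obtain k where k: "i = n * k" by (metis dvdE gcd_dvd1)
    have "n * gcd k P = n" using i(3) by (simp add: k gcd_mult_distrib_nat)
    then have "coprime k P" using assms by (simp add: coprime_iff_gcd_eq_1)
    moreover have "n * (2 * k) < n * P" using i(2) by (simp add: k mult_ac)
    ultimately show "i \<in> (\<lambda>k. n * k) ` {k. 0 < k \<and> 2 * k < P \<and> coprime k P}" using i(1) k by auto
  next
    fix i assume "i \<in> (\<lambda>k. n * k) ` {k. 0 < k \<and> 2 * k < P \<and> coprime k P}"
    then obtain k where k: "i = n * k" "0 < k" "2 * k < P" "coprime k P" by auto
    have "gcd i (n * P) = n" using k by (simp add: gcd_mult_distrib_nat[symmetric])
    moreover have "n * (2 * k) < n * P" using k assms by (intro mult_strict_left_mono) auto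
    ultimately show "i \<in> {i. 0 < i \<and> 2 * i < n * P \<and> gcd i (n * P) = gcd n (n * P)}"
      using k assms gn by (auto simp: mult_ac)
  qed
qed

lemma alphamu_bmu:
  assumes "m > 0"
  shows "jmu m \<mu> = bmu m \<mu> * m + alphamu m \<mu>" "alphamu m \<mu> < m"
  using assms by (simp_all add: bmu_def alphamu_def minus_div_mult_eq_mod)

lemma rho_gcd_class:
  fixes A :: "real ^ 'k ^ 'k"
  assumes n: "n > 0" and P: "P \<ge> 3" and m: "m = n * P"
  shows "rho m A n = (\<Sum>\<mu>\<in>neg_spectrum A. eig_mult A \<mu> *
    (\<Sum>k | 0 < k \<and> k < P \<and> coprime k P. bmu m \<mu> + (if k \<le> alphamu m \<mu> div n then 1 else 0)))"
proof -
  let ?S = "{k. 0 < k \<and> 2 * k < P \<and> coprime k P}"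
  have mpos: "m > 0" using n P m by simp
  have "2 * n < n * P" using n P by (metis mult.commute mult_less_cancel1 numeral_3_eq_3 Suc_le_eq less_le_trans lessI numeral_2_eq_2)
  then have "0 < n \<and> 2 * n < m" using n m by simp
  then have "rho m A n = (\<Sum>i\<in>{i. 0 < i \<and> 2 * i < m \<and> gcd i m = gcd n m}. eta m A i)"
    unfolding rho_def by (rule if_P)
  also have "{i. 0 < i \<and> 2 * i < m \<and> gcd i m = gcd n m} = (\<lambda>k. n * k) ` ?S"
    unfolding m by (rule gcd_class_eq[OF n])
  finally have "rho m A n = (\<Sum>i\<in>(\<lambda>k. n * k) ` ?S. eta m A i)" .
  also have "\<dots> = (\<Sum>k\<in>?S. eta m A (n * k))"
    using n by (subst sum.reindex) (auto simp: inj_on_def)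
  also have "\<dots> = (\<Sum>k\<in>?S. \<Sum>\<mu>\<in>neg_spectrum A. eig_mult A \<mu> *
     ((bmu m \<mu> + (if k \<le> alphamu m \<mu> div n then 1 else 0)) + (bmu m \<mu> + (if P - k \<le> alphamu m \<mu> div n then 1 else 0))))"
    unfolding eta_def
  proof (intro sum.cong refl)
    fix k \<mu> assume "k \<in> ?S"
    then have k: "0 < k" "2 * k < P" by auto
    have i: "0 < n * k" "2 * (n * k) < m" using k n by (auto simp: m)
    have le: "x \<le> alphamu m \<mu> div n \<longleftrightarrow> n * x \<le> alphamu m \<mu>" for x
      using n by (simp add: less_eq_div_iff_mult_less_eq mult.commute)
    have sub: "m - n * k = n * (P - k)" by (simp add: m diff_mult_distrib2)
    have mono: "n * k \<le> n * (P - k)" using k by (intro mult_left_mono) auto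
    have "n * k \<noteq> ss_idx m" "n * k \<noteq> ss_idx m + 1" "n * k \<noteq> ss_idx m + 2" using i by (auto simp: ss_idx_def)
    then have "beta m A (n * k) \<mu> = (if alphamu m \<mu> < n * k then 2 * bmu m \<mu> * eig_mult A \<mu>
        else if alphamu m \<mu> < n * (P - k) then (2 * bmu m \<mu> + 1) * eig_mult A \<mu>
        else 2 * (bmu m \<mu> + 1) * eig_mult A \<mu>)"
      using i n k unfolding beta_def sub by simp
    also have "\<dots> = eig_mult A \<mu> * ((bmu m \<mu> + (if k \<le> alphamu m \<mu> div n then 1 else 0)) +
        (bmu m \<mu> + (if P - k \<le> alphamu m \<mu> div n then 1 else 0)))"
      unfolding le using mono by (auto simp: algebra_simps)
    finally show "beta m A (n * k) \<mu> = eig_mult A \<mu> * ((bmu m \<mu> + (if k \<le> alphamu m \<mu> div n then 1 else 0)) +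
        (bmu m \<mu> + (if P - k \<le> alphamu m \<mu> div n then 1 else 0)))" .
  qed
  also have "\<dots> = (\<Sum>\<mu>\<in>neg_spectrum A. eig_mult A \<mu> * (\<Sum>k\<in>?S.
     (bmu m \<mu> + (if k \<le> alphamu m \<mu> div n then 1 else 0)) + (bmu m \<mu> + (if P - k \<le> alphamu m \<mu> div n then 1 else 0))))"
    by (subst sum.swap) (simp only: sum_distrib_left)
  also have "\<dots> = (\<Sum>\<mu>\<in>neg_spectrum A. eig_mult A \<mu> *
    (\<Sum>k | 0 < k \<and> k < P \<and> coprime k P. bmu m \<mu> + (if k \<le> alphamu m \<mu> div n then 1 else 0)))"
  proof (rule sum.cong[OF refl])
    fix \<mu>
    show "eig_mult A \<mu> * (\<Sum>k\<in>?S. (bmu m \<mu> + (if k \<le> alphamu m \<mu> div n then 1 else 0)) +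
        (bmu m \<mu> + (if P - k \<le> alphamu m \<mu> div n then 1 else 0))) = eig_mult A \<mu> *
        (\<Sum>k | 0 < k \<and> k < P \<and> coprime k P. bmu m \<mu> + (if k \<le> alphamu m \<mu> div n then 1 else 0))"
      by (subst sum_fold_reflection[OF P, of "\<lambda>k. bmu m \<mu> + (if k \<le> alphamu m \<mu> div n then 1 else 0)"]) (rule refl)
  qed
  finally show ?thesis .
qed

lemma alphamu_div_less:
  assumes "n > 0" "P > 0" "m = n * P"
  shows "alphamu m \<mu> div n < P"
  using alphamu_bmu(2)[of m \<mu>] assms by (simp add: div_less_iff_less_mult mult.commute)

lemma jmu_div:
  assumes "n > 0" "P > 0" "m = n * P"
  shows "jmu m \<mu> div n = bmu m \<mu> * P + alphamu m \<mu> div n"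
proof -
  have "jmu m \<mu> = alphamu m \<mu> + n * (bmu m \<mu> * P)"
    using alphamu_bmu(1)[of m \<mu>] assms by (simp add: mult_ac)
  then show ?thesis using assms(1) by simp
qed

lemma rho_zero:
  fixes A :: "real ^ 'k ^ 'k"
  shows "rho m A 0 = (\<Sum>\<mu>\<in>neg_spectrum A. eig_mult A \<mu> * (jmu m \<mu> div m + 1))"
  by (simp add: rho_def eta_def beta_def bmu_def mult.commute)

lemma rho_ss_idx:
  fixes A :: "real ^ 'k ^ 'k"
  assumes "m > 0"
  shows "rho m A (ss_idx m) = (\<Sum>\<mu>\<in>neg_spectrum A. eig_mult A \<mu> * (jmu m \<mu> div m))"
proof -
  have "ss_idx m \<noteq> 0" "\<not> 2 * ss_idx m < m" unfolding ss_idx_def using assms by linarith+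
  then have "rho m A (ss_idx m) = (\<Sum>\<mu>\<in>neg_spectrum A. bmu m \<mu> * eig_mult A \<mu>)"
    by (simp add: rho_def eta_def beta_def)
  then show ?thesis by (simp add: bmu_def mult.commute)
qed

text \<open>
  The multiples of \<open>n\<close> up to \<open>\<jj>\<^sub>\<mu>\<close> that are not multiples of \<open>m\<close> are counted by the first
  summand, the multiples of \<open>m\<close> by the second one.
\<close>

lemma rho_prime_cofactor:
  fixes A :: "real ^ 'k ^ 'k"
  assumes n: "n > 0" and P: "prime P" "P \<ge> 3" and m: "m = n * P"
  shows "rho m A n + rho m A (ss_idx m) = (\<Sum>\<mu>\<in>neg_spectrum A. eig_mult A \<mu> * (jmu m \<mu> div n))"
proof -
  have mpos: "m > 0" using n P m by simp
  have set: "{k. 0 < k \<and> k < P \<and> coprime k P} = {1..<P}"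
  proof -
    have "coprime k P" if "0 < k" "k < P" for k
    proof -
      have "\<not> P dvd k" using that by (auto dest: dvd_imp_le)
      then show ?thesis using prime_imp_coprime[OF P(1)] coprime_commute by blast
    qed
    then show ?thesis by auto
  qed
  have "rho m A (ss_idx m) = (\<Sum>\<mu>\<in>neg_spectrum A. eig_mult A \<mu> * bmu m \<mu>)"
    by (simp add: rho_ss_idx[OF mpos] bmu_def)
  then have "rho m A n + rho m A (ss_idx m) = (\<Sum>\<mu>\<in>neg_spectrum A. eig_mult A \<mu> *
      ((\<Sum>k\<in>{1..<P}. bmu m \<mu> + (if k \<le> alphamu m \<mu> div n then 1 else 0)) + bmu m \<mu>))"
    unfolding rho_gcd_class[OF n P(2) m, of A] set by (simp only: sum.distrib distrib_left)
  also have "\<dots> = (\<Sum>\<mu>\<in>neg_spectrum A. eig_mult A \<mu> * (jmu m \<mu> div n))"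
  proof (intro sum.cong refl arg_cong2[where f = "(*)"])
    fix \<mu>
    have lt: "alphamu m \<mu> div n < P" using alphamu_div_less[OF n _ m] P by simp
    have "(\<Sum>k\<in>{1..<P}. if k \<le> alphamu m \<mu> div n then 1 else 0) = card ({1..<P} \<inter> {k. k \<le> alphamu m \<mu> div n})"
      by (simp add: sum.If_cases)
    also have "{1..<P} \<inter> {k. k \<le> alphamu m \<mu> div n} = {1..alphamu m \<mu> div n}" using lt by auto
    finally have c: "(\<Sum>k\<in>{1..<P}. if k \<le> alphamu m \<mu> div n then 1 else 0) = alphamu m \<mu> div n" by simp
    have "(P - 1) * bmu m \<mu> + bmu m \<mu> = bmu m \<mu> * P" using P(2) by (cases P) auto
    then show "(\<Sum>k\<in>{1..<P}. bmu m \<mu> + (if k \<le> alphamu m \<mu> div n then 1 else 0)) + bmu m \<mu> = jmu m \<mu> div n"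
      using P(2) by (simp add: sum.distrib c jmu_div[OF n _ m] del: One_nat_def)
  qed
  finally show ?thesis .
qed

text \<open>
  Here the odd multiples of \<open>n\<close> up to \<open>\<jj>\<^sub>\<mu>\<close> are counted.
\<close>

lemma rho_two_power_cofactor:
  fixes A :: "real ^ 'k ^ 'k"
  assumes n: "n > 0" and q: "q \<ge> 2" and m: "m = n * 2 ^ q"
  shows "rho m A n = (\<Sum>\<mu>\<in>neg_spectrum A. eig_mult A \<mu> * ((jmu m \<mu> div n + 1) div 2))"
proof -
  have "(2::nat) ^ 2 \<le> 2 ^ q" using q by (intro power_increasing) auto
  then have P: "(2::nat) ^ q \<ge> 3" by simp
  have set: "{k::nat. 0 < k \<and> k < 2 ^ q \<and> coprime k (2 ^ q)} = {k. odd k \<and> k \<le> 2 ^ q - 1}"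
  proof -
    have c: "coprime k (2 ^ q) \<longleftrightarrow> odd k" for k :: nat
      using q by (simp add: coprime_power_right_iff coprime_right_2_iff_odd)
    have "(0 < k \<and> k < 2 ^ q \<and> odd k) = (odd k \<and> k \<le> 2 ^ q - 1)" for k :: nat
    proof -
      have "k < 2 ^ q \<longleftrightarrow> k \<le> 2 ^ q - 1" using P by linarith
      then show ?thesis using odd_pos[of k] by blast
    qed
    then show ?thesis unfolding c by (rule Collect_cong)
  qed
  have half: "(2::nat) ^ q div 2 = 2 ^ (q - 1)" "(2::nat) ^ q = 2 * 2 ^ (q - 1)"
    using q power_Suc[of "2::nat" "q - 1"] by simp_all
  show ?thesis
    unfolding rho_gcd_class[OF n P m, of A] set
  proof (intro sum.cong refl arg_cong2[where f = "(*)"])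
    fix \<mu>
    have lt: "alphamu m \<mu> div n < 2 ^ q" using alphamu_div_less[OF n _ m] by simp
    have fin: "finite {k. odd k \<and> k \<le> (2::nat) ^ q - 1}"
      by (rule finite_subset[of _ "{..2 ^ q - 1}"]) auto
    have "(\<Sum>k | odd k \<and> k \<le> (2::nat) ^ q - 1. if k \<le> alphamu m \<mu> div n then 1 else 0) =
        card ({k. odd k \<and> k \<le> (2::nat) ^ q - 1} \<inter> {k. k \<le> alphamu m \<mu> div n})"
      using fin by (simp add: sum.If_cases)
    also have "{k. odd k \<and> k \<le> (2::nat) ^ q - 1} \<inter> {k. k \<le> alphamu m \<mu> div n} = {k. odd k \<and> k \<le> alphamu m \<mu> div n}"
      using lt by auto
    finally have c: "(\<Sum>k | odd k \<and> k \<le> (2::nat) ^ q - 1. if k \<le> alphamu m \<mu> div n then 1 else 0) = (alphamu m \<mu> div n + 1) div 2"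
      by (simp only: card_odd_le)
    have "(\<Sum>k | odd k \<and> k \<le> (2::nat) ^ q - 1. bmu m \<mu>) = 2 ^ (q - 1) * bmu m \<mu>"
      using half by (simp add: card_odd_le)
    moreover have "(jmu m \<mu> div n + 1) div 2 = bmu m \<mu> * 2 ^ (q - 1) + (alphamu m \<mu> div n + 1) div 2"
      unfolding jmu_div[OF n _ m, simplified] half(2) by simp
    ultimately show "(\<Sum>k | odd k \<and> k \<le> 2 ^ q - 1. bmu m \<mu> + (if k \<le> alphamu m \<mu> div n then 1 else 0)) = (jmu m \<mu> div n + 1) div 2"
      by (simp only: sum.distrib c) simp
  qed
qed

lemma rho_half:
  fixes A :: "real ^ 'k ^ 'k"
  assumes m: "m = 2 * n" and n: "n > 0" and i: "i = ss_idx m + 1 \<or> i = ss_idx m + 2"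
  shows "rho m A i = (\<Sum>\<mu>\<in>neg_spectrum A. eig_mult A \<mu> * ((jmu m \<mu> div n + 1) div 2))"
proof -
  have "even m" "m div 2 = n" using m by simp_all
  have "i \<noteq> 0" "i \<noteq> ss_idx m" "\<not> 2 * i < m" using i m by (auto simp: ss_idx_def)
  then have "rho m A i = (\<Sum>\<mu>\<in>neg_spectrum A. if alphamu m \<mu> < n then bmu m \<mu> * eig_mult A \<mu> else (bmu m \<mu> + 1) * eig_mult A \<mu>)"
    using i \<open>even m\<close> \<open>m div 2 = n\<close> by (simp add: rho_def eta_def beta_def)
  also have "\<dots> = (\<Sum>\<mu>\<in>neg_spectrum A. eig_mult A \<mu> * ((jmu m \<mu> div n + 1) div 2))"
  proof (intro sum.cong refl)
    fix \<mu>
    have m': "m = n * 2" using m by simp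
    have "alphamu m \<mu> div n < 2" by (rule alphamu_div_less[OF n _ m']) simp
    moreover have "alphamu m \<mu> < n \<longleftrightarrow> alphamu m \<mu> div n = 0" using n by (simp add: div_eq_0_iff)
    ultimately show "(if alphamu m \<mu> < n then bmu m \<mu> * eig_mult A \<mu> else (bmu m \<mu> + 1) * eig_mult A \<mu>) =
        eig_mult A \<mu> * ((jmu m \<mu> div n + 1) div 2)"
      unfolding jmu_div[OF n _ m', simplified] by (cases "alphamu m \<mu> div n = 0") (auto simp: less_2_cases_iff)
  qed
  finally show ?thesis .
qed

lemma square_below_iff_le_jmu:
  fixes \<mu> :: real
  assumes m: "m > 0" and \<mu>: "\<mu> < 0" and nonres: "\<And>j::nat. (real j)\<^sup>2 / (real m)\<^sup>2 + \<mu> \<noteq> 0"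
  shows "(real J / real m)\<^sup>2 + \<mu> < 0 \<longleftrightarrow> J \<le> jmu m \<mu>"
proof -
  define x where "x = real m * sqrt (- \<mu>)"
  have x: "x > 0" using m \<mu> by (simp add: x_def)
  have x2: "x\<^sup>2 = (real m)\<^sup>2 * (- \<mu>)" using \<mu> by (simp add: x_def power_mult_distrib)
  have m2: "(real m)\<^sup>2 > 0" using m by simp
  have lt: "\<mu> < - (y\<^sup>2 / (real m)\<^sup>2) \<longleftrightarrow> y < x" if "y \<ge> 0" for y
  proof -
    have "\<mu> < - (y\<^sup>2 / (real m)\<^sup>2) \<longleftrightarrow> y\<^sup>2 / (real m)\<^sup>2 < - \<mu>" by linarith
    also have "\<dots> \<longleftrightarrow> y\<^sup>2 < x\<^sup>2" unfolding x2 pos_divide_less_eq[OF m2] by (simp add: mult.commute)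
    also have "\<dots> \<longleftrightarrow> y < x" using x that by (auto intro: power2_less_imp_less power_strict_mono)
    finally show ?thesis .
  qed
  have gt: "- (y\<^sup>2 / (real m)\<^sup>2) < \<mu> \<longleftrightarrow> x < y" if "y \<ge> 0" for y
  proof -
    have "- (y\<^sup>2 / (real m)\<^sup>2) < \<mu> \<longleftrightarrow> - \<mu> < y\<^sup>2 / (real m)\<^sup>2" by linarith
    also have "\<dots> \<longleftrightarrow> x\<^sup>2 < y\<^sup>2" unfolding x2 pos_less_divide_eq[OF m2] by (simp add: mult.commute)
    also have "\<dots> \<longleftrightarrow> x < y" using x that by (auto intro: power2_less_imp_less power_strict_mono)
    finally show ?thesis .
  qed
  have noninteger: "real j \<noteq> x" for j :: nat
  proof
    assume "real j = x"
    then have "\<not> \<mu> < - ((real j)\<^sup>2 / (real m)\<^sup>2)" "\<not> - ((real j)\<^sup>2 / (real m)\<^sup>2) < \<mu>"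
      using lt[of "real j"] gt[of "real j"] by auto
    then show False using nonres[of j] by linarith
  qed
  define j0 where "j0 = nat \<lfloor>x\<rfloor>"
  have "real j0 \<le> x" "x < real j0 + 1" using x by (auto simp: j0_def)
  then have j0: "real j0 < x" "x < real j0 + 1" using noninteger[of j0] by auto
  have "jmu m \<mu> = j0"
    unfolding jmu_def
  proof (rule the_equality)
    show "- ((real j0 + 1)\<^sup>2 / (real m)\<^sup>2) < \<mu> \<and> \<mu> < - ((real j0)\<^sup>2 / (real m)\<^sup>2)"
      using lt[of "real j0"] gt[of "real j0 + 1"] j0 by simp
  next
    fix j assume "- ((real j + 1)\<^sup>2 / (real m)\<^sup>2) < \<mu> \<and> \<mu> < - ((real j)\<^sup>2 / (real m)\<^sup>2)"
    then have "real j < x" "x < real j + 1" using lt[of "real j"] gt[of "real j + 1"] by simp_all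
    then have "real j < real j0 + 1" "real j0 < real j + 1" using j0 by linarith+
    then show "j = j0" by linarith
  qed
  moreover have "(real J / real m)\<^sup>2 + \<mu> < 0 \<longleftrightarrow> real J < x"
    using lt[of "real J"] by (auto simp: power_divide)
  moreover have "real J < x \<longleftrightarrow> J \<le> j0" using j0 by linarith
  ultimately show ?thesis by simp
qed

section \<open>Isotropy groups\<close>

lemma carrier_symgroup: "carrier (symgroup m) = ({0..<int m} \<times> UNIV) \<times> {-1, 1}"
  by (simp add: symgroup_def dihedral_def sign_img_def)

lemma mult_symgroup:
  "((i, a), x) \<otimes>\<^bsub>symgroup m\<^esub> ((j, b), y) = (((if a then i - j else i + j) mod int m, a \<noteq> b), x * y)"
  by (simp add: symgroup_def dihedral_def sign_img_def)

lemma one_symgroup: "\<one>\<^bsub>symgroup m\<^esub> = ((0, False), 1)"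
  by (simp add: symgroup_def dihedral_def sign_img_def)

lemma group_symgroup: "m > 0 \<Longrightarrow> group (symgroup m)"
  unfolding symgroup_def by (intro DirProd_group group_dihedral sign_img_is_group)

lemma rot_pow: "m > 1 \<Longrightarrow> rot [^]\<^bsub>dihedral m\<^esub> (d::nat) = (int d mod int m, False)"
proof (induction d)
  case 0
  then show ?case by (simp add: nat_pow_def dihedral_def)
next
  case (Suc d)
  then show ?case by (simp add: nat_pow_def dihedral_def rot_def mod_simps add.commute)
qed

lemma C2_periodic_mod:
  assumes "u \<in> C2_periodic m"
  shows "u (t + 2 * pi * of_int (x mod int m)) = u (t + 2 * pi * of_int x)"
proof -
  have per: "u (t + of_int k * (2 * pi * real m)) = u t" for t k
    using periodic_int[of u] assms by (simp add: C2_periodic_def)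
  have e: "real_of_int x = of_int (x mod int m) + real m * of_int (x div int m)"
    by (metis mod_mult_div_eq of_int_add of_int_mult of_int_of_nat_eq)
  show ?thesis
    using per[of "t + 2 * pi * of_int (x mod int m)" "x div int m"] by (simp add: e algebra_simps)
qed

lemma stabilizer_subgroup_symgroup:
  assumes m: "m > 0" and u: "u \<in> C2_periodic m"
  shows "subgroup (stabilizer (symgroup m) sym_act u) (symgroup m)"
proof -
  interpret group "symgroup m" by (rule group_symgroup[OF m])
  have one: "sym_act \<one>\<^bsub>symgroup m\<^esub> u = u" by (simp add: one_symgroup sym_act_def)
  show ?thesis
  proof (rule subgroupI)
    show "stabilizer (symgroup m) sym_act u \<subseteq> carrier (symgroup m)" by (auto simp: stabilizer_def)
    show "stabilizer (symgroup m) sym_act u \<noteq> {}"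
      using one one_closed unfolding stabilizer_def by blast
    fix g assume g: "g \<in> stabilizer (symgroup m) sym_act u"
    then have gc: "g \<in> carrier (symgroup m)" and gu: "sym_act g u = u" by (auto simp: stabilizer_def)
    have "sym_act (inv\<^bsub>symgroup m\<^esub> g) u = sym_act (inv\<^bsub>symgroup m\<^esub> g) (sym_act g u)" by (simp add: gu)
    also have "\<dots> = u" using sym_act_mult[OF u inv_closed[OF gc] gc] gc one by simp
    finally show "inv\<^bsub>symgroup m\<^esub> g \<in> stabilizer (symgroup m) sym_act u" using gc by (simp add: stabilizer_def)
    fix h assume h: "h \<in> stabilizer (symgroup m) sym_act u"
    then show "g \<otimes>\<^bsub>symgroup m\<^esub> h \<in> stabilizer (symgroup m) sym_act u"
      using gc gu sym_act_mult[OF u gc, of h] by (auto simp: stabilizer_def)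
  qed
qed

lemma mem_stabilizer_rotation:
  fixes u :: "real \<Rightarrow> real ^ 'k"
  assumes "x = 1 \<or> x = (-1::int)"
  shows "((j, False), x) \<in> stabilizer (symgroup m) sym_act u \<longleftrightarrow>
    j \<in> {0..<int m} \<and> (\<forall>t. u (t + 2 * pi * of_int j) = of_int x *\<^sub>R u t)"
proof -
  have "of_int x *\<^sub>R v = w \<longleftrightarrow> v = of_int x *\<^sub>R w" for v w :: "real ^ 'k" using assms by auto
  then show ?thesis using assms by (auto simp: stabilizer_def carrier_symgroup sym_act_def fun_eq_iff)
qed

lemma mem_stabilizer_reflection:
  fixes u :: "real \<Rightarrow> real ^ 'k"
  assumes "x = 1 \<or> x = (-1::int)"
  shows "((j, True), x) \<in> stabilizer (symgroup m) sym_act u \<longleftrightarrow>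
    j \<in> {0..<int m} \<and> (\<forall>t. u (- (t + 2 * pi * of_int j)) = of_int x *\<^sub>R u t)"
proof -
  have "of_int x *\<^sub>R v = w \<longleftrightarrow> v = of_int x *\<^sub>R w" for v w :: "real ^ 'k" using assms by auto
  then show ?thesis using assms by (auto simp: stabilizer_def carrier_symgroup sym_act_def fun_eq_iff)
qed

lemma shift_power:
  fixes u :: "real \<Rightarrow> real ^ 'k"
  assumes "\<And>t. u (t + c) = r *\<^sub>R u t"
  shows "u (t + real k * c) = r ^ k *\<^sub>R u t"
proof (induction k)
  case (Suc k)
  have "u (t + real (Suc k) * c) = u ((t + real k * c) + c)" by (simp add: algebra_simps)
  then show ?case using Suc by (simp add: assms)
qed simp

text \<open>
  Multiplying a reflection in the isotropy group by the given one yields a rotation, so only rotations have to be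
  considered. Their exponents are multiples of \<open>d\<close> by assumption, and their signs are determined because \<open>u \<noteq> 0\<close>.
\<close>

lemma stabilizer_eq_generate:
  fixes u :: "real \<Rightarrow> real ^ 'k" and r x c :: int
  assumes m: "m > 1" and d: "d > 0" and u: "u \<in> C2_periodic m" and nz: "u t0 \<noteq> 0"
    and r: "r = 1 \<or> r = -1" and x: "x = 1 \<or> x = -1" and c: "c \<in> {0..<int m}"
    and rot: "\<And>t. u (t + 2 * pi * real d) = of_int r *\<^sub>R u t"
    and refl: "\<And>t. u (- (t + 2 * pi * of_int c)) = of_int x *\<^sub>R u t"
    and only: "\<And>j y. y = 1 \<or> y = (-1::int) \<Longrightarrow> (\<And>t. u (t + 2 * pi * of_int j) = of_int y *\<^sub>R u t) \<Longrightarrow> int d dvd j"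
  shows "stabilizer (symgroup m) sym_act u =
    generate (symgroup m) {(rot [^]\<^bsub>dihedral m\<^esub> d, r), ((c, True), x)}" (is "?S = generate ?G ?K")
proof
  have m0: "m > 0" using m by simp
  interpret group ?G by (rule group_symgroup[OF m0])
  have S: "subgroup ?S ?G" by (rule stabilizer_subgroup_symgroup[OF m0 u])
  have gen: "?K \<subseteq> ?S"
  proof -
    have "u (t + 2 * pi * of_int (int d mod int m)) = of_int r *\<^sub>R u t" for t
      using C2_periodic_mod[OF u, of t "int d"] rot by simp
    moreover have "int d mod int m \<in> {0..<int m}" using m0 by simp
    ultimately have "(rot [^]\<^bsub>dihedral m\<^esub> d, r) \<in> ?S"
      unfolding rot_pow[OF m] by (subst mem_stabilizer_rotation[OF r]) blast
    moreover have "((c, True), x) \<in> ?S"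
      using c refl by (subst mem_stabilizer_reflection[OF x]) blast
    ultimately show ?thesis by simp
  qed
  then show "generate ?G ?K \<subseteq> ?S" by (rule generate_subgroup_incl[OF _ S])
  have pow: "((int d * int k mod int m, False), r ^ k) \<in> generate ?G ?K" for k
  proof (induction k)
    case 0
    show ?case using generate.one[of ?G ?K] by (simp add: one_symgroup)
  next
    case (Suc k)
    have "(rot [^]\<^bsub>dihedral m\<^esub> d, r) \<in> generate ?G ?K" by (rule generate.incl) simp
    from generate.eng[OF this Suc] show ?case
      unfolding rot_pow[OF m] mult_symgroup by (simp add: mod_simps algebra_simps)
  qed
  have rotS: "((j, False), y) \<in> generate ?G ?K" if g: "((j, False), y) \<in> ?S" for j y
  proof -
    have y: "y = 1 \<or> y = -1" using g by (auto simp: stabilizer_def carrier_symgroup)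
    have j: "j \<in> {0..<int m}" and jy: "\<And>t. u (t + 2 * pi * of_int j) = of_int y *\<^sub>R u t"
      using g unfolding mem_stabilizer_rotation[OF y] by auto
    obtain k where k: "j = int d * k" using only[OF y jy] by (auto elim: dvdE)
    have "k \<ge> 0" using j d k by (simp add: zero_le_mult_iff)
    then have k': "j = int d * int (nat k)" using k by simp
    have "of_int y *\<^sub>R u t0 = u (t0 + 2 * pi * of_int j)" by (simp add: jy)
    also have "\<dots> = u (t0 + real (nat k) * (2 * pi * real d))" by (simp add: k' mult_ac)
    also have "\<dots> = of_int r ^ nat k *\<^sub>R u t0" by (rule shift_power) (rule rot)
    finally have "real_of_int y = of_int (r ^ nat k)" using nz by simp
    then have "y = r ^ nat k" by (simp only: of_int_eq_iff)
    moreover have "j mod int m = j" using j by simp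
    ultimately show ?thesis using pow[of "nat k"] k' by metis
  qed
  show "?S \<subseteq> generate ?G ?K"
  proof
    fix g assume g: "g \<in> ?S"
    obtain j e y where gj: "g = ((j, e), y)" by (metis surj_pair)
    show "g \<in> generate ?G ?K"
    proof (cases e)
      case False
      then show ?thesis using rotS g gj by simp
    next
      case True
      have y: "y = 1 \<or> y = -1" and j: "j \<in> {0..<int m}"
        using g gj by (auto simp: stabilizer_def carrier_symgroup)
      have refl_gen: "((c, True), x) \<in> generate ?G ?K" by (rule generate.incl) simp
      have "g \<otimes>\<^bsub>?G\<^esub> ((c, True), x) \<in> ?S"
        using subgroup.m_closed[OF S g] gen by simp
      then have "(((j - c) mod int m, False), y * x) \<in> ?S" by (simp add: gj True mult_symgroup)
      then have "(((j - c) mod int m, False), y * x) \<in> generate ?G ?K" by (rule rotS)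
      from generate.eng[OF this refl_gen]
      have "((((j - c) mod int m + c) mod int m, True), y * x * x) \<in> generate ?G ?K"
        by (simp add: mult_symgroup)
      moreover have "((j - c) mod int m + c) mod int m = j" using j by (simp add: mod_simps)
      moreover have "y * x * x = y" using x by auto
      ultimately show ?thesis by (simp add: gj True)
    qed
  qed
qed

lemma admits_orbit_stabilizer:
  assumes m: "m > 0" and u: "u \<in> C2_periodic m" "is_solution f u"
  shows "admits_orbit m f (stabilizer (symgroup m) sym_act u)"
proof -
  interpret group "symgroup m" by (rule group_symgroup[OF m])
  let ?S = "stabilizer (symgroup m) sym_act u"
  have "\<one>\<^bsub>symgroup m\<^esub> \<otimes>\<^bsub>symgroup m\<^esub> h \<otimes>\<^bsub>symgroup m\<^esub> inv\<^bsub>symgroup m\<^esub> \<one>\<^bsub>symgroup m\<^esub> = h" if "h \<in> ?S" for h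
    using that by (simp add: stabilizer_def)
  then have "conjugate_in (symgroup m) ?S ?S"
    unfolding conjugate_in_def by (intro bexI[of _ "\<one>\<^bsub>symgroup m\<^esub>"]) (auto simp: image_iff)
  then show ?thesis using u unfolding admits_orbit_def by blast
qed

text \<open>
  The exponents \<open>j\<close> with this property form a subgroup of the integers, which makes
  greatest common divisors available.
\<close>

definition shift_sym :: "(real \<Rightarrow> real ^ 'k) \<Rightarrow> int \<Rightarrow> bool" where
  "shift_sym u j \<longleftrightarrow> (\<exists>y\<in>{1, -1::real}. \<forall>t. u (t + 2 * pi * of_int j) = y *\<^sub>R u t)"

lemma shift_sym_add:
  assumes "shift_sym u i" "shift_sym u j"
  shows "shift_sym u (i + j)"
proof -
  obtain x y where x: "x \<in> {1, -1::real}" "\<And>t. u (t + 2 * pi * of_int i) = x *\<^sub>R u t"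
    and y: "y \<in> {1, -1::real}" "\<And>t. u (t + 2 * pi * of_int j) = y *\<^sub>R u t"
    using assms by (auto simp only: shift_sym_def)
  have "u (t + 2 * pi * of_int (i + j)) = (y * x) *\<^sub>R u t" for t
    using x(2)[of t] y(2)[of "t + 2 * pi * of_int i"] by (simp add: algebra_simps)
  moreover have "y * x \<in> {1, -1}" using x(1) y(1) by auto
  ultimately show ?thesis unfolding shift_sym_def by blast
qed

lemma shift_sym_minus:
  assumes "shift_sym u j"
  shows "shift_sym u (- j)"
proof -
  obtain y where y: "y \<in> {1, -1::real}" "\<And>t. u (t + 2 * pi * of_int j) = y *\<^sub>R u t"
    using assms by (auto simp only: shift_sym_def)
  have "u (t + 2 * pi * of_int (- j)) = y *\<^sub>R u t" for t
    using y(1) y(2)[of "t + 2 * pi * of_int (- j)"] by auto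
  then show ?thesis using y(1) unfolding shift_sym_def by blast
qed

lemma shift_sym_mult:
  assumes "shift_sym u j"
  shows "shift_sym u (k * j)"
proof -
  have nat: "shift_sym u (int n * j)" for n
  proof (induction n)
    case 0
    show ?case by (auto simp: shift_sym_def)
  next
    case (Suc n)
    then show ?case using shift_sym_add[OF Suc assms] by (simp add: algebra_simps)
  qed
  show ?thesis
  proof (cases "k \<ge> 0")
    case True
    then show ?thesis using nat[of "nat k"] by simp
  next
    case False
    then show ?thesis using shift_sym_minus[OF nat[of "nat (- k)"]] by simp
  qed
qed

lemma shift_sym_gcd:
  assumes "shift_sym u i" "shift_sym u j"
  shows "shift_sym u (gcd i j)"
proof -
  obtain a b where "a * i + b * j = gcd i j" using bezout_int by blast
  then show ?thesis using shift_sym_add[OF shift_sym_mult[OF assms(1), of a] shift_sym_mult[OF assms(2), of b]] by simp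
qed

text \<open>
  Otherwise \<open>u\<close> would be invariant up to sign under a proper divisor of the shift \<open>2\<^sup>i\<close>; the quotient is even, so
  \<open>u\<close> would be invariant, and not antiperiodic, under the shift \<open>2\<^sup>i\<close> itself.
\<close>

lemma antiperiodic_two_power_shift_sym:
  fixes u :: "real \<Rightarrow> real ^ 'k"
  assumes anti: "\<And>t. u (t + 2 * pi * real (2 ^ i)) = - u t" and nz: "u t0 \<noteq> 0" and j: "shift_sym u j"
  shows "int (2 ^ i) dvd j"
proof (rule ccontr)
  assume nd: "\<not> int (2 ^ i) dvd j"
  define g where "g = gcd j (int (2 ^ i))"
  have "shift_sym u (int (2 ^ i))"
    unfolding shift_sym_def using anti by (intro bexI[of _ "-1"]) auto
  then have "shift_sym u g" unfolding g_def by (rule shift_sym_gcd[OF j])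
  then obtain y where y: "y \<in> {1, -1::real}" "\<And>t. u (t + 2 * pi * of_int g) = y *\<^sub>R u t"
    by (auto simp only: shift_sym_def)
  have gpos: "g > 0" by (simp add: g_def)
  have "nat g dvd 2 ^ i" using gpos by (simp add: g_def nat_dvd_iff flip: of_nat_power)
  then obtain l where l: "l \<le> i" "nat g = 2 ^ l" using divides_primepow_nat[OF two_is_prime_nat] by blast
  then have gl: "g = int (2 ^ l)" using gpos by (metis nat_eq_iff2 less_imp_le nat_0_le of_nat_eq_iff)
  have "l \<noteq> i" using nd gl by (metis g_def gcd_dvd1)
  then have e: "even ((2::nat) ^ (i - l))" using l(1) by simp
  have "real (2 ^ (i - l)) * (2 * pi * of_int g) = 2 * pi * real (2 ^ i)"
    using l(1) by (simp add: gl power_add[symmetric])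
  then have "u (t0 + 2 * pi * real (2 ^ i)) = y ^ (2 ^ (i - l)) *\<^sub>R u t0"
    using shift_power[where u = u, OF y(2), of t0 "2 ^ (i - l)"] by metis
  moreover have "y ^ (2 ^ (i - l)) = 1" using y(1) e by auto
  ultimately have "u t0 = - u t0" using anti by simp
  then show False using nz eq_uminus_self_imp_zero by blast
qed

section \<open>Orbits of periodic solutions\<close>

locale forced_system =
  fixes m :: nat and M :: real and f :: "real \<Rightarrow> real ^ 'k \<Rightarrow> real ^ 'k" and A :: "real ^ 'k ^ 'k"
  assumes m: "m \<ge> 3" and M: "M > 0"
    and cont: "continuous_on UNIV (\<lambda>(t, x). f t x)"
    and per: "\<And>t x. f (t + 2 * pi) x = f t x"
    and even_time: "\<And>t x. f (- t) x = f t x"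
    and odd_space: "\<And>t x. f t (- x) = - f t x"
    and sym: "transpose A = A"
    and lin: "uniform_limit UNIV (\<lambda>x t. (f t x - A *v x) /\<^sub>R norm x) (\<lambda>t. 0) (at 0)"
    and nonres: "\<And>(j::nat) \<mu>. \<mu> \<in> real_spectrum A \<Longrightarrow> (real j)\<^sup>2 / (real m)\<^sup>2 + \<mu> \<noteq> 0"
    and out: "\<And>t x. norm x \<ge> M \<Longrightarrow> f t x \<bullet> x > 0"
begin

text \<open>
  Both \<open>0\<close> and \<open>\<pi>\<close> are centres of symmetry of \<open>f\<close> in time. A solution that is even about \<open>-\<pi>\<close>, as the twisted dihedral
  group requires, becomes even about \<open>0\<close> for the shifted equation.
\<close>

lemma forced_system_shift: "forced_system m M (\<lambda>t. f (t - pi)) A"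
proof unfold_locales
  show "continuous_on UNIV (\<lambda>(t, x). f (t - pi) x)"
  proof -
    have "continuous_on UNIV (\<lambda>p::real \<times> (real ^ 'k). (fst p - pi, snd p))" by (intro continuous_intros)
    from continuous_on_compose2[OF cont this] show ?thesis by (simp add: case_prod_unfold)
  qed
  show "f (t + 2 * pi - pi) x = f (t - pi) x" for t x
    using per[of "t - pi" x] by (simp add: algebra_simps)
  show "f (- t - pi) x = f (t - pi) x" for t x
  proof -
    have "f (- t - pi) x = f (- (t + pi)) x" by simp
    also have "\<dots> = f (t + pi) x" by (rule even_time)
    also have "t + pi = t - pi + 2 * pi" by simp
    finally show ?thesis unfolding per .
  qed
  show "uniform_limit UNIV (\<lambda>x t. (f (t - pi) x - A *v x) /\<^sub>R norm x) (\<lambda>t. 0) (at 0)"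
    unfolding uniform_limit_iff
  proof (intro allI impI)
    fix e :: real assume "e > 0"
    from uniform_limitD[OF lin this]
    show "\<forall>\<^sub>F x in at 0. \<forall>t\<in>UNIV. dist ((f (t - pi) x - A *v x) /\<^sub>R norm x) 0 < e"
      by eventually_elim blast
  qed
qed (fact m M odd_space sym nonres out)+

text \<open>
  With \<open>L = 2\<pi>d\<close> the frequencies are \<open>J/m\<close>, where \<open>J\<close> runs through the multiples of \<open>n\<close> in the periodic case
  \<open>\<sigma> = 0\<close>, without \<open>J = 0\<close> for odd functions, and through the odd multiples in the antiperiodic case \<open>\<sigma> = 1\<close>.
\<close>

lemma symmetric_solution_exists:
  assumes s: "s = 1 \<or> s = (-1::real)" and d: "d > 0" and n: "n > 0"
    and \<sigma>: "\<sigma> = 0 \<and> m = n * d \<or> \<sigma> = 1 \<and> m = n * (2 * d)"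
    and index: "odd (\<Sum>\<mu>\<in>neg_spectrum A. eig_mult A \<mu> *
      (if \<sigma> = 0 then jmu m \<mu> div n + (if s = 1 then 1 else 0) else (jmu m \<mu> div n + 1) div 2))"
  shows "has_sym_solution f s \<sigma> (2 * pi * real d)"
proof -
  define L where "L = 2 * pi * real d"
  have L: "L > 0" using d by (simp add: L_def)
  have m0: "m > 0" using m by simp
  define J where "J = (\<lambda>a. if \<sigma> = 0 then (a div 2) * n else a * n)"
  have freq: "real a * pi / L = real (J a) / real m" if "even (a + \<sigma>)" for a
    using \<sigma>
  proof (elim disjE conjE)
    assume "\<sigma> = 0" "m = n * d"
    moreover have "real a = 2 * real (a div 2)" using that \<open>\<sigma> = 0\<close> by (metis add.right_neutral dvd_mult_div_cancel of_nat_mult of_nat_numeral)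
    ultimately show ?thesis using d n by (simp add: L_def J_def)
  next
    assume "\<sigma> = 1" "m = n * (2 * d)"
    then show ?thesis using d n by (simp add: L_def J_def)
  qed
  have nonres': "(real a * pi / L)\<^sup>2 + \<mu> \<noteq> 0" if "even (a + \<sigma>)" "\<mu> \<in> real_spectrum A" for a \<mu>
    using nonres[OF that(2), of "J a"] by (simp add: freq[OF that(1)] power_divide)
  have perL: "f (t + L) x = f t x" for t x
    using periodic_int[of "\<lambda>t. f t x" "2 * pi" t "int d"] per by (simp add: L_def mult_ac)
  have count: "card (negative_modes s \<sigma> L \<mu>) =
      (if \<sigma> = 0 then jmu m \<mu> div n + (if s = 1 then 1 else 0) else (jmu m \<mu> div n + 1) div 2)"
    if \<mu>: "\<mu> \<in> neg_spectrum A" for \<mu>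
  proof -
    have neg: "\<mu> < 0" "\<mu> \<in> real_spectrum A" using \<mu> by (auto simp: neg_spectrum_def)
    have iff: "(real a * pi / L)\<^sup>2 + \<mu> < 0 \<longleftrightarrow> J a \<le> jmu m \<mu>" if "even (a + \<sigma>)" for a
      unfolding freq[OF that] by (rule square_below_iff_le_jmu[OF m0 neg(1) nonres[OF neg(2)]])
    have le: "b * n \<le> jmu m \<mu> \<longleftrightarrow> b \<le> jmu m \<mu> div n" for b
      using n by (simp add: less_eq_div_iff_mult_less_eq)
    have set: "(negative_modes s \<sigma> L \<mu>) =
        {a. even (a + \<sigma>) \<and> (s = 1 \<or> a > 0) \<and> J a \<le> jmu m \<mu>}"
      using iff unfolding negative_modes_def by blast
    show ?thesis
    proof (cases "\<sigma> = 0")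
      case True
      define X where "X = (if s = 1 then {..jmu m \<mu> div n} else {1..jmu m \<mu> div n})"
      have X: "b \<in> X \<longleftrightarrow> (s = 1 \<or> b > 0) \<and> b \<le> jmu m \<mu> div n" for b
        by (auto simp: X_def)
      have J2: "J (2 * b) \<le> jmu m \<mu> \<longleftrightarrow> b \<le> jmu m \<mu> div n" for b
        using True le by (simp add: J_def)
      have "{a. even (a + \<sigma>) \<and> (s = 1 \<or> a > 0) \<and> J a \<le> jmu m \<mu>} = (\<lambda>b. 2 * b) ` X"
      proof (intro Set.set_eqI iffI)
        fix a assume a: "a \<in> {a. even (a + \<sigma>) \<and> (s = 1 \<or> a > 0) \<and> J a \<le> jmu m \<mu>}"
        then obtain b where b: "a = 2 * b" using True by (auto elim: evenE)
        then have "b \<in> X" using a unfolding X b by (simp add: J2)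
        then show "a \<in> (\<lambda>b. 2 * b) ` X" using b by blast
      next
        fix a assume "a \<in> (\<lambda>b. 2 * b) ` X"
        then obtain b where b: "a = 2 * b" "b \<in> X" by blast
        then show "a \<in> {a. even (a + \<sigma>) \<and> (s = 1 \<or> a > 0) \<and> J a \<le> jmu m \<mu>}"
          using True by (simp add: X J2)
      qed
      moreover have "card ((\<lambda>b. 2 * b) ` X) = card X" by (rule card_image) (simp add: inj_on_def)
      moreover have "card X = jmu m \<mu> div n + (if s = 1 then 1 else 0)" by (simp add: X_def)
      ultimately show ?thesis unfolding set using True by simp
    next
      case False
      then have "\<sigma> = 1" using \<sigma> by simp
      then have "{a. even (a + \<sigma>) \<and> (s = 1 \<or> a > 0) \<and> J a \<le> jmu m \<mu>} = {a. odd a \<and> a \<le> jmu m \<mu> div n}"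
        using le by (auto simp: J_def odd_pos)
      then show ?thesis unfolding set using \<open>\<sigma> = 1\<close> by (simp add: card_odd_le)
    qed
  qed
  have "odd (\<Sum>\<mu>\<in>neg_spectrum A. eig_mult A \<mu> *
      card (negative_modes s \<sigma> L \<mu>))"
    using index count by (simp cong: sum.cong)
  from nonzero_symmetric_solution[OF s L M cont perL even_time odd_space sym lin nonres' out this]
  show ?thesis by (simp add: L_def)
qed

lemma admits_orbit_generated:
  fixes r x c :: int and w v :: "real \<Rightarrow> real ^ 'k"
  assumes w: "\<And>t. (w has_vector_derivative v t) (at t)" and v: "\<And>t. (v has_vector_derivative f t (w t)) (at t)"
    and d: "d > 0" "d dvd m" and r: "r = 1 \<or> r = -1 \<and> even (m div d)" and x: "x = 1 \<or> x = -1" and c: "c \<in> {0, 1}"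
    and rot: "\<And>t. w (t + 2 * pi * real d) = of_int r *\<^sub>R w t"
    and refl: "\<And>t. w (- (t + 2 * pi * of_int c)) = of_int x *\<^sub>R w t" and nz: "w b \<noteq> 0"
    and only: "\<And>j. shift_sym w j \<Longrightarrow> int d dvd j"
  shows "admits_orbit m f (generate (symgroup m) {(rot [^]\<^bsub>dihedral m\<^esub> d, r), ((c, True), x)})"
proof -
  have m1: "m > 1" "m > 0" using m by simp_all
  have "w (t + 2 * pi * real m) = w t" for t
  proof -
    have "w (t + real (m div d) * (2 * pi * real d)) = of_int r ^ (m div d) *\<^sub>R w t"
      by (rule shift_power) (rule rot)
    moreover have "of_int r ^ (m div d) = (1::real)" using r by auto
    moreover have "real (m div d) * (2 * pi * real d) = 2 * pi * real m"
      using d by (auto simp: real_of_nat_div)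
    ultimately show ?thesis by simp
  qed
  moreover have "v C1_differentiable_on UNIV"
  proof -
    have "continuous_on UNIV w" using w by (meson continuous_at_imp_continuous_on has_vector_derivative_continuous)
    then have "continuous_on UNIV (\<lambda>t. (t, w t))" by (intro continuous_intros)
    from continuous_on_compose2[OF cont this] have "continuous_on UNIV (\<lambda>t. f t (w t))" by simp
    then show ?thesis unfolding C1_differentiable_on_def using v by (intro exI[of _ "\<lambda>t. f t (w t)"]) simp
  qed
  ultimately have C2: "w \<in> C2_periodic m" unfolding C2_periodic_def using w by blast
  have "vector_derivative w (at t) = v t" for t using w by (rule vector_derivative_at)
  then have sol: "is_solution f w"
    unfolding is_solution_def using vector_derivative_at[OF v] by simp
  have r': "r = 1 \<or> r = -1" using r by blast
  have c': "c \<in> {0..<int m}" using c m by auto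
  have only': "int d dvd j" if "y = 1 \<or> y = (-1::int)" "\<And>t. w (t + 2 * pi * of_int j) = of_int y *\<^sub>R w t" for j y
    using that by (intro only) (force simp: shift_sym_def)
  have "stabilizer (symgroup m) sym_act w = generate (symgroup m) {(rot [^]\<^bsub>dihedral m\<^esub> d, r), ((c, True), x)}"
    by (rule stabilizer_eq_generate[where u = w, OF m1(1) d(1) C2 nz r' x c' rot refl only'])
  then show ?thesis using admits_orbit_stabilizer[OF m1(2) C2 sol] by simp
qed

text \<open>
  The hypothesis on shifts is asked of all functions with the given symmetry, not of the solution found; it
  holds trivially for \<open>d = 1\<close>.
\<close>

lemma orbit_exists:
  fixes x :: int
  assumes x: "x = 1 \<or> x = -1" and d: "d > 0" and n: "n > 0"
    and \<sigma>: "\<sigma> = 0 \<and> m = n * d \<or> \<sigma> = 1 \<and> m = n * (2 * d)"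
    and index: "odd (\<Sum>\<mu>\<in>neg_spectrum A. eig_mult A \<mu> *
      (if \<sigma> = 0 then jmu m \<mu> div n + (if x = 1 then 1 else 0) else (jmu m \<mu> div n + 1) div 2))"
    and only: "\<And>w t0 j. w t0 \<noteq> (0 :: real ^ 'k) \<Longrightarrow> (\<And>t. w (t + 2 * pi * real d) = (-1) ^ \<sigma> *\<^sub>R w t) \<Longrightarrow>
      shift_sym w j \<Longrightarrow> int d dvd j"
  shows "admits_orbit m f (generate (symgroup m) {(rot [^]\<^bsub>dihedral m\<^esub> d, (-1) ^ \<sigma>), (flip, x)})"
proof -
  have x': "real_of_int x = 1 \<or> real_of_int x = -1" using x by auto
  have "(real_of_int x = 1) = (x = 1)" by simp
  then have "odd (\<Sum>\<mu>\<in>neg_spectrum A. eig_mult A \<mu> *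
      (if \<sigma> = 0 then jmu m \<mu> div n + (if real_of_int x = 1 then 1 else 0) else (jmu m \<mu> div n + 1) div 2))"
    using index by (simp only: simp_thms)
  from symmetric_solution_exists[OF x' d n \<sigma> this] obtain w v t0 where
    w: "\<And>t. (w has_vector_derivative v t) (at t)" "\<And>t. (v has_vector_derivative f t (w t)) (at t)"
    "\<And>t. w (- t) = of_int x *\<^sub>R w t" "\<And>t. w (t + 2 * pi * real d) = (-1) ^ \<sigma> *\<^sub>R w t" "w t0 \<noteq> 0"
    unfolding has_sym_solution_def by blast
  have dm: "d dvd m" using \<sigma> by auto
  have "(-1) ^ \<sigma> = (1::int) \<or> (-1) ^ \<sigma> = (-1::int) \<and> even (m div d)"
    using \<sigma> d by auto
  then show ?thesis
    unfolding flip_def using w only[OF w(5,4)]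
    by (intro admits_orbit_generated[where w = w and v = v and b = t0 and c = 0 and d = d, OF w(1,2) d dm _ x]) auto
qed

end

lemma has_vector_derivative_shift:
  fixes w :: "real \<Rightarrow> 'v::real_normed_vector"
  assumes "\<And>t. (w has_vector_derivative v t) (at t)"
  shows "((\<lambda>t. w (t + c)) has_vector_derivative v (t + c)) (at t)"
proof -
  have "((\<lambda>t. t + c) has_vector_derivative 1) (at t)"
    by (auto intro!: derivative_eq_intros)
  from vector_diff_chain_at[OF this assms] show ?thesis by (simp add: o_def)
qed

theorem theorem2p11:
  fixes m s :: nat and p \<epsilon> :: "nat \<Rightarrow> nat"
    and M :: real
    and f :: "real \<Rightarrow> real ^ 'k \<Rightarrow> real ^ 'k"
    and A :: "real ^ 'k ^ 'k"
  assumes "m \<ge> 3" and "M > 0"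
    and "continuous_on UNIV (\<lambda>(t, x). f t x)"
    and "\<And>t x. f (t + 2 * pi) x = f t x"
    and "\<And>t x. f (- t) x = f t x"
    and "\<And>t x. f t (- x) = - f t x"
    and "transpose A = A"
    and "uniform_limit UNIV (\<lambda>x t. (f t x - A *v x) /\<^sub>R norm x) (\<lambda>t. 0) (at 0)"
    and "\<And>(j::nat) \<mu>. \<mu> \<in> real_spectrum A \<Longrightarrow> (real j)\<^sup>2 / (real m)\<^sup>2 + \<mu> \<noteq> 0"
    and "\<And>t x. norm x \<ge> M \<Longrightarrow> f t x \<bullet> x > 0"
    and "m = 2 ^ \<epsilon> 0 * (\<Prod>l=1..s. p l ^ \<epsilon> l)"
    and "\<And>l. l \<in> {1..s} \<Longrightarrow> prime (p l) \<and> 2 < p l \<and> 0 < \<epsilon> l"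
    and "strict_mono_on {1..s} p"
  shows "(odd (rho m A 0) \<longrightarrow> admits_orbit m f (D_sub m m)) \<and>
    (odd (rho m A (ss_idx m)) \<longrightarrow> admits_orbit m f (Dz_sub m m)) \<and>
    (\<forall>l\<in>{1..s}. odd (rho m A (m div p l)) \<longrightarrow>
        admits_orbit m f (Dz_sub m (m div p l)) \<or> admits_orbit m f (Dz_sub m m)) \<and>
    (\<epsilon> 0 > 0 \<and> odd (rho m A (ss_idx m + 1)) \<longrightarrow> admits_orbit m f (Dd_sub m m)) \<and>
    (\<epsilon> 0 > 0 \<and> odd (rho m A (ss_idx m + 2)) \<longrightarrow> admits_orbit m f (Ddhat_sub m m)) \<and>
    (\<forall>q. \<epsilon> 0 > 0 \<and> 2 \<le> q \<and> q \<le> \<epsilon> 0 \<and> odd (rho m A (m div 2 ^ q)) \<longrightarrow>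
        admits_orbit m f (Dd_sub m (m div 2 ^ (q - 1))) \<and>
        admits_orbit m f (Ddtilde_sub m (m div 2 ^ (q - 1))))"
proof -
  interpret forced_system m M f A
    by unfold_locales (fact assms)+
  have m0: "m > 0" "m > 1" using m by simp_all
  have mm: "m div m = 1" using m0 by simp
  have pow_dvd: "2 ^ q dvd m" if "q \<le> \<epsilon> 0" for q
    using assms(11) that by (metis dvd_mult2 le_imp_power_dvd)
  have p_dvd: "p l dvd m" if "l \<in> {1..s}" for l
  proof -
    have "p l dvd p l ^ \<epsilon> l" using assms(12)[OF that] by (simp add: dvd_power)
    also have "\<dots> dvd (\<Prod>l=1..s. p l ^ \<epsilon> l)" using that by (intro dvd_prodI) auto
    finally show ?thesis using assms(11) by simp
  qed
  have two: "\<epsilon> 0 > 0 \<Longrightarrow> m = m div 2 * (2 * 1) \<and> m div 2 > 0"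
    using pow_dvd[of 1] m0 by auto
  have i: "admits_orbit m f (D_sub m m)" if "odd (rho m A 0)"
    using orbit_exists[of 1 1 m 0] that m0 by (simp add: D_sub_def mm rho_zero)
  have ii: "admits_orbit m f (Dz_sub m m)" if "odd (rho m A (ss_idx m))"
    using orbit_exists[of "-1" 1 m 0] that m0 by (simp add: Dz_sub_def mm rho_ss_idx)
  have iv: "admits_orbit m f (Dd_sub m m)" if "\<epsilon> 0 > 0" "odd (rho m A (ss_idx m + 1))"
    using orbit_exists[of 1 1 "m div 2" 1] that m0 two rho_half[of m "m div 2" "ss_idx m + 1" A]
    by (simp add: Dd_sub_def mm)
  have v: "admits_orbit m f (Ddhat_sub m m)" if "\<epsilon> 0 > 0" "odd (rho m A (ss_idx m + 2))"
    using orbit_exists[of "-1" 1 "m div 2" 1] that m0 two rho_half[of m "m div 2" "ss_idx m + 2" A]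
    by (simp add: Ddhat_sub_def mm)
  have iii: "admits_orbit m f (Dz_sub m (m div p l)) \<or> admits_orbit m f (Dz_sub m m)"
    if l: "l \<in> {1..s}" and odd: "odd (rho m A (m div p l))" for l
  proof (cases "odd (rho m A (ss_idx m))")
    case True
    then show ?thesis using ii by blast
  next
    case False
    define P where "P = p l"
    define n where "n = m div P"
    have P: "prime P" "P \<ge> 3" "P > 0" using assms(12)[OF l] by (auto simp: P_def)
    have mnP: "m = n * P" using p_dvd[OF l] by (simp add: n_def P_def)
    have n: "n > 0" using mnP m0 by (cases n) auto
    have "odd (\<Sum>\<mu>\<in>neg_spectrum A. eig_mult A \<mu> * (jmu m \<mu> div n))"
      using rho_prime_cofactor[OF n P(1,2) mnP, of A] odd False unfolding n_def P_def by presburger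
    then have "has_sym_solution f (-1) 0 (2 * pi * real P)"
      using P n mnP by (intro symmetric_solution_exists[where n = n]) auto
    then obtain w v t0 where w: "\<And>t. (w has_vector_derivative v t) (at t)" "\<And>t. (v has_vector_derivative f t (w t)) (at t)"
      "\<And>t. w (- t) = - w t" "\<And>t. w (t + 2 * pi * real P) = w t" "w t0 \<noteq> 0"
      by (auto simp: has_sym_solution_def)
    have mn: "m div n = P" using mnP n by simp
    \<comment> \<open>Here the isotropy group depends on the solution: since \<open>P\<close> is odd, sign invariance under the shift by
      \<open>2\<pi>\<close> upgrades the solution to period \<open>2\<pi>\<close>.\<close>
    show ?thesis
    proof (cases "shift_sym w 1")
      case True
      then obtain y where y: "y \<in> {1, -1::real}" "\<And>t. w (t + 2 * pi) = y *\<^sub>R w t"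
        by (auto simp only: shift_sym_def of_int_1 mult_1_right)
      have "odd P" using P prime_odd_nat by auto
      have "w (t0 + real P * (2 * pi)) = y ^ P *\<^sub>R w t0"
        by (rule shift_power) (rule y(2))
      then have "w t0 = y ^ P *\<^sub>R w t0" using w(4)[of t0] by (simp add: mult_ac)
      then have "y ^ P = 1" using w(5) by (metis scaleR_cancel_right scaleR_one)
      then have "y = 1" using y(1) \<open>odd P\<close> by auto
      then have "admits_orbit m f (generate (symgroup m) {(rot [^]\<^bsub>dihedral m\<^esub> (1::nat), 1), ((0, True), -1)})"
        using w y by (intro admits_orbit_generated[where w = w and v = v and b = t0, OF w(1,2)]) auto
      then show ?thesis by (simp add: Dz_sub_def mm flip_def)
    next
      case False
      have "int P dvd j" if j: "shift_sym w j" for j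
      proof (rule ccontr)
        assume "\<not> int P dvd j"
        then have "gcd (int P) j = 1"
          using P(1) by (metis prime_imp_coprime_int prime_nat_int_transfer coprime_iff_gcd_eq_1)
        moreover have "shift_sym w (int P)" unfolding shift_sym_def using w(4) by (intro bexI[of _ 1]) auto
        ultimately show False using shift_sym_gcd[OF _ j] False by metis
      qed
      then have "admits_orbit m f (generate (symgroup m) {(rot [^]\<^bsub>dihedral m\<^esub> P, 1), ((0, True), -1)})"
        using w P mnP by (intro admits_orbit_generated[where w = w and v = v and b = t0, OF w(1,2)]) auto
      then show ?thesis using mn by (simp add: Dz_sub_def flip_def n_def P_def)
    qed
  qed
  have vi: "admits_orbit m f (Dd_sub m (m div 2 ^ (q - 1))) \<and> admits_orbit m f (Ddtilde_sub m (m div 2 ^ (q - 1)))"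
    if q: "2 \<le> q" "q \<le> \<epsilon> 0" and odd: "odd (rho m A (m div 2 ^ q))" for q
  proof -
    define n where "n = m div 2 ^ q"
    define d where "d = (2::nat) ^ (q - 1)"
    have q2: "(2::nat) ^ q = 2 * d" using q(1) power_Suc[of "2::nat" "q - 1"] by (simp add: d_def)
    have mn: "m = n * 2 ^ q" using pow_dvd[OF q(2)] by (simp add: n_def)
    then have mn': "m = n * (2 * d)" by (simp only: q2)
    have n: "n > 0" using mn m0 by (cases n) auto
    have d: "d > 0" by (simp add: d_def)
    have "m = d * (2 * n)" using mn' by (simp add: mult_ac)
    then have "m div d = 2 * n" using d by simp
    moreover have "m div (2 * n) = d" using mn' n by (simp add: mult_ac)
    ultimately have md: "m div (m div d) = d" by simp
    have index: "odd (\<Sum>\<mu>\<in>neg_spectrum A. eig_mult A \<mu> * ((jmu m \<mu> div n + 1) div 2))"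
      using odd rho_two_power_cofactor[OF n q(1) mn, of A] by (simp add: n_def)
    have only: "int d dvd j" if "w t0 \<noteq> (0 :: real ^ 'k)" "\<And>t. w (t + 2 * pi * real d) = - w t" "shift_sym w j" for w t0 j
      using antiperiodic_two_power_shift_sym[of w "q - 1" t0 j] that by (simp add: d_def)
    have "admits_orbit m f (generate (symgroup m) {(rot [^]\<^bsub>dihedral m\<^esub> d, (-1) ^ 1), (flip, 1)})"
      using n d mn' index only by (intro orbit_exists[where n = n]) auto
    then have 1: "admits_orbit m f (Dd_sub m (m div d))" by (simp add: Dd_sub_def md)
    interpret shifted: forced_system m M "\<lambda>t. f (t - pi)" A by (rule forced_system_shift)
    have "has_sym_solution (\<lambda>t. f (t - pi)) 1 1 (2 * pi * real d)"
      using n d mn' index by (intro shifted.symmetric_solution_exists[where n = n]) auto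
    then obtain w v t0 where w: "\<And>t. (w has_vector_derivative v t) (at t)" "\<And>t. (v has_vector_derivative f (t - pi) (w t)) (at t)"
      "\<And>t. w (- t) = w t" "\<And>t. w (t + 2 * pi * real d) = - w t" "w t0 \<noteq> 0"
      by (auto simp: has_sym_solution_def)
    define u where "u = (\<lambda>t. w (t + pi))"
    have u1: "(u has_vector_derivative v (t + pi)) (at t)" for t
      unfolding u_def by (rule has_vector_derivative_shift[OF w(1)])
    have u2: "((\<lambda>t. v (t + pi)) has_vector_derivative f t (u t)) (at t)" for t
      using has_vector_derivative_shift[OF w(2), of pi t] by (simp add: u_def)
    have u3: "u (t + 2 * pi * real d) = - u t" for t
      using w(4)[of "t + pi"] by (simp add: u_def algebra_simps)
    have u4: "u (- (t + 2 * pi)) = u t" for t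
      using w(3)[of "t + pi"] by (simp add: u_def algebra_simps)
    have u5: "u (t0 - pi) \<noteq> 0" using w(5) by (simp add: u_def)
    have dvd: "d dvd m" "even (m div d)" using mn' \<open>m div d = 2 * n\<close> by auto
    have "admits_orbit m f (generate (symgroup m) {(rot [^]\<^bsub>dihedral m\<^esub> d, -1), ((1, True), 1)})"
      using u3 u4 only[of u, OF u5 u3] dvd
      by (intro admits_orbit_generated[where w = u and b = "t0 - pi", OF u1 u2 d _ _ _ _ _ _ u5]) auto
    moreover have "rot \<otimes>\<^bsub>dihedral m\<^esub> flip = (1, True)"
      using m by (simp add: dihedral_def rot_def flip_def)
    ultimately have 2: "admits_orbit m f (Ddtilde_sub m (m div d))" by (simp add: Ddtilde_sub_def md)
    show ?thesis using 1 2 by (simp add: d_def)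
  qed
  show ?thesis using i ii iii iv v vi by blast
qed

end
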